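(* Let $S$ be a self-adjoint restriction of $T_{\max}$ (with separated boundary conditions if $\tau$ is in the limit-circle case at both endpoints), fix $x_0\in(a,b)$ and $\varphi_a\in[0,\pi)$, and let $\theta_z,\phi_z$, the matrix measure $\Omega$ and the isometry $\mathcal F:L^2((a,b);r(x)dx)\to L^2(\mathbb R;d\Omega)$ be the associated objects. Then $\mathcal F$ is unitary with inverse given by $$\mathcal F^{-1}g(x)=\lim_{N\to\infty}\int_{[-N,N)}g(\lambda)\begin{pmatrix}\theta_\lambda(x)\\\phi_\lambda(x)\end{pmatrix}d\Omega(\lambda),\quad g\in L^2(\mathbb R;d\Omega),$$ where the limit exists in $L^2((a,b);r(x)dx)$. Moreover, $S=\mathcal F^*\mathrm M_{\mathrm{id}}\mathcal F$, where $\mathrm M_{\mathrm{id}}$ is the maximally defined operator of multiplication by $\lambda$ in $L^2(\mathbb R;d\Omega)$.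
   Context: Setting. $(a,b)\subseteq\mathbb R$ is an open interval (possibly unbounded); $p,q,r,s$ are Lebesgue measurable and real-valued a.e. on $(a,b)$, with $p^{-1},q,r,s\in L^1_{\mathrm{loc}}((a,b);dx)$, $r>0$ and $p\neq0$ a.e. For $f\in AC_{\mathrm{loc}}((a,b))$ put $f^{[1]}=p(f'+sf)$, $\mathfrak D_\tau=\{f\in AC_{\mathrm{loc}}((a,b)) : f^{[1]}\in AC_{\mathrm{loc}}((a,b))\}$, and $\tau f=\frac1r\big(-(f^{[1]})'+sf^{[1]}+qf\big)$ for $f\in\mathfrak D_\tau$. The Wronskian is $W(f,g)=fg^{[1]}-f^{[1]}g$; its limits at an endpoint exist whenever $f,g\in\mathfrak D_\tau$ and $f,\tau f,g,\tau g$ lie in $L^2$ near that endpoint. In $L^2((a,b);r(x)dx)$ the maximal operator is $T_{\max}f=\tau f$, $\operatorname{dom}(T_{\max})=\{g\in L^2((a,b);r\,dx): g\in\mathfrak D_\tau,\ \tau g\in L^2((a,b);r\,dx)\}$. A function lies in $L^2$ near $a$ (resp. $b$) if it lies in $L^2((a,c);r\,dx)$ (resp. $L^2((c,b);r\,dx)$) for each $c\in(a,b)$. $\tau$ is in the limit-circle case at an endpoint if for each $z\in\mathbb C$ all solutions of $(\tau-z)u=0$ lie in $L^2$ near that endpoint, and in the limit-point case if for each $z\in\mathbb C$ some solution does not. Form of $S$. $S$ is $\tau$ restricted to those $g\in\operatorname{dom}(T_{\max})$ which satisfy, at each limit-circle endpoint $c$, the boundary condition $W(g,\overline{v_c})(c)=0$,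 where $v_c\in\operatorname{dom}(T_{\max})$ is fixed with $W(v_c,\overline{v_c})(c)=0$ and $W(h,\overline{v_c})(c)\neq0$ for some $h\in\operatorname{dom}(T_{\max})$; no condition at limit-point endpoints. Fundamental system and Weyl functions. $\theta_z,\phi_z$ are the solutions of $(\tau-z)u=0$ with $\theta_z(x_0)=\phi_z^{[1]}(x_0)=\cos\varphi_a$ and $-\theta_z^{[1]}(x_0)=\phi_z(x_0)=\sin\varphi_a$. For $z\in\mathbb C\setminus\mathbb R$ the numbers $m_\pm(z)$ are determined by requiring that $\psi_{z,\pm}=\theta_z\pm m_\pm(z)\phi_z$ satisfy: $\psi_{z,-}$ lies in $L^2$ near $a$ and satisfies the boundary condition of $S$ at $a$ if $\tau$ is limit-circle at $a$; $\psi_{z,+}$ lies in $L^2$ near $b$ and satisfies the boundary condition of $S$ at $b$ if $\tau$ is limit-circle at $b$. The functions $m_\pm$ are Nevanlinna–Herglotz functions. Put $$M(z)=\begin{pmatrix}-\frac1{m_+(z)+m_-(z)}&\frac12\frac{m_-(z)-m_+(z)}{m_+(z)+m_-(z)}\\ \frac12\frac{m_-(z)-m_+(z)}{m_+(z)+m_-(z)}&\frac{m_-(z)m_+(z)}{m_+(z)+m_-(z)}\end{pmatrix},\quad z\in\mathbb C\setminus\mathbb R,$$ a matrix-valued Nevanlinna–Herglotz function. $\Omega$ is the associated self-adjoint (nonnegative) $2\times2$ matrix-valued measure, $$\Omega((\lambda_1,\lambda_2])=\lim_{\delta\downarrow0}\lim_{\varepsilon\downarrow0}\frac1\pi\int_{\lambda_1+\delta}^{\lambda_2+\delta}\operatorname{Im}\big(M(\lambda+i\varepsilon)\big)d\lambda,\quad\lambda_1<\lambda_2,$$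 $\Omega^{\mathrm{tr}}=\Omega_{1,1}+\Omega_{2,2}$, and $R_{i,j}$ is the density of $\Omega_{i,j}$ with respect to $\Omega^{\mathrm{tr}}$. $L^2(\mathbb R;d\Omega)$ is the Hilbert space of $\mathbb C^2$-valued functions with inner product $\langle\hat f,\hat g\rangle_\Omega=\int_{\mathbb R}\sum_{i,j=1}^2\hat f_i(\lambda)R_{i,j}(\lambda)\overline{\hat g_j(\lambda)}\,d\Omega^{\mathrm{tr}}(\lambda)$, and likewise $\int g\begin{pmatrix}\theta_\lambda(x)\\\phi_\lambda(x)\end{pmatrix}d\Omega=\int\big(\sum_{i}g_iR_{i,1}\,\theta_\lambda(x)+\sum_ig_iR_{i,2}\,\phi_\lambda(x)\big)d\Omega^{\mathrm{tr}}$. For $f\in L^2((a,b);r\,dx)$ with compact support, $\hat f(\lambda)=\Big(\int_a^b\theta_\lambda(x)f(x)r(x)dx,\ \int_a^b\phi_\lambda(x)f(x)r(x)dx\Big)^\top$; one has $\langle E((\lambda_1,\lambda_2])f,g\rangle=\langle\chi_{(\lambda_1,\lambda_2]}\hat f,\hat g\rangle_\Omega$ for compactly supported $f,g$, with $E$ the spectral measure of $S$ (may be taken as known), and $\mathcal F$ is the unique isometric extension of $f\mapsto\hat f$ to $L^2((a,b);r\,dx)$. *)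

theory Defs
  imports "HOL-Analysis.Analysis"
begin

text \<open>Functions on the interval are total functions on the reals of which only the restriction to
  the interval matters; elements of an L2 space are represented by functions, and identities between
  such elements hold almost everywhere.\<close>

definition L1_loc :: "real set \<Rightarrow> (real \<Rightarrow> real) \<Rightarrow> bool" where
  "L1_loc I f \<longleftrightarrow> (\<forall>K. compact K \<and> K \<subseteq> I \<longrightarrow> set_integrable lebesgue K f)"

definition AC_on :: "real \<Rightarrow> real \<Rightarrow> (real \<Rightarrow> complex) \<Rightarrow> bool" where
  "AC_on c d f \<longleftrightarrow>
     (\<forall>\<epsilon>>0. \<exists>\<delta>>0. \<forall>(n::nat) (u::nat \<Rightarrow> real) (v::nat \<Rightarrow> real).
        (\<forall>k<n. c \<le> u k \<and> u k \<le> v k \<and> v k \<le> d) \<longrightarrow>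
        disjoint_family_on (\<lambda>k. {u k<..<v k}) {..<n} \<longrightarrow>
        (\<Sum>k<n. v k - u k) < \<delta> \<longrightarrow>
        (\<Sum>k<n. cmod (f (v k) - f (u k))) < \<epsilon>)"

definition AC_loc :: "real set \<Rightarrow> (real \<Rightarrow> complex) \<Rightarrow> bool" where
  "AC_loc I f \<longleftrightarrow> (\<forall>c d. c \<le> d \<longrightarrow> {c..d} \<subseteq> I \<longrightarrow> AC_on c d f)"

record sturm_liouville =
  lft :: ereal
  rgt :: ereal
  coef_p :: "real \<Rightarrow> real"
  coef_q :: "real \<Rightarrow> real"
  coef_r :: "real \<Rightarrow> real"
  coef_s :: "real \<Rightarrow> real"

definition dom_int :: "sturm_liouville \<Rightarrow> real set" where
  "dom_int L = einterval (lft L) (rgt L)"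

definition sl_coefficients :: "sturm_liouville \<Rightarrow> bool" where
  "sl_coefficients L \<longleftrightarrow>
     lft L < rgt L \<and>
     coef_p L \<in> borel_measurable (lebesgue_on (dom_int L)) \<and>
     coef_q L \<in> borel_measurable (lebesgue_on (dom_int L)) \<and>
     coef_r L \<in> borel_measurable (lebesgue_on (dom_int L)) \<and>
     coef_s L \<in> borel_measurable (lebesgue_on (dom_int L)) \<and>
     L1_loc (dom_int L) (\<lambda>x. 1 / coef_p L x) \<and>
     L1_loc (dom_int L) (coef_q L) \<and>
     L1_loc (dom_int L) (coef_r L) \<and>
     L1_loc (dom_int L) (coef_s L) \<and>
     (AE x in lebesgue_on (dom_int L). coef_r L x > 0) \<and>
     (AE x in lebesgue_on (dom_int L). coef_p L x \<noteq> 0)"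

text \<open>The quasi-derivative is given almost everywhere by the formula
  \<open>p (f' + s f)\<close>; \<open>quasi_deriv\<close> is its absolutely continuous version, which is unique on the interval.\<close>

definition is_quasi_deriv :: "sturm_liouville \<Rightarrow> (real \<Rightarrow> complex) \<Rightarrow> (real \<Rightarrow> complex) \<Rightarrow> bool" where
  "is_quasi_deriv L f g \<longleftrightarrow>
     AC_loc (dom_int L) g \<and>
     (AE x in lebesgue_on (dom_int L).
        g x = of_real (coef_p L x) * (vector_derivative f (at x) + of_real (coef_s L x) * f x))"

definition D_tau :: "sturm_liouville \<Rightarrow> (real \<Rightarrow> complex) set" where
  "D_tau L = {f. AC_loc (dom_int L) f \<and> (\<exists>g. is_quasi_deriv L f g)}"

definition quasi_deriv :: "sturm_liouville \<Rightarrow> (real \<Rightarrow> complex) \<Rightarrow> real \<Rightarrow> complex" where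
  "quasi_deriv L f = (SOME g. is_quasi_deriv L f g)"

definition tau :: "sturm_liouville \<Rightarrow> (real \<Rightarrow> complex) \<Rightarrow> real \<Rightarrow> complex" where
  "tau L f x = 1 / of_real (coef_r L x) *
     (- vector_derivative (quasi_deriv L f) (at x)
      + of_real (coef_s L x) * quasi_deriv L f x + of_real (coef_q L x) * f x)"

definition is_solution :: "sturm_liouville \<Rightarrow> complex \<Rightarrow> (real \<Rightarrow> complex) \<Rightarrow> bool" where
  "is_solution L z u \<longleftrightarrow> u \<in> D_tau L \<and> (AE x in lebesgue_on (dom_int L). tau L u x = z * u x)"

definition wronskian ::
    "sturm_liouville \<Rightarrow> (real \<Rightarrow> complex) \<Rightarrow> (real \<Rightarrow> complex) \<Rightarrow> real \<Rightarrow> complex" where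
  "wronskian L f g x = f x * quasi_deriv L g x - quasi_deriv L f x * g x"

definition L2 :: "'a measure \<Rightarrow> ('a \<Rightarrow> complex) set" where
  "L2 M = {f. f \<in> borel_measurable M \<and> integrable M (\<lambda>x. (cmod (f x))\<^sup>2)}"

definition L2_inner :: "'a measure \<Rightarrow> ('a \<Rightarrow> complex) \<Rightarrow> ('a \<Rightarrow> complex) \<Rightarrow> complex" where
  "L2_inner M f g = (\<integral>x. f x * cnj (g x) \<partial>M)"

definition L2_norm :: "'a measure \<Rightarrow> ('a \<Rightarrow> complex) \<Rightarrow> real" where
  "L2_norm M f = sqrt (\<integral>x. (cmod (f x))\<^sup>2 \<partial>M)"

text \<open>An operator is represented by its graph, closed under almost everywhere equality.\<close>

type_synonym 'a l2_operator = "(('a \<Rightarrow> complex) \<times> ('a \<Rightarrow> complex)) set"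

definition densely_defined :: "'a measure \<Rightarrow> 'a l2_operator \<Rightarrow> bool" where
  "densely_defined M T \<longleftrightarrow>
     (\<forall>f\<in>L2 M. \<forall>\<epsilon>>0. \<exists>g\<in>Domain T. L2_norm M (\<lambda>x. f x - g x) < \<epsilon>)"

definition adjoint_operator :: "'a measure \<Rightarrow> 'a l2_operator \<Rightarrow> 'a l2_operator" where
  "adjoint_operator M T = {(g, k). g \<in> L2 M \<and> k \<in> L2 M \<and>
     (\<forall>(f, h)\<in>T. L2_inner M h g = L2_inner M f k)}"

definition self_adjoint_operator :: "'a measure \<Rightarrow> 'a l2_operator \<Rightarrow> bool" where
  "self_adjoint_operator M T \<longleftrightarrow> densely_defined M T \<and> T = adjoint_operator M T"

definition orthogonal_projection ::
    "'a measure \<Rightarrow> (('a \<Rightarrow> complex) \<Rightarrow> ('a \<Rightarrow> complex)) \<Rightarrow> bool" where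
  "orthogonal_projection M P \<longleftrightarrow>
     (\<forall>f\<in>L2 M. P f \<in> L2 M) \<and>
     (\<forall>f\<in>L2 M. \<forall>g\<in>L2 M. \<forall>c d.
        AE x in M. P (\<lambda>y. c * f y + d * g y) x = c * P f x + d * P g x) \<and>
     (\<forall>f\<in>L2 M. AE x in M. P (P f) x = P f x) \<and>
     (\<forall>f\<in>L2 M. \<forall>g\<in>L2 M. L2_inner M (P f) g = L2_inner M f (P g))"

definition projection_valued_measure ::
    "'a measure \<Rightarrow> (real set \<Rightarrow> ('a \<Rightarrow> complex) \<Rightarrow> ('a \<Rightarrow> complex)) \<Rightarrow> bool" where
  "projection_valued_measure M E \<longleftrightarrow>
     (\<forall>B\<in>sets borel. orthogonal_projection M (E B)) \<and>
     (\<forall>f\<in>L2 M. AE x in M. E UNIV f x = f x) \<and>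
     (\<forall>f\<in>L2 M. \<forall>A::nat \<Rightarrow> real set. range A \<subseteq> sets borel \<longrightarrow> disjoint_family A \<longrightarrow>
        (\<lambda>n. L2_norm M (\<lambda>x. (\<Sum>k<n. E (A k) f x) - E (\<Union>k. A k) f x)) \<longlonglongrightarrow> 0)"

definition scalar_spectral_measure ::
    "'a measure \<Rightarrow> (real set \<Rightarrow> ('a \<Rightarrow> complex) \<Rightarrow> ('a \<Rightarrow> complex)) \<Rightarrow> ('a \<Rightarrow> complex) \<Rightarrow> real measure"
  where
  "scalar_spectral_measure M E f =
     measure_of UNIV (sets borel) (\<lambda>B. ennreal (Re (L2_inner M (E B f) f)))"

text \<open>\<open>T\<close> is the integral of the identity function with respect to \<open>E\<close>: its domain consists of all
  \<open>f\<close> for which the identity function is square integrable with respect to the scalar spectral measure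
  of \<open>f\<close>, and its action is given through the quadratic form, which determines it by polarization.\<close>

definition spectral_measure_of ::
    "'a measure \<Rightarrow> 'a l2_operator \<Rightarrow> (real set \<Rightarrow> ('a \<Rightarrow> complex) \<Rightarrow> ('a \<Rightarrow> complex)) \<Rightarrow> bool" where
  "spectral_measure_of M T E \<longleftrightarrow>
     projection_valued_measure M E \<and>
     Domain T = {f \<in> L2 M. integrable (scalar_spectral_measure M E f) (\<lambda>t. t\<^sup>2)} \<and>
     (\<forall>(f, h)\<in>T. L2_inner M h f = of_real (\<integral>t. t \<partial>scalar_spectral_measure M E f))"

definition weighted :: "sturm_liouville \<Rightarrow> real set \<Rightarrow> real measure" where
  "weighted L A = density (lebesgue_on A) (\<lambda>x. ennreal (coef_r L x))"

abbreviation weight_measure :: "sturm_liouville \<Rightarrow> real measure" where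
  "weight_measure L \<equiv> weighted L (dom_int L)"

definition dom_max :: "sturm_liouville \<Rightarrow> (real \<Rightarrow> complex) set" where
  "dom_max L = {g \<in> L2 (weight_measure L). g \<in> D_tau L \<and> tau L g \<in> L2 (weight_measure L)}"

datatype endpoint = Left_End | Right_End

fun near_endpoint :: "sturm_liouville \<Rightarrow> endpoint \<Rightarrow> real \<Rightarrow> real set" where
  "near_endpoint L Left_End c = einterval (lft L) (ereal c)"
| "near_endpoint L Right_End c = einterval (ereal c) (rgt L)"

fun endpoint_filter :: "sturm_liouville \<Rightarrow> endpoint \<Rightarrow> ereal filter" where
  "endpoint_filter L Left_End = at_right (lft L)"
| "endpoint_filter L Right_End = at_left (rgt L)"

definition L2_near :: "sturm_liouville \<Rightarrow> endpoint \<Rightarrow> (real \<Rightarrow> complex) \<Rightarrow> bool" where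
  "L2_near L e f \<longleftrightarrow> (\<forall>c\<in>dom_int L. f \<in> L2 (weighted L (near_endpoint L e c)))"

definition limit_circle :: "sturm_liouville \<Rightarrow> endpoint \<Rightarrow> bool" where
  "limit_circle L e \<longleftrightarrow> (\<forall>z u. is_solution L z u \<longrightarrow> L2_near L e u)"

text \<open>\<open>wronskian_conj_at L e f v l\<close>: the Wronskian of \<open>f\<close> and the complex conjugate of \<open>v\<close> has the
  limit \<open>l\<close> at the endpoint \<open>e\<close>.\<close>

definition wronskian_conj_at ::
    "sturm_liouville \<Rightarrow> endpoint \<Rightarrow> (real \<Rightarrow> complex) \<Rightarrow> (real \<Rightarrow> complex) \<Rightarrow> complex \<Rightarrow> bool" where
  "wronskian_conj_at L e f v l \<longleftrightarrow>
     ((wronskian L f (\<lambda>x. cnj (v x)) \<circ> real_of_ereal) \<longlongrightarrow> l) (endpoint_filter L e)"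

text \<open>\<open>v\<close> assigns to each endpoint the function defining the boundary condition there; it is only
  relevant at limit-circle endpoints.\<close>

definition boundary_functions :: "sturm_liouville \<Rightarrow> (endpoint \<Rightarrow> real \<Rightarrow> complex) \<Rightarrow> bool" where
  "boundary_functions L v \<longleftrightarrow> (\<forall>e. limit_circle L e \<longrightarrow>
     v e \<in> dom_max L \<and> wronskian_conj_at L e (v e) (v e) 0 \<and>
     (\<exists>h\<in>dom_max L. \<exists>l. l \<noteq> 0 \<and> wronskian_conj_at L e h (v e) l))"

definition boundary_condition ::
    "sturm_liouville \<Rightarrow> (endpoint \<Rightarrow> real \<Rightarrow> complex) \<Rightarrow> endpoint \<Rightarrow> (real \<Rightarrow> complex) \<Rightarrow> bool" where
  "boundary_condition L v e g \<longleftrightarrow> (limit_circle L e \<longrightarrow> wronskian_conj_at L e g (v e) 0)"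

definition operator_S ::
    "sturm_liouville \<Rightarrow> (endpoint \<Rightarrow> real \<Rightarrow> complex) \<Rightarrow> real l2_operator" where
  "operator_S L v = {(f, h). f \<in> L2 (weight_measure L) \<and> h \<in> L2 (weight_measure L) \<and>
     (\<exists>g\<in>dom_max L. (\<forall>e. boundary_condition L v e g) \<and>
        (AE x in weight_measure L. f x = g x) \<and> (AE x in weight_measure L. h x = tau L g x))}"

definition fundamental_system ::
    "sturm_liouville \<Rightarrow> real \<Rightarrow> real \<Rightarrow> (complex \<Rightarrow> real \<Rightarrow> complex) \<Rightarrow> (complex \<Rightarrow> real \<Rightarrow> complex) \<Rightarrow> bool"
  where
  "fundamental_system L x0 \<alpha> \<theta> \<phi> \<longleftrightarrow> (\<forall>z.
     is_solution L z (\<theta> z) \<and> is_solution L z (\<phi> z) \<and>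
     \<theta> z x0 = of_real (cos \<alpha>) \<and> quasi_deriv L (\<phi> z) x0 = of_real (cos \<alpha>) \<and>
     - quasi_deriv L (\<theta> z) x0 = of_real (sin \<alpha>) \<and> \<phi> z x0 = of_real (sin \<alpha>))"

definition weyl_functions ::
    "sturm_liouville \<Rightarrow> (endpoint \<Rightarrow> real \<Rightarrow> complex) \<Rightarrow>
     (complex \<Rightarrow> real \<Rightarrow> complex) \<Rightarrow> (complex \<Rightarrow> real \<Rightarrow> complex) \<Rightarrow>
     (complex \<Rightarrow> complex) \<Rightarrow> (complex \<Rightarrow> complex) \<Rightarrow> bool" where
  "weyl_functions L v \<theta> \<phi> mminus mplus \<longleftrightarrow> (\<forall>z. z \<notin> \<real> \<longrightarrow>
     (let \<psi>minus = (\<lambda>x. \<theta> z x - mminus z * \<phi> z x);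
          \<psi>plus = (\<lambda>x. \<theta> z x + mplus z * \<phi> z x)
      in L2_near L Left_End \<psi>minus \<and> boundary_condition L v Left_End \<psi>minus \<and>
         L2_near L Right_End \<psi>plus \<and> boundary_condition L v Right_End \<psi>plus))"

definition weyl_matrix ::
    "(complex \<Rightarrow> complex) \<Rightarrow> (complex \<Rightarrow> complex) \<Rightarrow> complex \<Rightarrow> complex^2^2" where
  "weyl_matrix mminus mplus z = vector [
     vector [- 1 / (mplus z + mminus z),
             1 / 2 * ((mminus z - mplus z) / (mplus z + mminus z))],
     vector [1 / 2 * ((mminus z - mplus z) / (mplus z + mminus z)),
             mminus z * mplus z / (mplus z + mminus z)]]"

definition matrix_form :: "complex^2^2 \<Rightarrow> complex^2 \<Rightarrow> complex^2 \<Rightarrow> complex" where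
  "matrix_form A u w = (\<Sum>i\<in>UNIV. \<Sum>j\<in>UNIV. u $ i * A $ i $ j * cnj (w $ j))"

definition matrix_Im :: "complex^2^2 \<Rightarrow> complex^2^2" where
  "matrix_Im A = (\<chi> i j. (A $ i $ j - cnj (A $ j $ i)) / (2 * \<i>))"

text \<open>Matrix-valued measures are finite on bounded Borel sets only; their values on other sets are
  irrelevant.\<close>

definition matrix_measure :: "(real set \<Rightarrow> complex^2^2) \<Rightarrow> bool" where
  "matrix_measure \<Omega> \<longleftrightarrow>
     (\<forall>B. B \<in> sets borel \<longrightarrow> bounded B \<longrightarrow>
        (\<forall>i j. \<Omega> B $ i $ j = cnj (\<Omega> B $ j $ i)) \<and>
        (\<forall>\<xi>. 0 \<le> Re (matrix_form (\<Omega> B) \<xi> \<xi>))) \<and>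
     (\<forall>A::nat \<Rightarrow> real set. range A \<subseteq> sets borel \<longrightarrow> disjoint_family A \<longrightarrow> bounded (\<Union>k. A k) \<longrightarrow>
        (\<lambda>k. \<Omega> (A k)) sums \<Omega> (\<Union>k. A k))"

definition stieltjes_inversion ::
    "(complex \<Rightarrow> complex^2^2) \<Rightarrow> (real set \<Rightarrow> complex^2^2) \<Rightarrow> bool" where
  "stieltjes_inversion W \<Omega> \<longleftrightarrow> (\<forall>t1 t2. t1 < t2 \<longrightarrow> (\<exists>J.
     (\<forall>\<delta>>0. ((\<lambda>\<epsilon>. (1 / pi) *\<^sub>R
          (LBINT t:{t1 + \<delta>..t2 + \<delta>}. matrix_Im (W (of_real t + \<i> * of_real \<epsilon>))))
        \<longlongrightarrow> J \<delta>) (at_right 0)) \<and>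
     (J \<longlongrightarrow> \<Omega> {t1<..t2}) (at_right 0)))"

text \<open>\<open>\<mu>\<close> is the trace measure of \<open>\<Omega>\<close> and \<open>R\<close> the matrix of densities with respect to it.\<close>

definition trace_and_density ::
    "(real set \<Rightarrow> complex^2^2) \<Rightarrow> real measure \<Rightarrow> (real \<Rightarrow> complex^2^2) \<Rightarrow> bool" where
  "trace_and_density \<Omega> \<mu> R \<longleftrightarrow>
     sets \<mu> = sets borel \<and> R \<in> borel_measurable \<mu> \<and>
     (\<forall>B. B \<in> sets borel \<longrightarrow> bounded B \<longrightarrow>
        emeasure \<mu> B = ennreal (Re (trace (\<Omega> B))) \<and>
        set_integrable \<mu> B R \<and> \<Omega> B = (LINT t:B|\<mu>. R t))"

definition L2_matrix :: "real measure \<Rightarrow> (real \<Rightarrow> complex^2^2) \<Rightarrow> (real \<Rightarrow> complex^2) set" where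
  "L2_matrix \<mu> R =
     {g. g \<in> borel_measurable \<mu> \<and> integrable \<mu> (\<lambda>t. matrix_form (R t) (g t) (g t))}"

definition inner_matrix ::
    "real measure \<Rightarrow> (real \<Rightarrow> complex^2^2) \<Rightarrow> (real \<Rightarrow> complex^2) \<Rightarrow> (real \<Rightarrow> complex^2) \<Rightarrow> complex" where
  "inner_matrix \<mu> R g h = (\<integral>t. matrix_form (R t) (g t) (h t) \<partial>\<mu>)"

text \<open>Equality of elements of the L2 space of the matrix measure: the difference has norm zero.\<close>

definition eq_matrix ::
    "real measure \<Rightarrow> (real \<Rightarrow> complex^2^2) \<Rightarrow> (real \<Rightarrow> complex^2) \<Rightarrow> (real \<Rightarrow> complex^2) \<Rightarrow> bool" where
  "eq_matrix \<mu> R g h \<longleftrightarrow>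
     (AE t in \<mu>. matrix_form (R t) (g t - h t) (g t - h t) = 0)"

definition mult_id ::
    "real measure \<Rightarrow> (real \<Rightarrow> complex^2^2) \<Rightarrow> ((real \<Rightarrow> complex^2) \<times> (real \<Rightarrow> complex^2)) set" where
  "mult_id \<mu> R = {(g, k). g \<in> L2_matrix \<mu> R \<and> k \<in> L2_matrix \<mu> R \<and>
     eq_matrix \<mu> R k (\<lambda>t. of_real t *s g t)}"

definition compactly_supported :: "sturm_liouville \<Rightarrow> (real \<Rightarrow> complex) \<Rightarrow> bool" where
  "compactly_supported L f \<longleftrightarrow>
     (\<exists>K. compact K \<and> K \<subseteq> dom_int L \<and> (AE x in weight_measure L. x \<notin> K \<longrightarrow> f x = 0))"

definition transform ::
    "sturm_liouville \<Rightarrow> (complex \<Rightarrow> real \<Rightarrow> complex) \<Rightarrow> (complex \<Rightarrow> real \<Rightarrow> complex) \<Rightarrow>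
     (real \<Rightarrow> complex) \<Rightarrow> real \<Rightarrow> complex^2" where
  "transform L \<theta> \<phi> f t = vector [
     (\<integral>x. \<theta> (of_real t) x * f x \<partial>weight_measure L),
     (\<integral>x. \<phi> (of_real t) x * f x \<partial>weight_measure L)]"

definition isometric ::
    "'a measure \<Rightarrow> real measure \<Rightarrow> (real \<Rightarrow> complex^2^2) \<Rightarrow>
     (('a \<Rightarrow> complex) \<Rightarrow> (real \<Rightarrow> complex^2)) \<Rightarrow> bool" where
  "isometric M \<mu> R F \<longleftrightarrow>
     (\<forall>f\<in>L2 M. F f \<in> L2_matrix \<mu> R) \<and>
     (\<forall>f\<in>L2 M. \<forall>g\<in>L2 M. \<forall>c d. eq_matrix \<mu> R
        (F (\<lambda>x. c * f x + d * g x)) (\<lambda>t. c *s F f t + d *s F g t)) \<and>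
     (\<forall>f\<in>L2 M. inner_matrix \<mu> R (F f) (F f) = L2_inner M f f)"

definition unitary ::
    "'a measure \<Rightarrow> real measure \<Rightarrow> (real \<Rightarrow> complex^2^2) \<Rightarrow>
     (('a \<Rightarrow> complex) \<Rightarrow> (real \<Rightarrow> complex^2)) \<Rightarrow> bool" where
  "unitary M \<mu> R F \<longleftrightarrow> isometric M \<mu> R F \<and>
     (\<forall>g\<in>L2_matrix \<mu> R. \<exists>f\<in>L2 M. eq_matrix \<mu> R (F f) g)"

text \<open>The graph of the Hilbert space adjoint of \<open>F\<close>.\<close>

definition adjoint_transform ::
    "'a measure \<Rightarrow> real measure \<Rightarrow> (real \<Rightarrow> complex^2^2) \<Rightarrow>
     (('a \<Rightarrow> complex) \<Rightarrow> (real \<Rightarrow> complex^2)) \<Rightarrow> ((real \<Rightarrow> complex^2) \<times> ('a \<Rightarrow> complex)) set" where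
  "adjoint_transform M \<mu> R F = {(k, h). k \<in> L2_matrix \<mu> R \<and> h \<in> L2 M \<and>
     (\<forall>u\<in>L2 M. inner_matrix \<mu> R (F u) k = L2_inner M u h)}"

definition isometric_extension ::
    "sturm_liouville \<Rightarrow> (complex \<Rightarrow> real \<Rightarrow> complex) \<Rightarrow> (complex \<Rightarrow> real \<Rightarrow> complex) \<Rightarrow>
     real measure \<Rightarrow> (real \<Rightarrow> complex^2^2) \<Rightarrow>
     ((real \<Rightarrow> complex) \<Rightarrow> (real \<Rightarrow> complex^2)) \<Rightarrow> bool" where
  "isometric_extension L \<theta> \<phi> \<mu> R F \<longleftrightarrow>
     isometric (weight_measure L) \<mu> R F \<and>
     (\<forall>f\<in>L2 (weight_measure L). compactly_supported L f \<longrightarrow>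
        transform L \<theta> \<phi> f \<in> L2_matrix \<mu> R \<and> eq_matrix \<mu> R (F f) (transform L \<theta> \<phi> f))"

definition inversion_integrand ::
    "(complex \<Rightarrow> real \<Rightarrow> complex) \<Rightarrow> (complex \<Rightarrow> real \<Rightarrow> complex) \<Rightarrow> (real \<Rightarrow> complex^2^2) \<Rightarrow>
     (real \<Rightarrow> complex^2) \<Rightarrow> real \<Rightarrow> real \<Rightarrow> complex" where
  "inversion_integrand \<theta> \<phi> R g x t =
     (\<Sum>i\<in>UNIV. g t $ i * R t $ i $ 1) * \<theta> (of_real t) x +
     (\<Sum>i\<in>UNIV. g t $ i * R t $ i $ 2) * \<phi> (of_real t) x"

end

theory Submission
  imports Defs
begin

text \<open>For compactly supported \<open>f\<close> the given formula for \<open>E\<close> shows that \<open>F (E B f)\<close> is the projection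
  of \<open>\<chi>\<^sub>B F f\<close> onto the range of \<open>F\<close>; both have the same norm, so \<open>F (E B f) = \<chi>\<^sub>B F f\<close> and the range is
  invariant under multiplication by indicators of intervals. An element \<open>w\<close> orthogonal to the range is
  therefore pointwise orthogonal, almost everywhere, to the transforms of countably many indicator
  functions, and these span the plane at each \<open>\<lambda>\<close> by linear independence of \<open>\<theta>\<close> and \<open>\<phi>\<close>; so \<open>w = 0\<close>.
  The truncated inversion integral \<open>P\<close> of \<open>g\<close> satisfies \<open>\<langle>P, h\<rangle> = \<langle>\<chi> g, F h\<rangle>\<close> by Fubini, which puts it in
  the Hilbert space with \<open>F P = \<chi> g\<close>; completeness then gives surjectivity and the inversion formula.
  Finally the scalar spectral measure of \<open>f\<close> is the density of \<open>F f\<close> against the matrix measure, so \<open>S\<close>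
  and \<open>F\<^sup>* id F\<close> have the same domain and the same quadratic form, hence coincide by polarization.

  Measurability in \<open>\<lambda>\<close> rests on joint continuity of \<open>\<theta>\<close> and \<open>\<phi>\<close>, obtained from a Gronwall estimate for
  the first order system; passing to that system needs that absolutely continuous functions are
  differentiable almost everywhere and are integrals of their derivatives.\<close>

section \<open>Absolutely continuous functions\<close>

text \<open>Two features of the setting shape the argument. The density matrix \<open>R\<close> may
  be singular, so an element of the target space has many representatives: pointwise orthogonality
  only yields that \<open>R\<close> annihilates the conjugate of \<open>w\<close>, which is exactly
  what norm zero requires. And the transform carries no complex conjugation, so the exchange of
  integrals produces the right inner product only because the fundamental solutions are real for
  real spectral parameter; this comes from uniqueness for a system with real coefficients. Symmetry
  and idempotence of \<open>E\<close> are what make the two norms in the first step equal. The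
  spectral measure describes \<open>S\<close> only by its domain and quadratic form, so polarization
  has to take place inside the graph of \<open>S\<close>; it gives equal pairings against the
  domain, and density of the domain turns these into equality almost everywhere. Differentiability
  almost everywhere is reached by applying Vitali coverings twice, without a decomposition into
  monotone functions.\<close>

text \<open>The intervals are members of a \<open>division_of\<close>, with end points recovered by
  \<open>Inf\<close> and \<open>Sup\<close>, instead of two sequences as in \<open>AC_on\<close>:
  this makes content of divisions, extension of partial divisions and tagged divisions applicable.
  The codomain is arbitrary so that real and imaginary parts fall under it.\<close>

definition AC_division :: "real \<Rightarrow> real \<Rightarrow> (real \<Rightarrow> 'a::real_normed_vector) \<Rightarrow> bool" where
  "AC_division c d f \<longleftrightarrow> (\<forall>\<epsilon>>0. \<exists>\<delta>>0. \<forall>\<D>. \<D> division_of \<Union>\<D> \<longrightarrow> \<Union>\<D> \<subseteq> {c..d} \<longrightarrow>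
     (\<Sum>K\<in>\<D>. measure lebesgue K) < \<delta> \<longrightarrow> (\<Sum>K\<in>\<D>. norm (f (Sup K) - f (Inf K))) < \<epsilon>)"

lemma AC_divisionE:
  assumes "AC_division c d f" "\<epsilon> > 0"
  obtains \<delta> where "\<delta> > 0" "\<And>\<D>. \<lbrakk>\<D> division_of \<Union>\<D>; \<Union>\<D> \<subseteq> {c..d}; (\<Sum>K\<in>\<D>. measure lebesgue K) < \<delta>\<rbrakk> \<Longrightarrow>
     (\<Sum>K\<in>\<D>. norm (f (Sup K) - f (Inf K))) < \<epsilon>"
  using assms(1)[unfolded AC_division_def, rule_format, OF assms(2)] by blast

text \<open>Any enumeration of the finite division serves: its members have disjoint interiors, and
  these are the open intervals that \<open>AC_on\<close> asks to be disjoint.\<close>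

lemma AC_on_imp_AC_division:
  assumes "AC_on c d f" shows "AC_division c d f"
  unfolding AC_division_def
proof (intro allI impI)
  fix \<epsilon> :: real assume "\<epsilon> > 0"
  then obtain \<delta> where "\<delta> > 0" and \<delta>: "\<And>(n::nat) (u::nat \<Rightarrow> real) v. \<lbrakk>\<forall>k<n. c \<le> u k \<and> u k \<le> v k \<and> v k \<le> d;
      disjoint_family_on (\<lambda>k. {u k<..<v k}) {..<n}; (\<Sum>k<n. v k - u k) < \<delta>\<rbrakk> \<Longrightarrow>
      (\<Sum>k<n. cmod (f (v k) - f (u k))) < \<epsilon>"
    using assms[unfolded AC_on_def, rule_format, OF \<open>\<epsilon> > 0\<close>] by (elim exE conjE) (rule that, assumption, simp)
  have "(\<Sum>K\<in>\<D>. norm (f (Sup K) - f (Inf K))) < \<epsilon>"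
    if D: "\<D> division_of \<Union>\<D>" "\<Union>\<D> \<subseteq> {c..d}" "(\<Sum>K\<in>\<D>. measure lebesgue K) < \<delta>" for \<D>
  proof -
    have fin: "finite \<D>" using D(1) by (rule division_of_finite)
    obtain g where g: "bij_betw g {..<card \<D>} \<D>"
      using ex_bij_betw_nat_finite[OF fin] by (auto simp: atLeast0LessThan)
    define u where "u k = Inf (g k)" for k
    define w where "w k = Sup (g k)" for k
    have gk: "g k = {u k..w k}" "u k \<le> w k" "g k \<in> \<D>" if k: "k < card \<D>" for k
    proof -
      show gD: "g k \<in> \<D>" using g k by (auto simp: bij_betw_def)
      then obtain a b where ab: "g k = {a..b}" "g k \<noteq> {}"
        using division_ofD(3,4)[OF D(1)] by (metis box_real(2))
      then have "a \<le> b" by auto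
      then show "g k = {u k..w k}" "u k \<le> w k"
        using ab by (auto simp: u_def w_def)
    qed
    have "(\<Sum>K\<in>\<D>. norm (f (Sup K) - f (Inf K))) = (\<Sum>k<card \<D>. cmod (f (w k) - f (u k)))"
      unfolding u_def w_def by (rule sum.reindex_bij_betw[OF g, symmetric])
    also have "\<dots> < \<epsilon>"
    proof (rule \<delta>)
      show "\<forall>k<card \<D>. c \<le> u k \<and> u k \<le> w k \<and> w k \<le> d"
      proof (intro allI impI)
        fix k assume "k < card \<D>"
        from gk[OF this] have "{u k..w k} \<subseteq> {c..d}" "u k \<le> w k" using D(2) by blast+
        then show "c \<le> u k \<and> u k \<le> w k \<and> w k \<le> d" by auto
      qed
      show "disjoint_family_on (\<lambda>k. {u k<..<w k}) {..<card \<D>}"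
        unfolding disjoint_family_on_def
      proof (intro ballI impI)
        fix k l assume kl: "k \<in> {..<card \<D>}" "l \<in> {..<card \<D>}" "k \<noteq> l"
        then have "g k \<noteq> g l" using g by (auto simp: bij_betw_def inj_on_def)
        then have "interior (g k) \<inter> interior (g l) = {}"
          using division_ofD(5)[OF D(1)] gk kl by (metis lessThan_iff)
        then show "{u k<..<w k} \<inter> {u l<..<w l} = {}"
          using gk(1)[of k] gk(1)[of l] kl by (auto simp: interior_atLeastAtMost_real)
      qed
      have "(\<Sum>k<card \<D>. w k - u k) = (\<Sum>k<card \<D>. measure lebesgue (g k))"
        using gk by (intro sum.cong) auto
      also have "\<dots> = (\<Sum>K\<in>\<D>. measure lebesgue K)"
        by (rule sum.reindex_bij_betw[OF g])
      finally show "(\<Sum>k<card \<D>. w k - u k) < \<delta>" using D(3) by simp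
    qed
    finally show ?thesis .
  qed
  with \<open>\<delta> > 0\<close> show "\<exists>\<delta>>0. \<forall>\<D>. \<D> division_of \<Union>\<D> \<longrightarrow> \<Union>\<D> \<subseteq> {c..d} \<longrightarrow>
     (\<Sum>K\<in>\<D>. measure lebesgue K) < \<delta> \<longrightarrow> (\<Sum>K\<in>\<D>. norm (f (Sup K) - f (Inf K))) < \<epsilon>"
    by blast
qed

text \<open>Applied with \<open>h\<close> the real and the imaginary part, both of which are
  1-Lipschitz.\<close>

lemma AC_division_compose:
  assumes "AC_division c d f" "\<And>x y. norm (h (f x) - h (f y)) \<le> norm (f x - f y)"
  shows "AC_division c d (\<lambda>x. h (f x))"
  unfolding AC_division_def
proof (intro allI impI)
  fix \<epsilon> :: real assume "\<epsilon> > 0"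
  then obtain \<delta> where "\<delta> > 0" and \<delta>: "\<And>\<D>. \<lbrakk>\<D> division_of \<Union>\<D>; \<Union>\<D> \<subseteq> {c..d};
     (\<Sum>K\<in>\<D>. measure lebesgue K) < \<delta>\<rbrakk> \<Longrightarrow> (\<Sum>K\<in>\<D>. norm (f (Sup K) - f (Inf K))) < \<epsilon>"
    using AC_divisionE[OF assms(1) \<open>\<epsilon> > 0\<close>] by blast
  have "(\<Sum>K\<in>\<D>. norm (h (f (Sup K)) - h (f (Inf K)))) \<le> (\<Sum>K\<in>\<D>. norm (f (Sup K) - f (Inf K)))" for \<D>
    by (intro sum_mono assms(2))
  with \<delta> \<open>\<delta> > 0\<close> show "\<exists>\<delta>>0. \<forall>\<D>. \<D> division_of \<Union>\<D> \<longrightarrow> \<Union>\<D> \<subseteq> {c..d} \<longrightarrow>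
     (\<Sum>K\<in>\<D>. measure lebesgue K) < \<delta> \<longrightarrow> (\<Sum>K\<in>\<D>. norm (h (f (Sup K)) - h (f (Inf K)))) < \<epsilon>"
    by (meson order_le_less_trans)
qed

lemma AC_division_continuous_on:
  assumes "AC_division c d f" shows "continuous_on {c..d} f"
  unfolding continuous_on_iff
proof (intro ballI allI impI)
  fix x \<epsilon> :: real assume x: "x \<in> {c..d}" and "\<epsilon> > 0"
  then obtain \<delta> where "\<delta> > 0" and \<delta>: "\<And>\<D>. \<lbrakk>\<D> division_of \<Union>\<D>; \<Union>\<D> \<subseteq> {c..d};
     (\<Sum>K\<in>\<D>. measure lebesgue K) < \<delta>\<rbrakk> \<Longrightarrow> (\<Sum>K\<in>\<D>. norm (f (Sup K) - f (Inf K))) < \<epsilon>"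
    using AC_divisionE[OF assms(1) \<open>\<epsilon> > 0\<close>] by blast
  have *: "norm (f v - f u) < \<epsilon>" if "c \<le> u" "u \<le> v" "v \<le> d" "v - u < \<delta>" for u v
    using \<delta>[of "{{u..v}}"] that division_of_self[of u v] by auto
  have "dist (f y) (f x) < \<epsilon>" if "y \<in> {c..d}" "dist y x < \<delta>" for y
    using *[of x y] *[of y x] that x
    by (cases "x \<le> y") (auto simp: dist_norm norm_minus_commute dist_real_def)
  with \<open>\<delta> > 0\<close> show "\<exists>d'>0. \<forall>y\<in>{c..d}. dist y x < d' \<longrightarrow> dist (f y) (f x) < \<epsilon>" by blast
qed

section \<open>Vitali coverings by intervals\<close>

text \<open>The Vitali theorem gives countably many disjoint intervals that miss only a null set of
  \<open>S\<close>. Their union has finite measure because it lies in \<open>U\<close>, so finitely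
  many of them carry all but \<open>\<eta>\<close> of it; \<open>T\<close> collects both
  losses.\<close>

lemma vitali_finite_division:
  fixes S U :: "real set"
  assumes "open U" "S \<subseteq> U" "U \<in> lmeasurable" "\<eta> > 0"
    and V: "\<And>x d. \<lbrakk>x \<in> S; d > 0\<rbrakk> \<Longrightarrow> \<exists>u v. u < v \<and> v - u < d \<and> x \<in> {u..v} \<and> P u v"
  obtains \<D> T where "\<D> division_of \<Union>\<D>" "disjoint \<D>" "\<Union>\<D> \<subseteq> U" "S \<subseteq> \<Union>\<D> \<union> T" "T \<in> lmeasurable"
    "measure lebesgue T < \<eta>" "\<And>K. K \<in> \<D> \<Longrightarrow> Inf K < Sup K \<and> K = {Inf K..Sup K} \<and> P (Inf K) (Sup K)"
proof -
  \<comment> \<open>The covering theorem speaks of closed balls, so an interval is coded by its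
    midpoint \<open>a\<close> and half-length \<open>r\<close>.\<close>
  define a where "a = (\<lambda>p::real\<times>real. (fst p + snd p) / 2)"
  define r where "r = (\<lambda>p::real\<times>real. (snd p - fst p) / 2)"
  define K where "K = {p. fst p < snd p \<and> {fst p..snd p} \<subseteq> U \<and> P (fst p) (snd p)}"
  have cb: "cball (a p) (r p) = {fst p..snd p}" for p
    by (auto simp: a_def r_def cball_eq_atLeastAtMost field_simps)
  obtain C where C: "countable C" "C \<subseteq> K"
    and pw: "pairwise (\<lambda>i j. disjnt (cball (a i) (r i)) (cball (a j) (r j))) C"
    and neg: "negligible (S - (\<Union>i\<in>C. cball (a i) (r i)))"
  proof (rule Vitali_covering_theorem_cballs[of K r S a])
    show "0 < r i" if "i \<in> K" for i using that by (auto simp: K_def r_def)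
    fix x d :: real assume x: "x \<in> S" "0 < d"
    then obtain e where e: "e > 0" "ball x e \<subseteq> U" using assms(1,2) by (meson openE subsetD)
    \<comment> \<open>Intervals through \<open>x\<close> shorter than \<open>e\<close> stay inside
      \<open>U\<close>.\<close>
    obtain u v where uv: "u < v" "v - u < min d e" "x \<in> {u..v}" "P u v"
      using V[of x "min d e"] x e by auto
    have "{u..v} \<subseteq> ball x e" using uv by (auto simp: dist_real_def)
    then have "(u,v) \<in> K" using uv e by (auto simp: K_def)
    moreover have "x \<in> cball (a (u,v)) (r (u,v))" using uv unfolding cb by auto
    moreover have "r (u,v) < d" using uv by (auto simp: r_def)
    ultimately show "\<exists>i. i \<in> K \<and> x \<in> cball (a i) (r i) \<and> r i < d" by blast
  qed blast
  define I where "I = (\<lambda>p::real\<times>real. {fst p..snd p})"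
  have Im: "I p \<in> lmeasurable" for p by (auto simp: I_def)
  have IU: "I p \<subseteq> U" if "p \<in> C" for p using C that by (auto simp: K_def I_def)
  have disj: "disjoint_family_on I C"
    using pw unfolding cb disjoint_family_on_def pairwise_def disjnt_def I_def by blast
  have Un: "(\<Union>p\<in>C. I p) \<in> lmeasurable"
    by (rule fmeasurableI2[OF assms(3)]) (use IU C fmeasurableD[OF Im] in \<open>auto simp del: UN_simps intro!: sets.countable_UN''\<close>)
  obtain C' where C': "finite C'" "C' \<subseteq> C" "measure lebesgue ((\<Union>p\<in>C. I p) - (\<Union>p\<in>C'. I p)) < \<eta>"
  proof (cases "finite C")
    case True then show ?thesis using that[of C] \<open>\<eta> > 0\<close> by auto
  next
    case False
    define e where "e = from_nat_into C"
    have e: "bij_betw e UNIV C" unfolding e_def using False C by (simp add: bij_betw_from_nat_into)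
    have UC: "(\<Union>p\<in>C. I p) = (\<Union>n. I (e n))" using e by (auto simp: bij_betw_def)
    have dj: "disjoint_family (\<lambda>n. I (e n))"
      using disj e unfolding disjoint_family_on_def bij_betw_def inj_on_def by (metis UNIV_I rangeI)
    \<comment> \<open>Continuity from below along an enumeration of \<open>C\<close> yields the
      finite subfamily.\<close>
    have "(\<lambda>n. measure lebesgue (\<Union>k<n. I (e k))) \<longlonglongrightarrow> measure lebesgue (\<Union>n. \<Union>k<n. I (e k))"
    proof (rule Lim_measure_incseq)
      show "range (\<lambda>n. \<Union>k<n. I (e k)) \<subseteq> sets lebesgue"
        using fmeasurableD[OF Im] by (intro image_subsetI sets.finite_UN) auto
      show "incseq (\<lambda>n. \<Union>k<n. I (e k))" by (rule monoI) (force intro: order_less_le_trans)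
      have "(\<Union>n. \<Union>k<n. I (e k)) = (\<Union>p\<in>C. I p)" unfolding UC by blast
      then show "emeasure lebesgue (\<Union>n. \<Union>k<n. I (e k)) \<noteq> \<infinity>"
        using Un by (metis fmeasurableD2 infinity_ennreal_def)
    qed
    also have "(\<Union>n. \<Union>k<n. I (e k)) = (\<Union>p\<in>C. I p)" unfolding UC by blast
    finally have "\<forall>\<^sub>F n in sequentially. dist (measure lebesgue (\<Union>k<n. I (e k))) (measure lebesgue (\<Union>p\<in>C. I p)) < \<eta>"
      using \<open>\<eta> > 0\<close> tendstoD by blast
    then obtain n where n: "dist (measure lebesgue (\<Union>k<n. I (e k))) (measure lebesgue (\<Union>p\<in>C. I p)) < \<eta>"
      by (auto simp: eventually_sequentially)
    have sub: "(\<Union>k<n. I (e k)) \<subseteq> (\<Union>p\<in>C. I p)" unfolding UC by blast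
    have "measure lebesgue ((\<Union>p\<in>C. I p) - (\<Union>k<n. I (e k))) = measure lebesgue (\<Union>p\<in>C. I p) - measure lebesgue (\<Union>k<n. I (e k))"
      by (intro measurable_measure_Diff[OF Un _ sub] sets.finite_UN fmeasurableD[OF Im]) auto
    then have "measure lebesgue ((\<Union>p\<in>C. I p) - (\<Union>p\<in>e ` {..<n}. I p)) < \<eta>"
      using n by (simp add: dist_real_def)
    then show ?thesis by (intro that[of "e ` {..<n}"]) (use e in \<open>auto simp: bij_betw_def\<close>)
  qed
  define \<D> where "\<D> = I ` C'"
  \<comment> \<open>A second name for the index set, because \<open>K\<close> is bound to an
    interval in the next claims.\<close>
  define K' where "K' = K"
  define T where "T = (S - (\<Union>p\<in>C. I p)) \<union> ((\<Union>p\<in>C. I p) - (\<Union>p\<in>C'. I p))"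
  have negS: "negligible (S - (\<Union>p\<in>C. I p))" using neg by (simp add: cb I_def)
  have DI: "Inf K < Sup K \<and> K = {Inf K..Sup K} \<and> P (Inf K) (Sup K)" if KD: "K \<in> \<D>" for K
  proof -
    obtain p where p: "p \<in> C'" "K = I p" using KD by (auto simp: \<D>_def)
    have "p \<in> K'" using p C C'(2) by (auto simp: K'_def)
    then have "fst p < snd p" "P (fst p) (snd p)" by (auto simp: K'_def K_def)
    then show ?thesis using p by (simp add: I_def)
  qed
  have disjD: "L \<inter> L' = {}" if L: "L \<in> \<D>" "L' \<in> \<D>" "L \<noteq> L'" for L L'
  proof -
    obtain p p' where "p \<in> C'" "p' \<in> C'" "L = I p" "L' = I p'" "p \<noteq> p'" using L by (auto simp: \<D>_def)
    then show ?thesis using disj C'(2) by (metis disjoint_family_onD subsetD)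
  qed
  show ?thesis
  proof (rule that[of \<D> T])
    show "disjoint \<D>" using disjD by (auto simp: disjoint_def)
    show "\<D> division_of \<Union>\<D>"
    proof (rule division_ofI)
      show "finite \<D>" using C' by (simp add: \<D>_def)
      fix L assume L: "L \<in> \<D>"
      show "L \<subseteq> \<Union>\<D>" using L by blast
      show "L \<noteq> {}" using DI[OF L] by (metis atLeastatMost_empty_iff2 less_eq_real_def linorder_not_le)
      show "\<exists>a b. L = cbox a b" using DI[OF L] by (metis box_real(2))
      fix L' assume "L' \<in> \<D>" "L \<noteq> L'"
      then have "L \<inter> L' = {}" using L disjD by blast
      then show "interior L \<inter> interior L' = {}" using interior_subset[of L] interior_subset[of L'] by blast
    qed simp
    show "\<Union>\<D> \<subseteq> U" using IU C' by (auto simp: \<D>_def)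
    show "S \<subseteq> \<Union>\<D> \<union> T" by (auto simp: \<D>_def T_def)
    have m2: "(\<Union>p\<in>C. I p) - (\<Union>p\<in>C'. I p) \<in> lmeasurable"
      by (intro fmeasurable_Diff[OF Un] sets.finite_UN fmeasurableD[OF Im] C')
    show "T \<in> lmeasurable" unfolding T_def
      using negS m2 by (intro fmeasurable.Un) (auto simp: negligible_iff_measure)
    have "measure lebesgue T \<le> measure lebesgue (S - (\<Union>p\<in>C. I p)) + measure lebesgue ((\<Union>p\<in>C. I p) - (\<Union>p\<in>C'. I p))"
      unfolding T_def using negS m2 by (intro measure_Un_le) (simp_all add: negligible_iff_measure fmeasurableD)
    also have "\<dots> < \<eta>" using negS C' by (simp add: negligible_imp_measure0)
    finally show "measure lebesgue T < \<eta>" .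
  qed (rule DI)
qed

text \<open>The increment is additive when an interval is cut, so the theory of operative set
  functions does the telescoping. The case distinction on the empty interval is there because
  \<open>Sup\<close> and \<open>Inf\<close> of the empty set have no useful value.\<close>

lemma sum_increment_division:
  fixes f :: "real \<Rightarrow> 'a::ab_group_add"
  assumes "q division_of {a..b}" "a \<le> b"
  shows "(\<Sum>K\<in>q. f (Sup K) - f (Inf K)) = f b - f a"
proof -
  let ?f = "(\<lambda>K::real set. if K = {} then 0 else f (Sup K) - f (Inf K))"
  interpret operative_real plus 0 ?f
    rewrites "comm_monoid_set.F (+) 0 = sum"
    by standard[1] (auto simp add: sum_def)
  have "(\<Sum>K\<in>q. ?f K) = ?f {a..b}" using division[of q a b] assms by simp
  moreover have "(\<Sum>K\<in>q. ?f K) = (\<Sum>K\<in>q. f (Sup K) - f (Inf K))"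
    using division_ofD(3)[OF assms(1)] by (intro sum.cong) auto
  ultimately show ?thesis using assms(2) by simp
qed

lemma lmeasurable_outer_open:
  fixes H :: "real set"
  assumes H: "H \<in> lmeasurable" and "e > 0"
  obtains U where "open U" "H \<subseteq> U" "U \<in> lmeasurable" "measure lebesgue U < measure lebesgue H + e"
proof -
  let ?\<mu> = "measure lebesgue"
  obtain U where U: "open U" "H \<subseteq> U" "U - H \<in> lmeasurable" "emeasure lebesgue (U - H) < ennreal e"
    using sets_lebesgue_outer_open[OF fmeasurableD[OF H] \<open>e > 0\<close>] by metis
  have UH: "U = H \<union> (U - H)" using U by blast
  have Um: "U \<in> lmeasurable" using U H by (subst UH) (rule fmeasurable.Un)
  have "?\<mu> (U - H) < e" using U \<open>e > 0\<close>
    by (metis emeasure_eq_measure2 ennreal_less_iff measure_nonneg)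
  moreover have "?\<mu> (U - H) = ?\<mu> U - ?\<mu> H"
    by (rule measurable_measure_Diff) (use Um H U fmeasurableD in auto)
  ultimately show ?thesis using that[of U] U Um by auto
qed

lemma measure_lebesgue_Icc: "a \<le> b \<Longrightarrow> measure lebesgue {a..b} = b - a" for a b :: real
  by simp

section \<open>Differentiability almost everywhere\<close>

text \<open>Cover \<open>S\<close> by disjoint intervals of slope at most \<open>p\<close> whose
  total length barely exceeds the outer measure \<open>m\<close> of \<open>S\<close>, then cover the
  part of \<open>S\<close> inside them by subintervals of slope at least \<open>q\<close>. The
  second family has nearly the same total length, so what is left over is short and, by absolute
  continuity, carries almost no increment of \<open>f\<close>. Hence about \<open>q * m\<close> is
  at most about \<open>p * m\<close>, which forces \<open>m = 0\<close>.\<close>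

lemma AC_division_separated_slopes_negligible:
  fixes f :: "real \<Rightarrow> real"
  assumes AC: "AC_division c d f" and S: "S \<subseteq> {c<..<d}" and "p < q"
    and V1: "\<And>x e. \<lbrakk>x \<in> S; e > 0\<rbrakk> \<Longrightarrow> \<exists>u v. u < v \<and> v - u < e \<and> x \<in> {u..v} \<and> f v - f u \<le> p * (v - u)"
    and V2: "\<And>x e. \<lbrakk>x \<in> S; e > 0\<rbrakk> \<Longrightarrow> \<exists>u v. u < v \<and> v - u < e \<and> x \<in> {u..v} \<and> q * (v - u) \<le> f v - f u"
  shows "negligible S"
proof -
  let ?\<mu> = "measure lebesgue"
  let ?\<F> = "{U. open U \<and> S \<subseteq> U \<and> U \<subseteq> {c<..<d}}"
  \<comment> \<open>\<open>S\<close> need not be measurable, hence the outer measure, taken over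
    open sets inside the interval.\<close>
  define m where "m = Inf (?\<mu> ` ?\<F>)"
  have bdd: "bdd_below (?\<mu> ` ?\<F>)" by (rule bdd_belowI[of _ 0]) auto
  have "{c<..<d} \<in> ?\<F>" using S by simp
  from imageI[OF this, of ?\<mu>] have ne: "?\<mu> ` ?\<F> \<noteq> {}" by (rule ex_in_conv[THEN iffD1, OF exI])
  have m0: "m \<ge> 0" unfolding m_def using ne by (intro cInf_greatest) auto
  have mH: "m \<le> ?\<mu> H" if H: "H \<in> lmeasurable" "S \<subseteq> H" for H
  proof (rule field_le_epsilon)
    fix e :: real assume "e > 0"
    obtain U where U: "open U" "H \<subseteq> U" "U \<in> lmeasurable" "?\<mu> U < ?\<mu> H + e"
      using lmeasurable_outer_open[OF H(1) \<open>e > 0\<close>] by blast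
    let ?U = "U \<inter> {c<..<d}"
    have "m \<le> ?\<mu> ?U" unfolding m_def
      by (rule cInf_lower[OF imageI bdd]) (use U H S in auto)
    also have "\<dots> \<le> ?\<mu> U" by (rule measure_mono_fmeasurable) (use U fmeasurableD in auto)
    finally show "m \<le> ?\<mu> H + e" using U by simp
  qed
  have main: "(q - p) * (m - 2 * \<epsilon>) \<le> \<epsilon> * (1 + 3 * \<bar>p\<bar>)" if "\<epsilon> > 0" for \<epsilon>
  proof -
    obtain \<delta> where "\<delta> > 0" and \<delta>: "\<And>\<D>. \<lbrakk>\<D> division_of \<Union>\<D>; \<Union>\<D> \<subseteq> {c..d};
     (\<Sum>K\<in>\<D>. ?\<mu> K) < \<delta>\<rbrakk> \<Longrightarrow> (\<Sum>K\<in>\<D>. norm (f (Sup K) - f (Inf K))) < \<epsilon>"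
      using AC_divisionE[OF AC \<open>\<epsilon> > 0\<close>] by blast
    \<comment> \<open>The gaps between the two families will have total length at most
      \<open>3 * \<eta>\<close>, which must stay below \<open>\<delta>\<close>.\<close>
    define \<eta> where "\<eta> = min (\<delta> / 4) \<epsilon>"
    have \<eta>: "\<eta> > 0" "3 * \<eta> < \<delta>" "\<eta> \<le> \<epsilon>" using \<open>\<delta> > 0\<close> \<open>\<epsilon> > 0\<close> by (auto simp: \<eta>_def)
    have "Inf (?\<mu> ` ?\<F>) < m + \<eta>" using \<eta> by (simp add: m_def)
    then obtain U where U: "open U" "S \<subseteq> U" "U \<subseteq> {c<..<d}" "?\<mu> U < m + \<eta>"
      using cInf_lessD[OF ne] by blast
    have Um: "U \<in> lmeasurable"
      by (rule fmeasurableI2[of "{c<..<d}"]) (use U in auto)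
    obtain \<D>1 T1 where D1: "\<D>1 division_of \<Union>\<D>1" "disjoint \<D>1" "\<Union>\<D>1 \<subseteq> U" "S \<subseteq> \<Union>\<D>1 \<union> T1" "T1 \<in> lmeasurable"
      "?\<mu> T1 < \<eta>" "\<And>K. K \<in> \<D>1 \<Longrightarrow> Inf K < Sup K \<and> K = {Inf K..Sup K} \<and> f (Sup K) - f (Inf K) \<le> p * (Sup K - Inf K)"
      using vitali_finite_division[where P="\<lambda>u v. f v - f u \<le> p * (v - u)", OF U(1,2) Um \<eta>(1) V1] by metis
    have fin1: "finite \<D>1" using D1(1) by (rule division_of_finite)
    \<comment> \<open>Each of the \<open>card \<D>1\<close> inner coverings may miss an equal share
      of \<open>\<eta>\<close>; the \<open>+ 1\<close> avoids a division by zero.\<close>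
    define \<kappa> where "\<kappa> = \<eta> / (card \<D>1 + 1)"
    have \<kappa>: "\<kappa> > 0" "card \<D>1 * \<kappa> \<le> \<eta>" using \<eta> by (auto simp: \<kappa>_def field_simps)
    define Q where "Q K \<D> T \<longleftrightarrow> \<D> division_of \<Union>\<D> \<and> \<Union>\<D> \<subseteq> interior K \<and> S \<inter> interior K \<subseteq> \<Union>\<D> \<union> T \<and> T \<in> lmeasurable
      \<and> ?\<mu> T < \<kappa> \<and> (\<forall>J\<in>\<D>. Inf J < Sup J \<and> J = {Inf J..Sup J} \<and> q * (Sup J - Inf J) \<le> f (Sup J) - f (Inf J))"
      for K \<D> T
    have "\<exists>\<D> T. Q K \<D> T" if "K \<in> \<D>1" for K
    proof -
      have "K = {Inf K..Sup K}" using D1(7)[OF that] by blast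
      then have Km: "interior K \<in> lmeasurable" by (metis lmeasurable_interior bounded_closed_interval)
      have V2': "\<exists>u v. u < v \<and> v - u < e \<and> x \<in> {u..v} \<and> q * (v - u) \<le> f v - f u" if "x \<in> S \<inter> interior K" "e > 0" for x e
        by (rule V2) (use that in auto)
      obtain \<D> T where DT: "\<D> division_of \<Union>\<D>" "disjoint \<D>" "\<Union>\<D> \<subseteq> interior K" "S \<inter> interior K \<subseteq> \<Union>\<D> \<union> T" "T \<in> lmeasurable"
        "?\<mu> T < \<kappa>" "\<And>J. J \<in> \<D> \<Longrightarrow> Inf J < Sup J \<and> J = {Inf J..Sup J} \<and> q * (Sup J - Inf J) \<le> f (Sup J) - f (Inf J)"
        using vitali_finite_division[where P="\<lambda>u v. q * (v - u) \<le> f v - f u", OF open_interior inf_le2 Km \<kappa>(1) V2'] by metis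
      have "Q K \<D> T" unfolding Q_def
        by (intro conjI ballI DT(1) DT(3) DT(4) DT(5) DT(6)) (use DT(7) in blast)+
      then show ?thesis by blast
    qed
    then obtain \<D>2 T where Q: "\<And>K. K \<in> \<D>1 \<Longrightarrow> Q K (\<D>2 K) (T K)" by metis
    have D2: "\<D>2 K division_of \<Union>(\<D>2 K)" "\<Union>(\<D>2 K) \<subseteq> interior K" "S \<inter> interior K \<subseteq> \<Union>(\<D>2 K) \<union> T K"
      "T K \<in> lmeasurable" "?\<mu> (T K) < \<kappa>"
      "\<And>J. J \<in> \<D>2 K \<Longrightarrow> Inf J < Sup J \<and> J = {Inf J..Sup J} \<and> q * (Sup J - Inf J) \<le> f (Sup J) - f (Inf J)"
      if "K \<in> \<D>1" for K
      using Q[OF that] unfolding Q_def by blast+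
    \<comment> \<open>Completing the inner family to a division of all of \<open>K\<close> makes
      \<open>r K - \<D>2 K\<close> the gaps in \<open>K\<close> and lets the increment over
      \<open>K\<close> split.\<close>
    have "\<exists>r. \<D>2 K \<subseteq> r \<and> r division_of K" if "K \<in> \<D>1" for K
      using partial_division_extend_interval[OF D2(1)[OF that], of "Inf K" "Sup K"] D2(2)[OF that] D1(7)[OF that] interior_subset[of K]
      by (metis box_real(2) order_trans)
    then obtain r where r: "\<And>K. K \<in> \<D>1 \<Longrightarrow> \<D>2 K \<subseteq> r K" "\<And>K. K \<in> \<D>1 \<Longrightarrow> r K division_of K" by metis
    have finr: "finite (r K)" if "K \<in> \<D>1" for K using r(2)[OF that] by (rule division_of_finite)
    define a where "a = (\<Sum>K\<in>\<D>1. \<Sum>J\<in>\<D>2 K. ?\<mu> J)"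
    define G where "G = (\<Union>K\<in>\<D>1. r K - \<D>2 K)"
    have sumG: "sum h G = (\<Sum>K\<in>\<D>1. sum h (r K) - sum h (\<D>2 K))" for h :: "real set \<Rightarrow> real"
    proof -
      have "sum h G = (\<Sum>K\<in>\<D>1. sum h (r K - \<D>2 K))" unfolding G_def
      proof (rule sum.UNION_disjoint[OF fin1])
        show "\<forall>K\<in>\<D>1. finite (r K - \<D>2 K)" using finr by auto
        have "J \<noteq> J'" if "K \<in> \<D>1" "K' \<in> \<D>1" "K \<noteq> K'" "J \<in> r K" "J' \<in> r K'" for K K' J J'
        proof -
          have "J \<subseteq> K" "J' \<subseteq> K'" "J \<noteq> {}"
            using division_ofD(2,3)[OF r(2)[OF that(1)] that(4)] division_ofD(2)[OF r(2)[OF that(2)] that(5)] by auto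
          moreover have "K \<inter> K' = {}" using D1(2) that by (auto simp: disjoint_def)
          ultimately show ?thesis by blast
        qed
        then show "\<forall>K\<in>\<D>1. \<forall>K'\<in>\<D>1. K \<noteq> K' \<longrightarrow> (r K - \<D>2 K) \<inter> (r K' - \<D>2 K') = {}" by blast
      qed
      also have "\<dots> = (\<Sum>K\<in>\<D>1. sum h (r K) - sum h (\<D>2 K))"
        using finr r(1) by (intro sum.cong refl sum_diff) auto
      finally show ?thesis .
    qed
    have rsum: "(\<Sum>J\<in>r K. ?\<mu> J) = ?\<mu> K" if "K \<in> \<D>1" for K
      using content_division[OF r(2)[OF that]] .
    have D1sum: "(\<Sum>K\<in>\<D>1. ?\<mu> K) < m + \<eta>"
    proof -
      have "(\<Sum>K\<in>\<D>1. ?\<mu> K) = ?\<mu> (\<Union>\<D>1)" by (rule content_division[OF D1(1)])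
      also have "\<dots> \<le> ?\<mu> U"
        by (rule measure_mono_fmeasurable[OF D1(3) _ Um]) (use lmeasurable_division[OF D1(1)] fmeasurableD in blast)
      finally show ?thesis using U by simp
    qed
    have ma: "m \<le> a + 2 * \<eta>"
    proof -
      \<comment> \<open>A measurable superset of \<open>S\<close>: the inner intervals, both kinds
        of exceptional sets, and the end points of the outer intervals, which a covering of the
        interiors does not see.\<close>
      define H where "H = (\<Union>K\<in>\<D>1. \<Union>(\<D>2 K)) \<union> (\<Union>K\<in>\<D>1. T K) \<union> T1 \<union> (\<Union>K\<in>\<D>1. {Inf K, Sup K})"
      have m1: "(\<Union>K\<in>\<D>1. \<Union>(\<D>2 K)) \<in> lmeasurable"
        using lmeasurable_division[OF D2(1)] fin1 by (intro fmeasurable.finite_UN) auto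
      have m2: "(\<Union>K\<in>\<D>1. T K) \<in> lmeasurable"
        using D2(4) fin1 by (intro fmeasurable.finite_UN) auto
      have n3: "negligible (\<Union>K\<in>\<D>1. {Inf K, Sup K})" using fin1 by (intro negligible_Union) auto
      have m3: "(\<Union>K\<in>\<D>1. {Inf K, Sup K}) \<in> lmeasurable" using n3 by (simp add: negligible_iff_measure)
      have Hm: "H \<in> lmeasurable" unfolding H_def using m1 m2 m3 D1(5) by (intro fmeasurable.Un)
      have "S \<subseteq> H"
      proof
        fix x assume x: "x \<in> S"
        show "x \<in> H"
        proof (cases "x \<in> T1")
          case False
          then obtain K where K: "K \<in> \<D>1" "x \<in> K" using D1(4) x by blast
          have "K = {Inf K..Sup K}" using D1(7) K by blast
          then have "x \<in> interior K \<or> x = Inf K \<or> x = Sup K" using K(2)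
            by (metis atLeastAtMost_iff greaterThanLessThan_iff interior_atLeastAtMost_real less_eq_real_def)
          moreover have "x \<in> \<Union>(\<D>2 K) \<union> T K" if "x \<in> interior K"
            using D2(3)[OF K(1)] x that by (metis IntI subsetD)
          ultimately show ?thesis using K(1) unfolding H_def by auto
        qed (simp add: H_def)
      qed
      then have "m \<le> ?\<mu> H" by (rule mH[OF Hm])
      also have "\<dots> \<le> ?\<mu> ((\<Union>K\<in>\<D>1. \<Union>(\<D>2 K)) \<union> (\<Union>K\<in>\<D>1. T K) \<union> T1) + ?\<mu> (\<Union>K\<in>\<D>1. {Inf K, Sup K})"
        unfolding H_def using m1 m2 m3 D1(5) by (intro measure_Un_le) auto
      also have "\<dots> \<le> ?\<mu> ((\<Union>K\<in>\<D>1. \<Union>(\<D>2 K)) \<union> (\<Union>K\<in>\<D>1. T K)) + ?\<mu> T1 + 0"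
        using m1 m2 m3 D1(5) negligible_imp_measure0[OF n3] by (intro add_mono measure_Un_le) auto
      also have "\<dots> \<le> ?\<mu> (\<Union>K\<in>\<D>1. \<Union>(\<D>2 K)) + ?\<mu> (\<Union>K\<in>\<D>1. T K) + ?\<mu> T1 + 0"
        using m1 m2 by (intro add_mono measure_Un_le order_refl) auto
      also have "?\<mu> (\<Union>K\<in>\<D>1. \<Union>(\<D>2 K)) \<le> (\<Sum>K\<in>\<D>1. ?\<mu> (\<Union>(\<D>2 K)))"
        using lmeasurable_division[OF D2(1)] by (intro measure_UNION_le fin1) (auto intro: fmeasurableD)
      also have "(\<Sum>K\<in>\<D>1. ?\<mu> (\<Union>(\<D>2 K))) = a" unfolding a_def
        by (intro sum.cong refl content_division[OF D2(1), symmetric])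
      also have "?\<mu> (\<Union>K\<in>\<D>1. T K) \<le> (\<Sum>K\<in>\<D>1. ?\<mu> (T K))"
        using D2(4) by (intro measure_UNION_le fin1) (auto intro: fmeasurableD)
      also have "(\<Sum>K\<in>\<D>1. ?\<mu> (T K)) \<le> (\<Sum>K\<in>\<D>1. \<kappa>)" using D2(5) by (intro sum_mono) (auto intro: less_imp_le)
      also have "\<dots> \<le> \<eta>" using \<kappa> by simp
      finally show ?thesis using D1(6) by simp
    qed
    have gap: "(\<Sum>J\<in>G. ?\<mu> J) = (\<Sum>K\<in>\<D>1. ?\<mu> K) - a"
      unfolding sumG a_def using rsum by (simp add: sum_subtractf)
    have Gdiv: "G division_of \<Union>G"
    proof (rule division_ofI)
      show "finite G" unfolding G_def using fin1 finr by auto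
      fix J assume J: "J \<in> G"
      then obtain K where K: "K \<in> \<D>1" "J \<in> r K" by (auto simp: G_def)
      show "J \<subseteq> \<Union>G" using J by blast
      show "J \<noteq> {}" "\<exists>a b. J = cbox a b" using division_ofD(3,4)[OF r(2)[OF K(1)] K(2)] by auto
      fix J' assume J': "J' \<in> G" "J \<noteq> J'"
      then obtain K' where K': "K' \<in> \<D>1" "J' \<in> r K'" by (auto simp: G_def)
      show "interior J \<inter> interior J' = {}"
      proof (cases "K = K'")
        case True then show ?thesis using division_ofD(5)[OF r(2)[OF K(1)] K(2)] K' J' by blast
      next
        case False
        then have "K \<inter> K' = {}" using D1(2) K K' by (auto simp: disjoint_def)
        moreover have "J \<subseteq> K" "J' \<subseteq> K'" using r(2) K K' division_ofD(2) by metis+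
        ultimately show ?thesis using interior_subset by blast
      qed
    qed simp
    have "\<Union>G \<subseteq> \<Union>\<D>1" unfolding G_def using division_ofD(2)[OF r(2)] by blast
    then have Gsub: "\<Union>G \<subseteq> {c..d}" using D1(3) U(3) by force
    have "(\<Sum>J\<in>G. norm (f (Sup J) - f (Inf J))) < \<epsilon>"
      by (rule \<delta>[OF Gdiv Gsub]) (use gap D1sum ma \<eta> in linarith)
    moreover have "\<bar>\<Sum>J\<in>G. f (Sup J) - f (Inf J)\<bar> \<le> (\<Sum>J\<in>G. norm (f (Sup J) - f (Inf J)))"
      unfolding real_norm_def by (rule sum_abs)
    ultimately have "\<bar>\<Sum>J\<in>G. f (Sup J) - f (Inf J)\<bar> < \<epsilon>" by (rule order_le_less_trans[rotated])
    then have Gf: "(\<Sum>J\<in>G. f (Sup J) - f (Inf J)) > - \<epsilon>" by linarith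
    have inc: "(\<Sum>J\<in>r K. f (Sup J) - f (Inf J)) = f (Sup K) - f (Inf K)" if "K \<in> \<D>1" for K
      using sum_increment_division[of "r K" "Inf K" "Sup K" f] D1(7)[OF that] r(2)[OF that] by force
    have "(\<Sum>J\<in>G. f (Sup J) - f (Inf J)) =
       (\<Sum>K\<in>\<D>1. f (Sup K) - f (Inf K)) - (\<Sum>K\<in>\<D>1. \<Sum>J\<in>\<D>2 K. f (Sup J) - f (Inf J))"
      unfolding sumG using inc by (simp add: sum_subtractf)
    moreover have "(\<Sum>K\<in>\<D>1. f (Sup K) - f (Inf K)) \<le> (\<Sum>K\<in>\<D>1. p * ?\<mu> K)"
    proof (rule sum_mono)
      fix K assume "K \<in> \<D>1"
      from D1(7)[OF this] have "Inf K < Sup K" "K = {Inf K..Sup K}" "f (Sup K) - f (Inf K) \<le> p * (Sup K - Inf K)" by auto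
      moreover from this have "?\<mu> K = Sup K - Inf K" by (metis less_imp_le measure_lebesgue_Icc)
      ultimately show "f (Sup K) - f (Inf K) \<le> p * ?\<mu> K" by simp
    qed
    moreover have "(\<Sum>K\<in>\<D>1. \<Sum>J\<in>\<D>2 K. q * ?\<mu> J) \<le> (\<Sum>K\<in>\<D>1. \<Sum>J\<in>\<D>2 K. f (Sup J) - f (Inf J))"
    proof (intro sum_mono)
      fix K J assume "K \<in> \<D>1" "J \<in> \<D>2 K"
      from D2(6)[OF this] have "Inf J < Sup J" "J = {Inf J..Sup J}" "q * (Sup J - Inf J) \<le> f (Sup J) - f (Inf J)" by auto
      moreover from this have "?\<mu> J = Sup J - Inf J" by (metis less_imp_le measure_lebesgue_Icc)
      ultimately show "q * ?\<mu> J \<le> f (Sup J) - f (Inf J)" by simp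
    qed
    \<comment> \<open>The increment over the outer intervals is at most \<open>p\<close> times their
      length, and at least \<open>q * a\<close> minus what the gaps can take away.\<close>
    ultimately have "q * a - \<epsilon> \<le> p * (\<Sum>K\<in>\<D>1. ?\<mu> K)"
      using Gf unfolding a_def by (simp add: sum_distrib_left)
    moreover define g where "g = (\<Sum>K\<in>\<D>1. ?\<mu> K) - a"
    have "0 \<le> (\<Sum>J\<in>G. ?\<mu> J)" by (intro sum_nonneg) simp
    then have g: "0 \<le> g" "g \<le> 3 * \<eta>" using D1sum ma unfolding g_def gap by linarith+
    have "p * g \<le> \<bar>p\<bar> * (3 * \<epsilon>)" using g \<eta>
      by (intro mult_mono) auto
    moreover have "(q - p) * (m - 2 * \<epsilon>) \<le> (q - p) * a" using \<open>p < q\<close> ma \<eta> by (intro mult_left_mono) auto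
    ultimately show ?thesis by (simp add: g_def algebra_simps)
  qed
  have "m \<le> 0"
  proof (rule ccontr)
    assume "\<not> m \<le> 0" then have "m > 0" by simp
    \<comment> \<open>Collects the coefficients of \<open>\<epsilon>\<close> in \<open>main\<close>;
      the \<open>\<epsilon>\<close> chosen next makes the right side half of the left.\<close>
    define C where "C = 1 + 3 * \<bar>p\<bar> + 2 * (q - p)"
    have C: "C > 0" using \<open>p < q\<close> by (simp add: C_def)
    define \<epsilon> where "\<epsilon> = (q - p) * m / (2 * C)"
    have "\<epsilon> > 0" using C \<open>m > 0\<close> \<open>p < q\<close> by (simp add: \<epsilon>_def)
    from main[OF this] have "(q - p) * m \<le> \<epsilon> * C" by (simp add: C_def algebra_simps)
    also have "\<dots> = (q - p) * m / 2" using C by (simp add: \<epsilon>_def)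
    finally show False using \<open>m > 0\<close> \<open>p < q\<close> by (simp add: mult_le_0_iff)
  qed
  then have m: "m = 0" using m0 by simp
  show "negligible S"
    unfolding negligible_outer_le
  proof (intro allI impI)
    fix e :: real assume "e > 0"
    then have "Inf (?\<mu> ` ?\<F>) < e" using m by (simp add: m_def)
    then obtain U where U: "open U" "S \<subseteq> U" "U \<subseteq> {c<..<d}" "?\<mu> U < e"
      using cInf_lessD[OF ne] by blast
    have "U \<in> lmeasurable" by (rule fmeasurableI2[of "{c<..<d}"]) (use U in auto)
    then show "\<exists>U. S \<subseteq> U \<and> U \<in> lmeasurable \<and> ?\<mu> U \<le> e" using U by (intro exI[of _ U]) simp
  qed
qed

text \<open>The witness \<open>y\<close> may lie on either side of \<open>x\<close>; the difference
  quotient does not change when its two points are swapped.\<close>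

lemma slope_interval:
  fixes f :: "real \<Rightarrow> real"
  assumes "y \<noteq> x" "\<bar>y - x\<bar> < e" "R ((f y - f x) / (y - x))"
  shows "\<exists>u v. u < v \<and> v - u < e \<and> x \<in> {u..v} \<and> R ((f v - f u) / (v - u))"
proof (cases "x < y")
  case True
  then show ?thesis using assms by (intro exI[of _ x] exI[of _ y]) auto
next
  case False
  have "(f x - f y) / (x - y) = (f y - f x) / (y - x)"
    by (metis minus_diff_eq minus_divide_divide)
  then show ?thesis using assms False by (intro exI[of _ y] exI[of _ x]) auto
qed

text \<open>The points where the limsup of the absolute difference quotients is infinite; elsewhere
  all Dini derivates are finite.\<close>

definition steep_points :: "(real \<Rightarrow> real) \<Rightarrow> real set" where
  "steep_points f = {x. \<forall>n::nat. \<exists>\<^sub>F y in at x. real n < \<bar>(f y - f x) / (y - x)\<bar>}"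

lemma frequently_at_real:
  "(\<exists>\<^sub>F y in at (x::real). P y) \<longleftrightarrow> (\<forall>e>0. \<exists>y. y \<noteq> x \<and> \<bar>y - x\<bar> < e \<and> P y)"
  unfolding frequently_at by (auto simp: dist_real_def)

text \<open>In a piece so short that the variation over disjoint intervals stays below 1, intervals
  of slope at least \<open>n\<close> in absolute value have total length below \<open>1 / n\<close>.
  Such pieces are enough because negligibility is a local property.\<close>

lemma AC_division_steep_negligible:
  fixes f :: "real \<Rightarrow> real"
  assumes AC: "AC_division c d f"
  shows "negligible ({c<..<d} \<inter> steep_points f)" (is "negligible ?S")
  unfolding locally_negligible_alt[of ?S]
proof
  fix x assume x: "x \<in> ?S"
  obtain \<delta> where "\<delta> > 0" and \<delta>: "\<And>\<D>. \<lbrakk>\<D> division_of \<Union>\<D>; \<Union>\<D> \<subseteq> {c..d};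
     (\<Sum>K\<in>\<D>. measure lebesgue K) < \<delta>\<rbrakk> \<Longrightarrow> (\<Sum>K\<in>\<D>. norm (f (Sup K) - f (Inf K))) < 1"
    using AC_divisionE[OF AC zero_less_one] by blast
  \<comment> \<open>Radius \<open>\<delta>/4\<close> gives length at most \<open>\<delta>/2\<close>,
    strictly below the tolerance.\<close>
  define V where "V = ball x (\<delta>/4) \<inter> {c<..<d}"
  have V: "open V" "V \<in> lmeasurable" "measure lebesgue V < \<delta>" "V \<subseteq> {c..d}"
  proof -
    show "open V" "V \<subseteq> {c..d}" by (auto simp: V_def)
    have bm: "ball x (\<delta>/4) \<in> lmeasurable" by simp
    show Vm: "V \<in> lmeasurable"
      by (rule fmeasurableI2[OF bm]) (auto simp: V_def)
    have "measure lebesgue V \<le> measure lebesgue (ball x (\<delta>/4))"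
      by (rule measure_mono_fmeasurable[OF _ fmeasurableD[OF Vm] bm]) (auto simp: V_def)
    also have "\<dots> = \<delta> / 2" using \<open>\<delta> > 0\<close> by (simp add: ball_eq_greaterThanLessThan)
    finally show "measure lebesgue V < \<delta>" using \<open>\<delta> > 0\<close> by simp
  qed
  have "negligible (?S \<inter> V)"
    unfolding negligible_outer_le
  proof (intro allI impI)
    fix e :: real assume "e > 0"
    \<comment> \<open>Half of \<open>e\<close> is spent on the steep intervals, half on the set
      \<open>T\<close> that the covering misses.\<close>
    obtain n :: nat where n: "n > 0" "1 / real n < e / 2"
      using \<open>e > 0\<close> by (metis half_gt_zero nat_approx_posE of_nat_Suc zero_less_Suc)
    have "\<exists>u v. u < v \<and> v - u < r \<and> y \<in> {u..v} \<and> real n * (v - u) \<le> \<bar>f v - f u\<bar>"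
      if "y \<in> ?S \<inter> V" "r > 0" for y r
    proof -
      have "\<exists>\<^sub>F y' in at y. real n < \<bar>(f y' - f y) / (y' - y)\<bar>"
        using that(1) by (simp add: steep_points_def)
      then obtain y' where "y' \<noteq> y" "\<bar>y' - y\<bar> < r" "real n < \<bar>(f y' - f y) / (y' - y)\<bar>"
        using \<open>r > 0\<close> unfolding frequently_at_real by blast
      from slope_interval[of y' y r "\<lambda>s. real n < \<bar>s\<bar>", OF this] obtain u v where
        uv: "u < v" "v - u < r" "y \<in> {u..v}" "real n < \<bar>(f v - f u) / (v - u)\<bar>" by blast
      then have "real n * (v - u) \<le> \<bar>f v - f u\<bar>" by (simp add: abs_divide pos_less_divide_eq)
      with uv show ?thesis by blast
    qed
    then obtain \<D> T where D: "\<D> division_of \<Union>\<D>" "\<Union>\<D> \<subseteq> V" "?S \<inter> V \<subseteq> \<Union>\<D> \<union> T" "T \<in> lmeasurable"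
      "measure lebesgue T < e / 2" "\<And>K. K \<in> \<D> \<Longrightarrow> Inf K < Sup K \<and> K = {Inf K..Sup K} \<and> real n * (Sup K - Inf K) \<le> \<bar>f (Sup K) - f (Inf K)\<bar>"
      using vitali_finite_division[where P="\<lambda>u v. real n * (v - u) \<le> \<bar>f v - f u\<bar>" and U=V and S="?S \<inter> V" and \<eta>="e / 2"]
      V(1,2) \<open>e > 0\<close> by (metis half_gt_zero inf_le2)
    have Dm: "\<Union>\<D> \<in> lmeasurable" by (rule lmeasurable_division[OF D(1)])
    have "(\<Sum>K\<in>\<D>. measure lebesgue K) = measure lebesgue (\<Union>\<D>)" by (rule content_division[OF D(1)])
    also have "\<dots> \<le> measure lebesgue V"
      by (rule measure_mono_fmeasurable[OF D(2) fmeasurableD[OF Dm] V(2)])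
    finally have "(\<Sum>K\<in>\<D>. norm (f (Sup K) - f (Inf K))) < 1"
      using D(2) V(3,4) by (intro \<delta>[OF D(1)]) auto
    moreover have "(\<Sum>K\<in>\<D>. real n * measure lebesgue K) \<le> (\<Sum>K\<in>\<D>. norm (f (Sup K) - f (Inf K)))"
    proof (intro sum_mono)
      fix K assume "K \<in> \<D>"
      from D(6)[OF this] have "Inf K < Sup K" "K = {Inf K..Sup K}" "real n * (Sup K - Inf K) \<le> \<bar>f (Sup K) - f (Inf K)\<bar>" by auto
      moreover from this have "measure lebesgue K = Sup K - Inf K" by (metis less_imp_le measure_lebesgue_Icc)
      ultimately show "real n * measure lebesgue K \<le> norm (f (Sup K) - f (Inf K))" by simp
    qed
    ultimately have "real n * measure lebesgue (\<Union>\<D>) < 1"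
      using content_division[OF D(1)] by (simp add: sum_distrib_left[symmetric])
    then have "measure lebesgue (\<Union>\<D>) < 1 / real n" using n by (simp add: field_simps)
    then have "measure lebesgue (\<Union>\<D> \<union> T) \<le> e"
      using n D(5) measure_Un_le[of "\<Union>\<D>" lebesgue T] Dm D(4) fmeasurableD by fastforce
    moreover have "\<Union>\<D> \<union> T \<in> lmeasurable" using Dm D(4) by (rule fmeasurable.Un)
    ultimately show "\<exists>T. ?S \<inter> V \<subseteq> T \<and> T \<in> lmeasurable \<and> measure lebesgue T \<le> e"
      using D(3) by blast
  qed
  moreover have "openin (top_of_set ?S) (?S \<inter> V)" using V(1) by (rule openin_open_Int)
  moreover have "x \<in> ?S \<inter> V" using x \<open>\<delta> > 0\<close> by (auto simp: V_def)
  ultimately show "\<exists>U. openin (top_of_set ?S) U \<and> x \<in> U \<and> negligible U" by blast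
qed

text \<open>Liminf and limsup of the difference quotients are taken in \<open>ereal\<close>, where
  they always exist. If they differed, two rationals would fit between them; being off the steep set
  makes the common value finite.\<close>

lemma differentiable_if_slopes_close:
  fixes f :: "real \<Rightarrow> real"
  assumes "x \<notin> steep_points f"
    and sep: "\<And>p q::rat. p < q \<Longrightarrow> \<not> ((\<exists>\<^sub>F y in at x. (f y - f x) / (y - x) < of_rat p) \<and>
       (\<exists>\<^sub>F y in at x. of_rat q < (f y - f x) / (y - x)))"
  shows "f differentiable at x"
proof -
  define s where "s y = (f y - f x) / (y - x)" for y
  define g where "g y = ereal (s y)" for y
  have le: "Liminf (at x) g \<le> Limsup (at x) g" by (rule Liminf_le_Limsup) simp
  have eq: "Liminf (at x) g = Limsup (at x) g"
  proof (rule ccontr)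
    assume "Liminf (at x) g \<noteq> Limsup (at x) g"
    then have "Liminf (at x) g < Limsup (at x) g" using le by simp
    then obtain p where p: "Liminf (at x) g < real_of_rat p" "real_of_rat p < Limsup (at x) g"
      using ereal_dense3 by blast
    then obtain q where q: "ereal (real_of_rat p) < real_of_rat q" "real_of_rat q < Limsup (at x) g"
      using ereal_dense3 by blast
    have "\<exists>\<^sub>F y in at x. s y < of_rat p"
    proof (rule ccontr)
      assume "\<not> ?thesis"
      then have "\<forall>\<^sub>F y in at x. ereal (of_rat p) \<le> g y" by (simp add: not_frequently not_less g_def)
      from Liminf_bounded[OF this] show False using p by simp
    qed
    moreover have "\<exists>\<^sub>F y in at x. of_rat q < s y"
    proof (rule ccontr)
      assume "\<not> ?thesis"
      then have "\<forall>\<^sub>F y in at x. g y \<le> ereal (of_rat q)" by (simp add: not_frequently not_less g_def)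
      from Limsup_bounded[OF this] show False using q by simp
    qed
    ultimately show False using sep[of p q] q by (simp add: s_def of_rat_less)
  qed
  define L where "L = Limsup (at x) g"
  have lim: "(g \<longlongrightarrow> L) (at x)" unfolding L_def by (subst tendsto_iff_Liminf_eq_Limsup) (auto simp: eq)
  obtain n :: nat where "\<not> (\<exists>\<^sub>F y in at x. real n < \<bar>s y\<bar>)"
    using assms(1) by (auto simp: steep_points_def s_def)
  then have n: "\<forall>\<^sub>F y in at x. \<bar>s y\<bar> \<le> real n" by (simp add: not_frequently not_less)
  have "L \<le> ereal (real n)" unfolding L_def
    by (rule Limsup_bounded) (use n in eventually_elim, auto simp: g_def)
  moreover have "ereal (- real n) \<le> L" unfolding L_def eq[symmetric]
    by (rule Liminf_bounded) (use n in eventually_elim, auto simp: g_def)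
  ultimately obtain l where l: "L = ereal l" by (cases L) auto
  have "(s \<longlongrightarrow> l) (at x)" using lim unfolding l g_def by simp
  then have "(f has_field_derivative l) (at x)" unfolding has_field_derivative_iff s_def .
  then show ?thesis unfolding real_differentiable_def by blast
qed

theorem AC_division_differentiable_ae:
  fixes f :: "real \<Rightarrow> real"
  assumes AC: "AC_division c d f"
  shows "negligible {x\<in>{c<..<d}. \<not> f differentiable at x}"
proof -
  define A where "A = (\<lambda>(p::rat,q::rat). {x\<in>{c<..<d}. (\<exists>\<^sub>F y in at x. (f y - f x) / (y - x) < of_rat p) \<and>
       (\<exists>\<^sub>F y in at x. of_rat q < (f y - f x) / (y - x))})"
  have A: "negligible (A pq)" if "fst pq < snd pq" for pq
  proof (rule AC_division_separated_slopes_negligible[OF AC])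
    show "A pq \<subseteq> {c<..<d}" by (auto simp: A_def)
    show "real_of_rat (fst pq) < real_of_rat (snd pq)" using that by (simp add: of_rat_less)
    fix x e :: real assume x: "x \<in> A pq" and e: "e > 0"
    have x1: "\<exists>\<^sub>F y in at x. (f y - f x) / (y - x) < of_rat (fst pq)"
      and x2: "\<exists>\<^sub>F y in at x. of_rat (snd pq) < (f y - f x) / (y - x)"
      using x by (auto simp: A_def split: prod.splits)
    obtain y where "y \<noteq> x" "\<bar>y - x\<bar> < e" "(f y - f x) / (y - x) < of_rat (fst pq)"
      using x1 e unfolding frequently_at_real by blast
    from slope_interval[of y x e "\<lambda>s. s < of_rat (fst pq)", OF this] obtain u v where
        uv: "u < v" "v - u < e" "x \<in> {u..v}" "(f v - f u) / (v - u) < of_rat (fst pq)" by blast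
    moreover from uv have "f v - f u \<le> of_rat (fst pq) * (v - u)" by (simp add: pos_divide_less_eq)
    ultimately show "\<exists>u v. u < v \<and> v - u < e \<and> x \<in> {u..v} \<and> f v - f u \<le> of_rat (fst pq) * (v - u)" by blast
    obtain y where "y \<noteq> x" "\<bar>y - x\<bar> < e" "of_rat (snd pq) < (f y - f x) / (y - x)"
      using x2 e unfolding frequently_at_real by blast
    from slope_interval[of y x e "\<lambda>s. of_rat (snd pq) < s", OF this] obtain u v where
        uv: "u < v" "v - u < e" "x \<in> {u..v}" "of_rat (snd pq) < (f v - f u) / (v - u)" by blast
    moreover from uv have "of_rat (snd pq) * (v - u) \<le> f v - f u" by (simp add: pos_less_divide_eq)
    ultimately show "\<exists>u v. u < v \<and> v - u < e \<and> x \<in> {u..v} \<and> of_rat (snd pq) * (v - u) \<le> f v - f u" by blast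
  qed
  have "negligible (\<Union>pq\<in>{pq. fst pq < snd pq}. A pq)"
    using A by (intro negligible_countable_Union) (auto intro: countable_subset[OF subset_UNIV])
  then have "negligible (({c<..<d} \<inter> steep_points f) \<union> (\<Union>pq\<in>{pq. fst pq < snd pq}. A pq))"
    using AC_division_steep_negligible[OF AC] by (rule negligible_Un[rotated])
  then show ?thesis
  proof (rule negligible_subset)
    show "{x\<in>{c<..<d}. \<not> f differentiable at x} \<subseteq>
      ({c<..<d} \<inter> steep_points f) \<union> (\<Union>pq\<in>{pq. fst pq < snd pq}. A pq)"
    proof
      fix x assume x: "x \<in> {x\<in>{c<..<d}. \<not> f differentiable at x}"
      then have "x \<in> steep_points f \<or> (\<exists>p q::rat. p < q \<and> (\<exists>\<^sub>F y in at x. (f y - f x) / (y - x) < of_rat p) \<and>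
       (\<exists>\<^sub>F y in at x. of_rat q < (f y - f x) / (y - x)))"
        using differentiable_if_slopes_close[of x f] by blast
      then show "x \<in> ({c<..<d} \<inter> steep_points f) \<union> (\<Union>pq\<in>{pq. fst pq < snd pq}. A pq)"
        using x by (auto simp: A_def)
    qed
  qed
qed

section \<open>Recovering an absolutely continuous function from its derivative\<close>

text \<open>The gauge does the work: off \<open>N\<close> it makes the linear approximation accurate
  to \<open>e1\<close> per unit length, on \<open>N\<close> it keeps the intervals inside an open
  set of measure below \<open>\<delta>\<close>, where absolute continuity bounds the total
  increment. Setting the integrand to 0 on \<open>N\<close> leaves only these increments to estimate
  there.\<close>

lemma AC_division_FTC:
  fixes f :: "real \<Rightarrow> 'a::banach"
  assumes AC: "AC_division c d f" and "c \<le> d" and N: "negligible N"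
    and der: "\<And>x. x \<in> {c..d} - N \<Longrightarrow> (f has_vector_derivative f' x) (at x)"
  shows "(f' has_integral (f d - f c)) {c..d}"
proof -
  define h where "h x = (if x \<in> N then 0 else f' x)" for x
  have "(h has_integral (f d - f c)) {c..d}"
    unfolding box_real(2)[symmetric] has_integral
  proof (intro allI impI)
    fix e :: real assume "e > 0"
    \<comment> \<open>The \<open>+ 1\<close> covers the degenerate interval
      \<open>c = d\<close>.\<close>
    define e1 where "e1 = e / (2 * (d - c + 1))"
    have e1: "e1 > 0" "e1 * (d - c) < e / 2"
      using \<open>e > 0\<close> \<open>c \<le> d\<close> by (auto simp: e1_def field_simps)
    obtain \<delta> where "\<delta> > 0" and \<delta>: "\<And>\<D>. \<lbrakk>\<D> division_of \<Union>\<D>; \<Union>\<D> \<subseteq> {c..d};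
     (\<Sum>K\<in>\<D>. measure lebesgue K) < \<delta>\<rbrakk> \<Longrightarrow> (\<Sum>K\<in>\<D>. norm (f (Sup K) - f (Inf K))) < e / 2"
      using AC_divisionE[OF AC half_gt_zero[OF \<open>e > 0\<close>]] by blast
    have Nm: "N \<in> lmeasurable" "measure lebesgue N = 0" using N by (auto simp: negligible_iff_measure)
    obtain V where V: "open V" "N \<subseteq> V" "V \<in> lmeasurable" "measure lebesgue V < measure lebesgue N + \<delta>"
      using lmeasurable_outer_open[OF Nm(1) \<open>\<delta> > 0\<close>] by blast
    then have Vm: "V \<in> lmeasurable" "measure lebesgue V < \<delta>" using Nm(2) by auto
    have "\<exists>r>0. (x \<in> N \<longrightarrow> ball x r \<subseteq> V) \<and> (x \<in> {c..d} - N \<longrightarrow>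
       (\<forall>y. \<bar>y - x\<bar> < r \<longrightarrow> norm (f y - f x - (y - x) *\<^sub>R f' x) \<le> e1 * \<bar>y - x\<bar>))" for x
    proof (cases "x \<in> N")
      case True
      then show ?thesis using V by (meson DiffD2 openE subsetD)
    next
      case False
      show ?thesis
      proof (cases "x \<in> {c..d}")
        case True
        then have "(f has_derivative (\<lambda>h. h *\<^sub>R f' x)) (at x)"
          using der[of x] False by (simp add: has_vector_derivative_def)
        then obtain r where "r > 0" "\<forall>y. norm (y - x) < r \<longrightarrow> norm (f y - f x - (y - x) *\<^sub>R f' x) \<le> e1 * norm (y - x)"
          using \<open>e1 > 0\<close> unfolding has_derivative_at_alt by blast
        then show ?thesis using False by auto
      qed (use False in \<open>auto intro: exI[of _ 1]\<close>)
    qed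
    then obtain r where r: "\<And>x. r x > 0" "\<And>x. x \<in> N \<Longrightarrow> ball x (r x) \<subseteq> V"
      "\<And>x y. \<lbrakk>x \<in> {c..d} - N; \<bar>y - x\<bar> < r x\<rbrakk> \<Longrightarrow> norm (f y - f x - (y - x) *\<^sub>R f' x) \<le> e1 * \<bar>y - x\<bar>"
      by metis
    have "norm ((\<Sum>(x,K)\<in>p. measure lborel K *\<^sub>R h x) - (f d - f c)) < e"
      if p: "p tagged_division_of cbox c d" "(\<lambda>x. ball x (r x)) fine p" for p
    proof -
      have fin: "finite p" using p(1) by (rule tagged_division_of_finite)
      define pN where "pN = {xK \<in> p. fst xK \<in> N}"
      have pN: "pN \<subseteq> p" by (auto simp: pN_def)
      have ptag: "p tagged_division_of {c..d}" using p(1) by simp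
      have sp: "\<exists>u v. K = {u..v} \<and> u \<le> v \<and> x \<in> {u..v} \<and> {u..v} \<subseteq> {c..d} \<and> {u..v} \<subseteq> ball x (r x)" if xK: "(x,K) \<in> p" for x K
      proof -
        obtain u v where uv: "K = {u..v}" using tagged_division_ofD(4)[OF ptag xK] by auto
        have "x \<in> K" "K \<subseteq> {c..d}" using tagged_division_ofD(2,3)[OF ptag xK] by auto
        moreover have "K \<subseteq> ball x (r x)" using p(2) xK by (auto simp: fine_def)
        ultimately show ?thesis using uv by auto
      qed
      define D where "D K = f (Sup K) - f (Inf K)" for K :: "real set"
      have tot: "(\<Sum>(x,K)\<in>p. D K) = f d - f c"
        unfolding D_def by (rule additive_tagged_division_1[OF \<open>c \<le> d\<close> ptag])
      have "(\<Sum>(x,K)\<in>p. measure lborel K *\<^sub>R h x) - (f d - f c) = (\<Sum>(x,K)\<in>p. measure lborel K *\<^sub>R h x - D K)"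
        unfolding tot[symmetric] by (simp add: sum_subtractf split_def)
      also have "\<dots> = (\<Sum>(x,K)\<in>pN. measure lborel K *\<^sub>R h x - D K) + (\<Sum>(x,K)\<in>p - pN. measure lborel K *\<^sub>R h x - D K)"
        using sum.subset_diff[OF pN fin] by (simp add: add.commute)
      also have "norm \<dots> \<le> norm (\<Sum>(x,K)\<in>pN. measure lborel K *\<^sub>R h x - D K) + norm (\<Sum>(x,K)\<in>p - pN. measure lborel K *\<^sub>R h x - D K)"
        by (rule norm_triangle_ineq)
      also have "norm (\<Sum>(x,K)\<in>pN. measure lborel K *\<^sub>R h x - D K) < e / 2"
      proof -
        have tp: "pN tagged_partial_division_of {c..d}"
          using tagged_partial_division_subset[OF _ pN] ptag by (auto simp: tagged_division_of_def)
        have td: "pN tagged_division_of \<Union>(snd ` pN)" using tagged_partial_division_of_Union_self[OF tp] .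
        have dv: "snd ` pN division_of \<Union>(snd ` pN)" using partial_division_of_tagged_division[OF tp] .
        have sub: "\<Union>(snd ` pN) \<subseteq> V" "\<Union>(snd ` pN) \<subseteq> {c..d}"
          using sp r(2) unfolding pN_def by fastforce+
        have "norm (\<Sum>(x,K)\<in>pN. measure lborel K *\<^sub>R h x - D K) = norm (\<Sum>(x,K)\<in>pN. D K)"
        proof -
          have "(\<Sum>(x,K)\<in>pN. measure lborel K *\<^sub>R h x - D K) = (\<Sum>(x,K)\<in>pN. - D K)"
            by (intro sum.cong refl) (auto simp: pN_def h_def)
          then show ?thesis by (simp add: split_def sum_negf)
        qed
        also have "\<dots> \<le> (\<Sum>(x,K)\<in>pN. norm (D K))"
          by (simp add: split_def norm_sum)
        also have "\<dots> = (\<Sum>(x,K)\<in>pN. if K = {} then 0 else norm (D K))"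
          using tagged_division_ofD(2)[OF td] by (intro sum.cong refl) (auto, metis empty_iff)
        \<comment> \<open>Passes from tagged intervals to intervals: two tags can share an interval
          only if it is degenerate, and there the increment is 0.\<close>
        also have "\<dots> = (\<Sum>K\<in>snd ` pN. if K = {} then 0 else norm (D K))"
        proof (rule sum.over_tagged_division_lemma[OF td])
          fix u v :: real assume "box u v = {}"
          then have "v \<le> u" by simp
          then show "(if cbox u v = {} then 0 else norm (D (cbox u v))) = 0"
            by (cases "u = v") (auto simp: D_def)
        qed
        also have "\<dots> = (\<Sum>K\<in>snd ` pN. norm (D K))"
          using division_ofD(3)[OF dv] by (intro sum.cong) auto
        also have "\<dots> < e / 2" unfolding D_def
        proof (rule \<delta>[OF dv sub(2)])
          have "(\<Sum>K\<in>snd ` pN. measure lebesgue K) = measure lebesgue (\<Union>(snd ` pN))" by (rule content_division[OF dv])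
          also have "\<dots> \<le> measure lebesgue V"
            by (rule measure_mono_fmeasurable[OF sub(1) fmeasurableD[OF lmeasurable_division[OF dv]] Vm(1)])
          finally show "(\<Sum>K\<in>snd ` pN. measure lebesgue K) < \<delta>" using Vm by simp
        qed
        finally show ?thesis .
      qed
      also have "norm (\<Sum>(x,K)\<in>p - pN. measure lborel K *\<^sub>R h x - D K) \<le> e1 * (d - c)"
      proof -
        have "norm (\<Sum>(x,K)\<in>p - pN. measure lborel K *\<^sub>R h x - D K) \<le> (\<Sum>(x,K)\<in>p - pN. e1 * measure lborel K)"
        proof (rule sum_norm_le, clarify)
          fix x K assume xK: "(x,K) \<in> p" "(x,K) \<notin> pN"
          then have xN: "x \<notin> N" by (auto simp: pN_def)
          obtain u v where uv: "K = {u..v}" "u \<le> v" "x \<in> {u..v}" "{u..v} \<subseteq> {c..d}" "{u..v} \<subseteq> ball x (r x)"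
            using sp[OF xK(1)] by blast
          have xc: "x \<in> {c..d} - N" using uv xN by blast
          have "u \<in> {u..v}" "v \<in> {u..v}" using uv by auto
          then have "u \<in> ball x (r x)" "v \<in> ball x (r x)" using uv(5) by blast+
          then have "norm (f u - f x - (u - x) *\<^sub>R f' x) \<le> e1 * \<bar>u - x\<bar>" "norm (f v - f x - (v - x) *\<^sub>R f' x) \<le> e1 * \<bar>v - x\<bar>"
            using r(3)[OF xc] by (auto simp: dist_real_def abs_minus_commute)
          \<comment> \<open>The error over \<open>{u..v}\<close> splits at the tag \<open>x\<close>
            into the errors of the linear approximation at the two end points.\<close>
          moreover have "measure lborel K *\<^sub>R h x - D K = (f u - f x - (u - x) *\<^sub>R f' x) - (f v - f x - (v - x) *\<^sub>R f' x)"
            using uv xN by (simp add: D_def h_def algebra_simps)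
          ultimately have "norm (measure lborel K *\<^sub>R h x - D K) \<le> e1 * \<bar>u - x\<bar> + e1 * \<bar>v - x\<bar>"
            using norm_triangle_ineq4[of "f u - f x - (u - x) *\<^sub>R f' x" "f v - f x - (v - x) *\<^sub>R f' x"] by simp
          also have "\<dots> = e1 * measure lborel K" using uv by (simp add: algebra_simps)
          finally show "norm (measure lborel K *\<^sub>R h x - D K) \<le> e1 * measure lborel K" .
        qed
        also have "\<dots> \<le> (\<Sum>(x,K)\<in>p. e1 * measure lborel K)"
          using fin e1 by (intro sum_mono2) (auto intro!: mult_nonneg_nonneg)
        also have "\<dots> = e1 * (\<Sum>(x,K)\<in>p. measure lborel K)" by (simp add: sum_distrib_left split_def)
        also have "(\<Sum>(x,K)\<in>p. measure lborel K) = d - c"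
          using additive_content_tagged_division[OF p(1)] \<open>c \<le> d\<close> by simp
        finally show ?thesis .
      qed
      finally show ?thesis using e1 by linarith
    qed
    moreover have "gauge (\<lambda>x. ball x (r x))" using r(1) by (auto simp: gauge_def)
    ultimately show "\<exists>\<gamma>. gauge \<gamma> \<and> (\<forall>p. p tagged_division_of cbox c d \<and> \<gamma> fine p \<longrightarrow>
       norm ((\<Sum>(x,K)\<in>p. measure lborel K *\<^sub>R h x) - (f d - f c)) < e)" by blast
  qed
  then show ?thesis
    by (rule has_integral_spike[OF N, rotated]) (auto simp: h_def)
qed

lemma AC_on_imp_AC_division_Re_Im:
  assumes "AC_on c d f" shows "AC_division c d (\<lambda>x. Re (f x))" "AC_division c d (\<lambda>x. Im (f x))"
  using AC_division_compose[OF AC_on_imp_AC_division[OF assms], of Re]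
    AC_division_compose[OF AC_on_imp_AC_division[OF assms], of Im]
    abs_Re_le_cmod abs_Im_le_cmod
  by (auto simp: minus_complex.simps[symmetric] simp del: minus_complex.simps)

theorem AC_on_has_vector_derivative_ae:
  assumes "AC_on c d f"
  shows "negligible {x\<in>{c<..<d}. \<not> (f has_vector_derivative vector_derivative f (at x)) (at x)}"
proof -
  note AC_division_differentiable_ae[OF AC_on_imp_AC_division_Re_Im(1)[OF assms]]
    AC_division_differentiable_ae[OF AC_on_imp_AC_division_Re_Im(2)[OF assms]]
  from negligible_Un[OF this] show ?thesis
  proof (rule negligible_subset, intro subsetI)
    fix x assume "x \<in> {x\<in>{c<..<d}. \<not> (f has_vector_derivative vector_derivative f (at x)) (at x)}"
    moreover have "(f has_vector_derivative vector_derivative f (at x)) (at x)"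
      if "(\<lambda>x. Re (f x)) differentiable at x" "(\<lambda>x. Im (f x)) differentiable at x"
    proof -
      obtain a b where "((\<lambda>x. Re (f x)) has_vector_derivative a) (at x)" "((\<lambda>x. Im (f x)) has_vector_derivative b) (at x)"
        using \<open>(\<lambda>x. Re (f x)) differentiable at x\<close> \<open>(\<lambda>x. Im (f x)) differentiable at x\<close>
        unfolding vector_derivative_works by blast
      from has_vector_derivative_add[OF bounded_linear.has_vector_derivative[OF bounded_linear_of_real this(1)]
        bounded_linear.has_vector_derivative[OF bounded_linear_compose[OF bounded_linear_mult_right bounded_linear_of_real] this(2), of \<i>]]
      have "(f has_vector_derivative (complex_of_real a + \<i> * complex_of_real b)) (at x)"
        by (simp add: complex_eq[symmetric])
      then show ?thesis by (metis differentiableI_vector vector_derivative_works)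
    qed
    ultimately show "x \<in> {x \<in> {c<..<d}. \<not> (\<lambda>x. Re (f x)) differentiable at x} \<union>
      {x \<in> {c<..<d}. \<not> (\<lambda>x. Im (f x)) differentiable at x}" by blast
  qed
qed

theorem AC_on_FTC:
  assumes "AC_on c d f" "c \<le> d" 
  shows "((\<lambda>x. vector_derivative f (at x)) has_integral (f d - f c)) {c..d}"
proof (rule AC_division_FTC[OF AC_on_imp_AC_division[OF assms(1)] assms(2)])
  \<comment> \<open>The end points join the exceptional set because the derivative is two-sided and
    \<open>AC_on\<close> says nothing about \<open>f\<close> beyond them.\<close>
  show "negligible ({x\<in>{c<..<d}. \<not> (f has_vector_derivative vector_derivative f (at x)) (at x)} \<union> {c,d})"
    by (intro negligible_Un AC_on_has_vector_derivative_ae assms) simp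
qed auto

section \<open>The first order system of a Sturm--Liouville equation\<close>

lemma AE_lebesgue_on_iff_negligible:
  fixes I :: "real set"
  assumes "I \<in> sets lebesgue"
  shows "(AE x in lebesgue_on I. P x) \<longleftrightarrow> negligible {x\<in>I. \<not> P x}"
proof -
  have "(AE x in lebesgue_on I. P x) \<longleftrightarrow> (AE x in lebesgue. x \<in> I \<longrightarrow> P x)"
    using assms by (intro AE_restrict_space_iff) simp
  also have "\<dots> \<longleftrightarrow> negligible {x\<in>I. \<not> P x}"
  proof
    assume "AE x in lebesgue. x \<in> I \<longrightarrow> P x"
    then obtain N where "{x\<in>space lebesgue. \<not> (x \<in> I \<longrightarrow> P x)} \<subseteq> N" "emeasure lebesgue N = 0" "N \<in> sets lebesgue"
      by (rule AE_E)
    then have "negligible N" "{x\<in>I. \<not> P x} \<subseteq> N" by (auto simp: negligible_iff_null_sets null_sets_def)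
    then show "negligible {x\<in>I. \<not> P x}" by (rule negligible_subset)
  next
    assume "negligible {x\<in>I. \<not> P x}"
    then have "AE x in lebesgue. x \<notin> {x\<in>I. \<not> P x}"
      by (intro AE_not_in) (simp add: negligible_iff_null_sets)
    then show "AE x in lebesgue. x \<in> I \<longrightarrow> P x" by eventually_elim auto
  qed
  finally show ?thesis .
qed

lemma open_dom_int: "open (dom_int L)" and connected_dom_int: "connected (dom_int L)"
proof -
  have "is_interval (dom_int L)"
    unfolding is_interval_1 dom_int_def einterval_def
    by (auto, (meson ereal_less_eq(3) le_less_trans less_le_trans)+)
  then show "connected (dom_int L)" by (simp add: is_interval_connected)
qed (simp add: dom_int_def)

lemma dom_int_lebesgue: "dom_int L \<in> sets lebesgue"
  using open_dom_int by auto

lemma dom_int_Icc_neighbourhood: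
  assumes "x \<in> dom_int L" obtains c d where "c < x" "x < d" "{c..d} \<subseteq> dom_int L"
proof -
  obtain e where "e > 0" "cball x e \<subseteq> dom_int L"
    using open_dom_int assms open_contains_cball by blast
  then show ?thesis using that[of "x - e" "x + e"] by (auto simp: cball_eq_atLeastAtMost)
qed

lemma AC_loc_continuous_on:
  assumes "AC_loc (dom_int L) f" shows "continuous_on (dom_int L) f"
  unfolding continuous_on_eq_continuous_at[OF open_dom_int]
proof
  fix x assume "x \<in> dom_int L"
  then obtain c d where cd: "c < x" "x < d" "{c..d} \<subseteq> dom_int L" by (rule dom_int_Icc_neighbourhood)
  then have "continuous_on {c..d} f" using assms unfolding AC_loc_def
    by (intro AC_division_continuous_on AC_on_imp_AC_division) auto
  then show "isCont f x" using cd
    by (metis continuous_on_interior interior_atLeastAtMost_real greaterThanLessThan_iff)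
qed

lemma AC_loc_has_vector_derivative_ae:
  assumes "AC_loc (dom_int L) f"
  shows "AE x in lebesgue_on (dom_int L). (f has_vector_derivative vector_derivative f (at x)) (at x)"
  unfolding AE_lebesgue_on_iff_negligible[OF dom_int_lebesgue]
proof -
  let ?S = "{x\<in>dom_int L. \<not> (f has_vector_derivative vector_derivative f (at x)) (at x)}"
  show "negligible ?S"
    unfolding locally_negligible_alt[of ?S]
  proof
    fix x assume x: "x \<in> ?S"
    then obtain c d where cd: "c < x" "x < d" "{c..d} \<subseteq> dom_int L" using dom_int_Icc_neighbourhood by blast
    then have "AC_on c d f" using assms unfolding AC_loc_def by simp
    from AC_on_has_vector_derivative_ae[OF this] have "negligible (?S \<inter> {c<..<d})"
      by (rule negligible_subset) auto
    moreover have "openin (top_of_set ?S) (?S \<inter> {c<..<d})" by (rule openin_open_Int) simp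
    ultimately show "\<exists>U. openin (top_of_set ?S) U \<and> x \<in> U \<and> negligible U" using x cd by auto
  qed
qed

abbreviation sl_rhs1 :: "sturm_liouville \<Rightarrow> (real \<Rightarrow> complex) \<Rightarrow> (real \<Rightarrow> complex) \<Rightarrow> real \<Rightarrow> complex" where
  "sl_rhs1 L u w \<equiv> (\<lambda>x. w x / of_real (coef_p L x) - of_real (coef_s L x) * u x)"

abbreviation sl_rhs2 ::
    "sturm_liouville \<Rightarrow> complex \<Rightarrow> (real \<Rightarrow> complex) \<Rightarrow> (real \<Rightarrow> complex) \<Rightarrow> real \<Rightarrow> complex" where
  "sl_rhs2 L z u w \<equiv> (\<lambda>x. of_real (coef_s L x) * w x + (of_real (coef_q L x) - z * of_real (coef_r L x)) * u x)"

text \<open>The equation in integrated form, with the quasi-derivative as an explicit second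
  component \<open>w\<close>. Since \<open>quasi_deriv\<close> is a choice, its behaviour under
  linear combinations and conjugation is not immediate, whereas this predicate is closed under both.
  The pointwise derivative of \<open>u\<close> is kept because it recovers \<open>w\<close> from
  \<open>u\<close>.\<close>

definition sl_system :: "sturm_liouville \<Rightarrow> complex \<Rightarrow> (real \<Rightarrow> complex) \<Rightarrow> (real \<Rightarrow> complex) \<Rightarrow> bool" where
  "sl_system L z u w \<longleftrightarrow> continuous_on (dom_int L) u \<and> continuous_on (dom_int L) w \<and>
     (AE x in lebesgue_on (dom_int L). (u has_vector_derivative
        (sl_rhs1 L u w x)) (at x)) \<and>
     (\<forall>c d. c \<le> d \<longrightarrow> {c..d} \<subseteq> dom_int L \<longrightarrow>
        (sl_rhs1 L u w has_integral (u d - u c)) {c..d} \<and>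
        (sl_rhs2 L z u w
           has_integral (w d - w c)) {c..d})"

lemma has_integral_AE_cong:
  assumes "AE x in lebesgue_on (dom_int L). f x = g x" "{c..d} \<subseteq> dom_int L" "(f has_integral i) {c..d}"
  shows "(g has_integral i) {c..d}"
proof (rule has_integral_spike[OF _ _ assms(3)])
  show "negligible {x\<in>dom_int L. f x \<noteq> g x}"
    using assms(1) by (simp add: AE_lebesgue_on_iff_negligible[OF dom_int_lebesgue])
qed (use assms(2) in auto)

lemma is_solution_imp_sl_system:
  assumes "sl_coefficients L" "is_solution L z u"
  shows "sl_system L z u (quasi_deriv L u)"
proof -
  let ?I = "dom_int L" and ?w = "quasi_deriv L u"
  have u: "AC_loc ?I u" and "\<exists>g. is_quasi_deriv L u g"
    using assms(2) unfolding is_solution_def D_tau_def by auto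
  from this(2) have "is_quasi_deriv L u ?w" unfolding quasi_deriv_def by (rule someI_ex)
  then have w: "AC_loc ?I ?w" and
    w_eq: "AE x in lebesgue_on ?I. ?w x = of_real (coef_p L x) * (vector_derivative u (at x) + of_real (coef_s L x) * u x)"
    unfolding is_quasi_deriv_def by auto
  have p0: "AE x in lebesgue_on ?I. coef_p L x \<noteq> 0" and r0: "AE x in lebesgue_on ?I. coef_r L x > 0"
    using assms(1) by (auto simp: sl_coefficients_def)
  have t: "AE x in lebesgue_on ?I. tau L u x = z * u x" using assms(2) by (simp add: is_solution_def)
  have vu: "AE x in lebesgue_on ?I. vector_derivative u (at x) = sl_rhs1 L u ?w x"
    using w_eq p0 by eventually_elim (auto simp: field_simps)
  have vw: "AE x in lebesgue_on ?I. vector_derivative ?w (at x) =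
     sl_rhs2 L z u ?w x"
    using t r0
  proof eventually_elim
    case (elim x)
    \<comment> \<open>Positivity of \<open>r\<close> cancels the factor \<open>1 / r\<close> in
      \<open>tau\<close>.\<close>
    then have "- vector_derivative ?w (at x) + of_real (coef_s L x) * ?w x + of_real (coef_q L x) * u x =
        of_real (coef_r L x) * (z * u x)"
      unfolding tau_def elim(1)[symmetric] by simp
    have "vector_derivative ?w (at x) = of_real (coef_s L x) * ?w x + of_real (coef_q L x) * u x -
        (- vector_derivative ?w (at x) + of_real (coef_s L x) * ?w x + of_real (coef_q L x) * u x)" by simp
    also have "\<dots> = of_real (coef_s L x) * ?w x + of_real (coef_q L x) * u x - of_real (coef_r L x) * (z * u x)"
      by (simp only: \<open>- _ + _ + _ = _\<close>)
    finally show ?case by (simp add: algebra_simps)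
  qed
  show ?thesis unfolding sl_system_def
  proof (intro conjI allI impI)
    show "continuous_on ?I u" "continuous_on ?I ?w" using u w by (auto intro: AC_loc_continuous_on)
    show "AE x in lebesgue_on ?I. (u has_vector_derivative
        (sl_rhs1 L u ?w x)) (at x)"
      using AC_loc_has_vector_derivative_ae[OF u] vu by eventually_elim simp
    fix c d :: real assume cd: "c \<le> d" "{c..d} \<subseteq> ?I"
    then have ac: "AC_on c d u" "AC_on c d ?w" using u w by (auto simp: AC_loc_def)
    show "(sl_rhs1 L u ?w has_integral (u d - u c)) {c..d}"
      by (rule has_integral_AE_cong[OF vu cd(2) AC_on_FTC[OF ac(1) cd(1)]])
    show "(sl_rhs2 L z u ?w
           has_integral (?w d - ?w c)) {c..d}"
      by (rule has_integral_AE_cong[OF vw cd(2) AC_on_FTC[OF ac(2) cd(1)]])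
  qed
qed

lemma sl_system_lincomb:
  assumes "sl_system L z u w" "sl_system L z u' w'"
  shows "sl_system L z (\<lambda>x. a * u x + b * u' x) (\<lambda>x. a * w x + b * w' x)"
  unfolding sl_system_def
proof (intro conjI allI impI)
  let ?I = "dom_int L"
  note A = assms[unfolded sl_system_def]
  show "continuous_on ?I (\<lambda>x. a * u x + b * u' x)" "continuous_on ?I (\<lambda>x. a * w x + b * w' x)"
    using A by (auto intro!: continuous_intros)
  have "AE x in lebesgue_on ?I. (u has_vector_derivative
        (sl_rhs1 L u w x)) (at x)"
    "AE x in lebesgue_on ?I. (u' has_vector_derivative
        (sl_rhs1 L u' w' x)) (at x)"
    using A by auto
  then show "AE x in lebesgue_on ?I. ((\<lambda>x. a * u x + b * u' x) has_vector_derivative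
        ((a * w x + b * w' x) / of_real (coef_p L x) - of_real (coef_s L x) * (a * u x + b * u' x))) (at x)"
  proof eventually_elim
    case (elim x)
    from has_vector_derivative_add[OF has_vector_derivative_mult_right[OF elim(1), of a] has_vector_derivative_mult_right[OF elim(2), of b]]
    show ?case by (simp add: field_simps add_divide_distrib)
  qed
  fix c d :: real assume "c \<le> d" "{c..d} \<subseteq> ?I"
  then have B: "(sl_rhs1 L u w has_integral (u d - u c)) {c..d}"
    "(sl_rhs1 L u' w' has_integral (u' d - u' c)) {c..d}"
    "(sl_rhs2 L z u w has_integral (w d - w c)) {c..d}"
    "(sl_rhs2 L z u' w' has_integral (w' d - w' c)) {c..d}"
    using A by auto
  show "((\<lambda>x. (a * w x + b * w' x) / of_real (coef_p L x) - of_real (coef_s L x) * (a * u x + b * u' x)) has_integral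
      (a * u d + b * u' d - (a * u c + b * u' c))) {c..d}"
    using has_integral_add[OF has_integral_mult_right[OF B(1), of a] has_integral_mult_right[OF B(2), of b]]
    by (simp add: algebra_simps add_divide_distrib)
  show "((\<lambda>x. of_real (coef_s L x) * (a * w x + b * w' x) + (of_real (coef_q L x) - z * of_real (coef_r L x)) * (a * u x + b * u' x))
     has_integral (a * w d + b * w' d - (a * w c + b * w' c))) {c..d}"
    using has_integral_add[OF has_integral_mult_right[OF B(3), of a] has_integral_mult_right[OF B(4), of b]]
    by (simp add: algebra_simps)
qed

text \<open>The coefficients are real. For a real parameter this turns a solution with real data at
  one point into a second solution with the same data, so uniqueness makes it real.\<close>

lemma sl_system_cnj:
  assumes "sl_system L z u w"
  shows "sl_system L (cnj z) (\<lambda>x. cnj (u x)) (\<lambda>x. cnj (w x))"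
  unfolding sl_system_def
proof (intro conjI allI impI)
  let ?I = "dom_int L"
  note A = assms[unfolded sl_system_def]
  show "continuous_on ?I (\<lambda>x. cnj (u x))" "continuous_on ?I (\<lambda>x. cnj (w x))"
    using A by (auto intro!: continuous_intros)
  have "AE x in lebesgue_on ?I. (u has_vector_derivative
        (sl_rhs1 L u w x)) (at x)"
    using A by auto
  then show "AE x in lebesgue_on ?I. ((\<lambda>x. cnj (u x)) has_vector_derivative
        (cnj (w x) / of_real (coef_p L x) - of_real (coef_s L x) * cnj (u x))) (at x)"
  proof eventually_elim
    case (elim x)
    from has_vector_derivative_cnj[OF elim] show ?case by simp
  qed
  fix c d :: real assume "c \<le> d" "{c..d} \<subseteq> ?I"
  then have B: "(sl_rhs1 L u w has_integral (u d - u c)) {c..d}"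
    "(sl_rhs2 L z u w has_integral (w d - w c)) {c..d}"
    using A by auto
  show "((\<lambda>x. cnj (w x) / of_real (coef_p L x) - of_real (coef_s L x) * cnj (u x)) has_integral
      (cnj (u d) - cnj (u c))) {c..d}"
    using has_integral_linear[OF B(1) bounded_linear_cnj] by (simp add: o_def)
  show "((\<lambda>x. of_real (coef_s L x) * cnj (w x) + (of_real (coef_q L x) - cnj z * of_real (coef_r L x)) * cnj (u x))
     has_integral (cnj (w d) - cnj (w c))) {c..d}"
    using has_integral_linear[OF B(2) bounded_linear_cnj] by (simp add: o_def)
qed

text \<open>If \<open>u\<close> vanishes then so does its derivative, so \<open>w / p\<close> and
  hence \<open>w\<close> vanish almost everywhere, and continuity does the rest. This supplies the
  second linear equation when the independence of \<open>\<theta>\<close> and \<open>\<phi>\<close>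
  is shown.\<close>

lemma sl_system_zero_quasi_deriv:
  assumes "sl_coefficients L" "sl_system L z u w" "\<And>x. x \<in> dom_int L \<Longrightarrow> u x = 0" "x \<in> dom_int L"
  shows "w x = 0"
proof -
  let ?I = "dom_int L"
  note A = assms(2)[unfolded sl_system_def]
  have p0: "AE x in lebesgue_on ?I. coef_p L x \<noteq> 0"
    using assms(1) by (auto simp: sl_coefficients_def)
  have "AE x in lebesgue_on ?I. (u has_vector_derivative
        (sl_rhs1 L u w x)) (at x)"
    using A by auto
  moreover have "AE x in lebesgue_on ?I. x \<in> ?I" using dom_int_lebesgue by (intro AE_I2) simp
  ultimately have "AE x in lebesgue_on ?I. w x = 0" using p0
  proof eventually_elim
    case (elim x)
    have "((\<lambda>x. 0) has_vector_derivative (0::complex)) (at x)" by (rule has_vector_derivative_const)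
    then have "(u has_vector_derivative 0) (at x)"
      by (rule has_vector_derivative_transform_within_open[OF _ open_dom_int elim(2)]) (simp add: assms(3))
    from vector_derivative_unique_at[OF this elim(1)] show ?case using elim assms(3) by auto
  qed
  then have neg: "negligible {x\<in>?I. w x \<noteq> 0}" by (simp add: AE_lebesgue_on_iff_negligible[OF dom_int_lebesgue])
  have "open {x\<in>?I. w x \<noteq> 0}"
  proof -
    have "continuous_on ?I w" using A by auto
    then have "open (?I \<inter> w -` (- {0}))" using open_dom_int by (intro continuous_open_preimage) auto
    then show ?thesis by (simp add: vimage_def Int_def)
  qed
  then have "{x\<in>?I. w x \<noteq> 0} = {}" using neg open_not_negligible by blast
  then show ?thesis using assms(4) by blast
qed

section \<open>A Gronwall estimate and continuous dependence on data and parameter\<close>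

text \<open>Over an interval on which \<open>k\<close> integrates to at most a quarter no
  exponential is required: with \<open>x1\<close> a maximum point of \<open>N\<close>, each of the
  two components changes by at most \<open>N x1 / 4\<close> apart from the contribution of
  \<open>h\<close>, and the resulting half of \<open>N x1\<close> is absorbed on the left.
  Connectedness of the domain covers longer distances later.\<close>

lemma gronwall_step:
  fixes U W f g :: "real \<Rightarrow> complex"
  assumes cont: "continuous_on {c..d} U" "continuous_on {c..d} W"
    and f: "\<And>a b. \<lbrakk>a \<le> b; {a..b} \<subseteq> {c..d}\<rbrakk> \<Longrightarrow> (f has_integral (U b - U a)) {a..b}"
    and g: "\<And>a b. \<lbrakk>a \<le> b; {a..b} \<subseteq> {c..d}\<rbrakk> \<Longrightarrow> (g has_integral (W b - W a)) {a..b}"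
    and k: "k integrable_on {c..d}" "\<And>x. x \<in> {c..d} \<Longrightarrow> 0 \<le> k x" "integral {c..d} k \<le> 1 / 4"
    and h: "h integrable_on {c..d}" "\<And>x. x \<in> {c..d} \<Longrightarrow> 0 \<le> h x"
    and fk: "\<And>x. x \<in> {c..d} \<Longrightarrow> norm (f x) \<le> k x * (norm (U x) + norm (W x))"
    and gk: "\<And>x. x \<in> {c..d} \<Longrightarrow> norm (g x) \<le> k x * (norm (U x) + norm (W x)) + h x"
    and xy: "x \<in> {c..d}" "y \<in> {c..d}"
  shows "norm (U x) + norm (W x) \<le> 2 * (norm (U y) + norm (W y) + integral {c..d} h)"
proof -
  define N where "N t = norm (U t) + norm (W t)" for t
  have "continuous_on {c..d} N" unfolding N_def by (intro continuous_intros cont)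
  then obtain x1 where x1: "x1 \<in> {c..d}" "\<And>t. t \<in> {c..d} \<Longrightarrow> N t \<le> N x1"
    using continuous_attains_sup[of "{c..d}" N] xy by auto
  have N0: "0 \<le> N t" for t by (simp add: N_def)
  have est: "norm (U b - U a) \<le> N x1 / 4 \<and> norm (W b - W a) \<le> N x1 / 4 + integral {c..d} h"
    if ab: "a \<le> b" "{a..b} \<subseteq> {c..d}" for a b
  proof -
    have ki: "k integrable_on {a..b}" "h integrable_on {a..b}"
      using k(1) h(1) ab(2) integrable_subinterval_real by blast+
    have kle: "integral {a..b} k \<le> 1 / 4"
      using integral_subset_le[OF ab(2) ki(1) k(1)] k(2,3) by (meson order_trans)
    have hle: "integral {a..b} h \<le> integral {c..d} h"
      using integral_subset_le[OF ab(2) ki(2) h(1)] h(2) by auto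
    have kN: "(\<lambda>t. k t * N x1) integrable_on {a..b}" using ki(1) by (rule integrable_on_mult_left)
    have "norm (integral {a..b} f) \<le> integral {a..b} (\<lambda>t. k t * N x1)"
    proof (rule integral_norm_bound_integral[OF _ kN])
      show "f integrable_on {a..b}" using f[OF ab] by blast
      fix t assume "t \<in> {a..b}"
      then have t: "t \<in> {c..d}" using ab by blast
      have "norm (f t) \<le> k t * N t" using fk[OF t] by (simp add: N_def)
      also have "\<dots> \<le> k t * N x1" using x1(2)[OF t] k(2)[OF t] by (rule mult_left_mono)
      finally show "norm (f t) \<le> k t * N x1" .
    qed
    also have "\<dots> = integral {a..b} k * N x1" by (rule integral_mult_left)
    also have "\<dots> \<le> 1 / 4 * N x1" using kle N0 by (rule mult_right_mono)
    finally have 1: "norm (U b - U a) \<le> N x1 / 4" using integral_unique[OF f[OF ab]] by simp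
    have "norm (integral {a..b} g) \<le> integral {a..b} (\<lambda>t. k t * N x1 + h t)"
    proof (rule integral_norm_bound_integral[OF _ integrable_add[OF kN ki(2)]])
      show "g integrable_on {a..b}" using g[OF ab] by blast
      fix t assume "t \<in> {a..b}"
      then have t: "t \<in> {c..d}" using ab by blast
      have "norm (g t) \<le> k t * N t + h t" using gk[OF t] by (simp add: N_def)
      also have "k t * N t \<le> k t * N x1" using x1(2)[OF t] k(2)[OF t] by (rule mult_left_mono)
      finally show "norm (g t) \<le> k t * N x1 + h t" by simp
    qed
    also have "\<dots> = integral {a..b} k * N x1 + integral {a..b} h"
      using Henstock_Kurzweil_Integration.integral_add[OF kN ki(2)] by (simp add: integral_mult_left)
    also have "\<dots> \<le> 1 / 4 * N x1 + integral {c..d} h" by (rule add_mono[OF mult_right_mono[OF kle N0] hle])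
    finally have 2: "norm (W b - W a) \<le> N x1 / 4 + integral {c..d} h" using integral_unique[OF g[OF ab]] by simp
    show ?thesis using 1 2 by blast
  qed
  have step: "N x1 \<le> N y + N x1 / 2 + integral {c..d} h"
  proof -
    have "norm (U x1 - U y) \<le> N x1 / 4 \<and> norm (W x1 - W y) \<le> N x1 / 4 + integral {c..d} h"
    proof (cases "x1 \<le> y")
      case True
      then show ?thesis using est[of x1 y] x1 xy by (auto simp: norm_minus_commute)
    next
      case False
      then show ?thesis using est[of y x1] x1 xy by auto
    qed
    moreover have "norm (U x1) \<le> norm (U y) + norm (U x1 - U y)" "norm (W x1) \<le> norm (W y) + norm (W x1 - W y)"
      using norm_triangle_sub by blast+
    ultimately show ?thesis unfolding N_def by linarith
  qed
  have "N x \<le> N x1" using x1 xy by blast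
  also have "\<dots> \<le> 2 * (N y + integral {c..d} h)" using step by simp
  finally show ?thesis by (simp add: N_def)
qed

lemma L1_loc_integrable_on:
  assumes "L1_loc (dom_int L) f" "{c..d} \<subseteq> dom_int L"
  shows "f integrable_on {c..d}" "(\<lambda>x. \<bar>f x\<bar>) integrable_on {c..d}"
proof -
  have "set_integrable lebesgue {c..d} f" using assms unfolding L1_loc_def by auto
  then have "f absolutely_integrable_on {c..d}" .
  then show "f integrable_on {c..d}" "(\<lambda>x. \<bar>f x\<bar>) integrable_on {c..d}"
    by (auto simp: absolutely_integrable_on_def)
qed

text \<open>The indefinite integral is continuous; half of \<open>\<epsilon>\<close> is spent on
  each side of \<open>x\<close>.\<close>

lemma small_integral_neighbourhood:
  assumes k: "\<And>c d. {c..d} \<subseteq> dom_int L \<Longrightarrow> k integrable_on {c..d}" and x: "x \<in> dom_int L" and "\<epsilon> > 0"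
  obtains c d where "c < x" "x < d" "{c..d} \<subseteq> dom_int L" "integral {c..d} k \<le> (\<epsilon>::real)"
proof -
  obtain c0 d0 where cd: "c0 < x" "x < d0" "{c0..d0} \<subseteq> dom_int L" using x by (rule dom_int_Icc_neighbourhood)
  define K where "K t = integral {c0..t} k" for t
  have "continuous_on {c0..d0} K" unfolding K_def by (rule indefinite_integral_continuous_1[OF k[OF cd(3)]])
  then obtain \<delta> where \<delta>: "\<delta> > 0" "\<And>t. t \<in> {c0..d0} \<Longrightarrow> dist t x < \<delta> \<Longrightarrow> dist (K t) (K x) < \<epsilon> / 2"
    using cd \<open>\<epsilon> > 0\<close> unfolding continuous_on_iff by (metis atLeastAtMost_iff half_gt_zero less_imp_le)
  define c where "c = max c0 (x - \<delta> / 2)"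
  define d where "d = min d0 (x + \<delta> / 2)"
  have 1: "c0 \<le> c" "c < x" "x < d" "d \<le> d0" using cd \<delta> by (auto simp: c_def d_def)
  have "dist (K c) (K x) < \<epsilon> / 2" "dist (K d) (K x) < \<epsilon> / 2"
    using \<delta> 1 by (auto intro!: \<delta>(2) simp: c_def d_def dist_real_def)
  moreover have sub: "{c0..d} \<subseteq> dom_int L" by (rule order_trans[OF _ cd(3)]) (use 1 in auto)
  moreover have sub': "{c..d} \<subseteq> dom_int L" by (rule order_trans[OF _ cd(3)]) (use 1 in auto)
  moreover have "K c + integral {c..d} k = K d" unfolding K_def
    by (rule Henstock_Kurzweil_Integration.integral_combine) (use 1 k[OF sub] in auto)
  ultimately have "integral {c..d} k \<le> \<epsilon>" by (simp add: dist_real_def abs_if split: if_splits)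
  then show ?thesis using that[of c d] 1 sub' by blast
qed

text \<open>The difference of two systems solves a system with a forcing term proportional to
  \<open>z i - \<omega>\<close>, so the Gronwall step spreads smallness at one point of a short
  interval uniformly over it. From \<open>x0\<close> it reaches every point by connectedness. An
  arbitrary filter lets one statement yield both uniqueness and continuity in the parameter.\<close>

lemma sl_system_tendsto_locally_uniform:
  fixes u w :: "'i \<Rightarrow> real \<Rightarrow> complex"
  assumes coef: "sl_coefficients L"
    and sys: "\<And>i. sl_system L (z i) (u i) (w i)" and lim: "sl_system L \<omega> u0 w0"
    and z: "(z \<longlongrightarrow> \<omega>) F"
    and init: "x0 \<in> dom_int L" "((\<lambda>i. u i x0) \<longlongrightarrow> u0 x0) F" "((\<lambda>i. w i x0) \<longlongrightarrow> w0 x0) F"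
    and x: "x \<in> dom_int L"
  obtains c d where "c < x" "x < d" "{c..d} \<subseteq> dom_int L"
    "\<And>\<epsilon>. \<epsilon> > 0 \<Longrightarrow> \<forall>\<^sub>F i in F. \<forall>t\<in>{c..d}. norm (u i t - u0 t) < \<epsilon>"
proof -
  let ?I = "dom_int L"
  define D where "D i t = norm (u i t - u0 t) + norm (w i t - w0 t)" for i t
  \<comment> \<open>Eventually bounds all \<open>z i\<close>, so that one majorant \<open>k\<close>
    of the coefficients serves along the filter.\<close>
  define Z where "Z = norm \<omega> + 1"
  define k where "k t = \<bar>1 / coef_p L t\<bar> + \<bar>coef_s L t\<bar> + \<bar>coef_q L t\<bar> + Z * \<bar>coef_r L t\<bar>" for t
  have Z0: "Z > 0" unfolding Z_def by (simp add: add_nonneg_pos)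
  have k0: "k t \<ge> 0" for t using Z0 by (auto simp: k_def)
  have L1: "L1_loc ?I (\<lambda>t. 1 / coef_p L t)" "L1_loc ?I (coef_q L)" "L1_loc ?I (coef_r L)" "L1_loc ?I (coef_s L)"
    using coef by (auto simp: sl_coefficients_def)
  have ki: "k integrable_on {c..d}" if "{c..d} \<subseteq> ?I" for c d
    unfolding k_def using L1[THEN L1_loc_integrable_on(2), OF that]
    by (intro integrable_add integrable_on_mult_right) auto
  have ri: "(\<lambda>t. \<bar>coef_r L t\<bar>) integrable_on {c..d}" if "{c..d} \<subseteq> ?I" for c d
    using L1(3)[THEN L1_loc_integrable_on(2), OF that] .
  have zZ: "\<forall>\<^sub>F i in F. norm (z i) \<le> Z"
  proof -
    have "\<forall>\<^sub>F i in F. dist (z i) \<omega> < 1" using z by (rule tendstoD) simp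
    then show ?thesis
    proof eventually_elim
      case (elim i)
      have "norm (z i) \<le> norm \<omega> + norm (z i - \<omega>)" by (rule norm_triangle_sub)
      then show ?case using elim by (simp add: Z_def dist_norm)
    qed
  qed
  have local: "\<exists>c d. c < a \<and> a < d \<and> {c..d} \<subseteq> ?I \<and>
      (\<forall>y\<in>{c..d}. ((\<lambda>i. D i y) \<longlongrightarrow> 0) F \<longrightarrow> (\<forall>\<epsilon>>0. \<forall>\<^sub>F i in F. \<forall>t\<in>{c..d}. D i t < \<epsilon>))"
    if a: "a \<in> ?I" for a
  proof -
    obtain c d where cd: "c < a" "a < d" "{c..d} \<subseteq> ?I" "integral {c..d} k \<le> 1 / 4"
      using small_integral_neighbourhood[OF ki a, of "1/4"] by auto
    have cu0: "continuous_on {c..d} u0" using lim cd(3) unfolding sl_system_def by (blast intro: continuous_on_subset)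
    have "compact (u0 ` {c..d})" by (rule compact_continuous_image[OF cu0]) simp
    then obtain B where B: "\<And>t. t \<in> {c..d} \<Longrightarrow> norm (u0 t) \<le> B"
      using compact_imp_bounded bounded_iff by (metis imageI)
    have B0: "0 \<le> B" using order_trans[OF norm_ge_zero B[of a]] cd by simp
    have bound: "D i t \<le> 2 * (D i y + norm (z i - \<omega>) * B * integral {c..d} (\<lambda>t. \<bar>coef_r L t\<bar>))"
      if i: "norm (z i) \<le> Z" and ty: "t \<in> {c..d}" "y \<in> {c..d}" for i t y
    proof -
      \<comment> \<open>A majorant of the forcing term, with \<open>B\<close> bounding
        \<open>u0\<close> on the interval.\<close>
      define h where "h t = norm (z i - \<omega>) * B * \<bar>coef_r L t\<bar>" for t
      note S = sys[of i, unfolded sl_system_def] and S0 = lim[unfolded sl_system_def]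
      have "norm (u i t - u0 t) + norm (w i t - w0 t) \<le> 2 * (norm (u i y - u0 y) + norm (w i y - w0 y) + integral {c..d} h)"
      proof (rule gronwall_step[where U="\<lambda>t. u i t - u0 t" and W="\<lambda>t. w i t - w0 t" and k=k and h=h
         and f="\<lambda>t. sl_rhs1 L (u i) (w i) t - sl_rhs1 L u0 w0 t"
         and g="\<lambda>t. sl_rhs2 L (z i) (u i) (w i) t - sl_rhs2 L \<omega> u0 w0 t"])
        have "continuous_on {c..d} (u i)" "continuous_on {c..d} (w i)" "continuous_on {c..d} w0"
          using S S0 cd(3) by (blast intro: continuous_on_subset)+
        then show "continuous_on {c..d} (\<lambda>t. u i t - u0 t)" "continuous_on {c..d} (\<lambda>t. w i t - w0 t)"
          using cu0 by (auto intro!: continuous_intros)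
        fix a b :: real assume ab: "a \<le> b" "{a..b} \<subseteq> {c..d}"
        then have ab': "{a..b} \<subseteq> ?I" using cd(3) by blast
        show "((\<lambda>t. sl_rhs1 L (u i) (w i) t - sl_rhs1 L u0 w0 t)
           has_integral (u i b - u0 b - (u i a - u0 a))) {a..b}"
          by (rule has_integral_eq_rhs[OF has_integral_diff[of _ "u i b - u i a" "{a..b}" _ "u0 b - u0 a"]])
            (use S S0 ab(1) ab' in \<open>blast, blast, simp\<close>)
        show "((\<lambda>t. sl_rhs2 L (z i) (u i) (w i) t - sl_rhs2 L \<omega> u0 w0 t)
           has_integral (w i b - w0 b - (w i a - w0 a))) {a..b}"
          by (rule has_integral_eq_rhs[OF has_integral_diff[of _ "w i b - w i a" "{a..b}" _ "w0 b - w0 a"]])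
            (use S S0 ab(1) ab' in \<open>blast, blast, simp\<close>)
      next
        show "h integrable_on {c..d}" unfolding h_def using ri[OF cd(3)] by (rule integrable_on_mult_right)
        show "0 \<le> h t" for t unfolding h_def using B0 by simp
      next
        fix t assume t: "t \<in> {c..d}"
        define U where "U = u i t - u0 t"
        define V where "V = w i t - w0 t"
        have "sl_rhs1 L (u i) (w i) t - sl_rhs1 L u0 w0 t
          = of_real (1 / coef_p L t) * V - of_real (coef_s L t) * U" by (simp add: U_def V_def field_simps diff_divide_distrib)
        also have "norm \<dots> \<le> \<bar>1 / coef_p L t\<bar> * norm V + \<bar>coef_s L t\<bar> * norm U"
          by (rule order_trans[OF norm_triangle_ineq4]) (simp only: norm_mult norm_of_real order_refl)
        also have "\<dots> \<le> k t * norm V + k t * norm U"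
          using Z0 by (intro add_mono mult_right_mono) (auto simp: k_def)
        finally show "norm (sl_rhs1 L (u i) (w i) t - sl_rhs1 L u0 w0 t)
          \<le> k t * (norm (u i t - u0 t) + norm (w i t - w0 t))" by (simp add: U_def V_def algebra_simps)
        have "sl_rhs2 L (z i) (u i) (w i) t - sl_rhs2 L \<omega> u0 w0 t
           = of_real (coef_s L t) * V + (of_real (coef_q L t) - z i * of_real (coef_r L t)) * U - (z i - \<omega>) * u0 t * of_real (coef_r L t)"
          by (simp add: U_def V_def algebra_simps)
        also have "norm \<dots> \<le> norm (of_real (coef_s L t) * V) + norm (of_real (coef_q L t) - z i * of_real (coef_r L t)) * norm U
            + norm ((z i - \<omega>) * u0 t * of_real (coef_r L t))"
          unfolding norm_mult[symmetric] by (meson add_mono norm_triangle_ineq norm_triangle_ineq4 order_refl order_trans)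
        also have "\<dots> \<le> \<bar>coef_s L t\<bar> * norm V + (\<bar>coef_q L t\<bar> + Z * \<bar>coef_r L t\<bar>) * norm U + h t"
        proof (intro add_mono mult_right_mono)
          show "norm (of_real (coef_s L t) * V) \<le> \<bar>coef_s L t\<bar> * norm V" by (simp add: norm_mult)
          have "norm (of_real (coef_q L t) - z i * of_real (coef_r L t)) \<le> \<bar>coef_q L t\<bar> + norm (z i) * \<bar>coef_r L t\<bar>"
            by (rule order_trans[OF norm_triangle_ineq4]) (simp add: norm_mult)
          also have "\<dots> \<le> \<bar>coef_q L t\<bar> + Z * \<bar>coef_r L t\<bar>" using i by (intro add_mono mult_right_mono) auto
          finally show "norm (of_real (coef_q L t) - z i * of_real (coef_r L t)) \<le> \<bar>coef_q L t\<bar> + Z * \<bar>coef_r L t\<bar>" .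
          show "norm ((z i - \<omega>) * u0 t * of_real (coef_r L t)) \<le> h t"
            unfolding h_def norm_mult using B[OF t] by (auto intro!: mult_right_mono mult_left_mono)
        qed simp
        also have "\<dots> \<le> k t * norm V + k t * norm U + h t"
          using Z0 by (intro add_mono mult_right_mono) (auto simp: k_def)
        finally show "norm (sl_rhs2 L (z i) (u i) (w i) t - sl_rhs2 L \<omega> u0 w0 t)
          \<le> k t * (norm (u i t - u0 t) + norm (w i t - w0 t)) + h t" by (simp add: U_def V_def algebra_simps)
      qed (use ki[OF cd(3)] k0 cd(4) ty in auto)
      then show ?thesis unfolding D_def h_def by (simp add: integral_mult_right)
    qed
    have "\<forall>\<^sub>F i in F. \<forall>t\<in>{c..d}. D i t < \<epsilon>" if y: "y \<in> {c..d}" "((\<lambda>i. D i y) \<longlongrightarrow> 0) F" and "\<epsilon> > 0" for y \<epsilon>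
    proof -
      have "((\<lambda>i. norm (z i - \<omega>)) \<longlongrightarrow> 0) F" using z by (simp add: LIM_zero tendsto_norm_zero)
      then have "((\<lambda>i. 2 * (D i y + norm (z i - \<omega>) * B * integral {c..d} (\<lambda>t. \<bar>coef_r L t\<bar>))) \<longlongrightarrow> 2 * (0 + 0 * B * integral {c..d} (\<lambda>t. \<bar>coef_r L t\<bar>))) F"
        using y(2) by (intro tendsto_intros)
      then have "\<forall>\<^sub>F i in F. 2 * (D i y + norm (z i - \<omega>) * B * integral {c..d} (\<lambda>t. \<bar>coef_r L t\<bar>)) < \<epsilon>"
        using \<open>\<epsilon> > 0\<close> by (auto dest: order_tendstoD(2))
      then show ?thesis using zZ
      proof eventually_elim
        case (elim i)
        show ?case using order_le_less_trans[OF bound[OF elim(2) _ y(1)] elim(1)] by blast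
      qed
    qed
    then show ?thesis using cd by blast
  qed
  \<comment> \<open>Near any given point, convergence at one place implies convergence at all
    others, and it holds at \<open>x0\<close>; connectedness propagates it.\<close>
  have conv: "((\<lambda>i. D i y) \<longlongrightarrow> 0) F" if "y \<in> ?I" for y
  proof (rule connected_induction_simple[where P="\<lambda>y. ((\<lambda>i. D i y) \<longlongrightarrow> 0) F", OF connected_dom_int init(1) that])
    show "((\<lambda>i. D i x0) \<longlongrightarrow> 0) F" unfolding D_def
      using init(2,3) by (intro tendsto_add_zero tendsto_norm_zero LIM_zero)
    fix a assume a: "a \<in> ?I"
    obtain c d where cd: "c < a" "a < d" "{c..d} \<subseteq> ?I" and
      un: "\<And>y. \<lbrakk>y\<in>{c..d}; ((\<lambda>i. D i y) \<longlongrightarrow> 0) F\<rbrakk> \<Longrightarrow> \<forall>\<epsilon>>0. \<forall>\<^sub>F i in F. \<forall>t\<in>{c..d}. D i t < \<epsilon>"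
      using local[OF a] by blast
    have st: "((\<lambda>i. D i y') \<longlongrightarrow> 0) F" if y: "y \<in> {c<..<d}" "y' \<in> {c<..<d}" "((\<lambda>i. D i y) \<longlongrightarrow> 0) F" for y y'
    proof (rule tendstoI)
      fix e :: real assume "e > 0"
      have "\<forall>\<^sub>F i in F. \<forall>t\<in>{c..d}. D i t < e" using un[of y] y \<open>e > 0\<close> by auto
      then show "\<forall>\<^sub>F i in F. dist (D i y') 0 < e"
      proof eventually_elim
        case (elim i)
        have "D i y' < e" using elim y by auto
        then show ?case by (simp add: dist_real_def D_def)
      qed
    qed
    have "{c<..<d} \<subseteq> ?I" using cd(3) by (rule order_trans[rotated]) auto
    then have op: "openin (top_of_set ?I) {c<..<d}" by (intro open_openin_trans open_dom_int) auto
    show "\<exists>T. openin (top_of_set ?I) T \<and> a \<in> T \<and> (\<forall>x\<in>T. \<forall>y\<in>T. ((\<lambda>i. D i x) \<longlongrightarrow> 0) F \<longrightarrow> ((\<lambda>i. D i y) \<longlongrightarrow> 0) F)"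
    proof (intro exI[of _ "{c<..<d}"] conjI ballI impI)
      show "a \<in> {c<..<d}" using cd by simp
    qed (rule op, erule (2) st)
  qed
  obtain c d where cd: "c < x" "x < d" "{c..d} \<subseteq> ?I" and
    un': "\<forall>y\<in>{c..d}. ((\<lambda>i. D i y) \<longlongrightarrow> 0) F \<longrightarrow> (\<forall>\<epsilon>>0. \<forall>\<^sub>F i in F. \<forall>t\<in>{c..d}. D i t < \<epsilon>)"
    using local[OF x] by blast
  have "x \<in> {c..d}" using cd by simp
  then have un: "\<forall>\<^sub>F i in F. \<forall>t\<in>{c..d}. D i t < \<epsilon>" if "\<epsilon> > 0" for \<epsilon>
    using un' conv[OF x] that by blast
  show ?thesis
  proof (rule that[OF cd])
    fix \<epsilon> :: real assume "\<epsilon> > 0"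
    from un[OF this] show "\<forall>\<^sub>F i in F. \<forall>t\<in>{c..d}. norm (u i t - u0 t) < \<epsilon>"
    proof eventually_elim
      case (elim i)
      then show ?case unfolding D_def by (metis add_le_same_cancel1 le_add_same_cancel1 norm_ge_zero order_le_less_trans)
    qed
  qed
qed

text \<open>A constant family that converges to the other solution: a nonzero difference at
  \<open>x\<close> would have to be smaller than itself.\<close>

corollary sl_system_unique:
  assumes "sl_coefficients L" "sl_system L z u w" "sl_system L z u' w'"
    "x0 \<in> dom_int L" "u x0 = u' x0" "w x0 = w' x0" "x \<in> dom_int L"
  shows "u x = u' x"
proof (rule ccontr)
  assume ne: "u x \<noteq> u' x"
  obtain c d where cd: "c < x" "x < d" and
    un: "\<And>\<epsilon>. \<epsilon> > 0 \<Longrightarrow> \<forall>\<^sub>F i::nat in sequentially. \<forall>t\<in>{c..d}. norm (u t - u' t) < \<epsilon>"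
    by (rule sl_system_tendsto_locally_uniform[of L "\<lambda>i. z" "\<lambda>i. u" "\<lambda>i. w" z u' w' sequentially x0 x])
      (use assms in auto)
  have "\<forall>t\<in>{c..d}. norm (u t - u' t) < norm (u x - u' x)"
    using un[of "norm (u x - u' x)"] ne by simp
  then show False using cd by auto
qed

text \<open>Uniformity of the convergence near \<open>x\<close> is what upgrades continuity in each
  variable to joint continuity.\<close>

corollary sl_system_jointly_continuous:
  assumes "sl_coefficients L" "\<And>z. sl_system L z (u z) (w z)"
    "x0 \<in> dom_int L" "\<And>z. u z x0 = a" "\<And>z. w z x0 = b"
  shows "continuous_on (dom_int L \<times> UNIV) (\<lambda>(x,z). u z x)"
proof -
  have "isCont (\<lambda>(x,z). u z x) (x, \<omega>)" if x: "x \<in> dom_int L" for x \<omega>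
  proof -
    \<comment> \<open>The filter is \<open>nhds\<close>, not \<open>at\<close>, so that the product
      neighbourhood formed below contains the parameter \<open>\<omega>\<close> itself.\<close>
    obtain c d where cd: "c < x" "x < d" "{c..d} \<subseteq> dom_int L" and
      un: "\<And>\<epsilon>. \<epsilon> > 0 \<Longrightarrow> \<forall>\<^sub>F z in nhds \<omega>. \<forall>t\<in>{c..d}. norm (u z t - u \<omega> t) < \<epsilon>"
    proof (rule sl_system_tendsto_locally_uniform[of L "\<lambda>z. z" u w \<omega> "u \<omega>" "w \<omega>" "nhds \<omega>" x0 x])
      show "((\<lambda>z. z) \<longlongrightarrow> \<omega>) (nhds \<omega>)" by (simp add: filterlim_ident)
    qed (use assms x in auto)
    have "((\<lambda>(x,z). u z x) \<longlongrightarrow> u \<omega> x) (nhds (x, \<omega>))"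
    proof (rule tendstoI)
      fix e :: real assume "e > 0"
      have "continuous_on (dom_int L) (u \<omega>)" using assms(2)[of \<omega>] by (simp add: sl_system_def)
      then have "isCont (u \<omega>) x" using x open_dom_int continuous_on_eq_continuous_at by blast
      then have "(u \<omega> \<longlongrightarrow> u \<omega> x) (nhds x)" unfolding continuous_within by (simp add: tendsto_at_iff_tendsto_nhds)
      then have "\<forall>\<^sub>F t in nhds x. dist (u \<omega> t) (u \<omega> x) < e / 2" using \<open>e > 0\<close> by (intro tendstoD) auto
      moreover have "\<forall>\<^sub>F t in nhds x. t \<in> {c<..<d}" using cd by (intro eventually_nhds_in_open) auto
      ultimately have 1: "\<forall>\<^sub>F t in nhds x. dist (u \<omega> t) (u \<omega> x) < e / 2 \<and> t \<in> {c<..<d}" by (rule eventually_conj)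
      have 2: "\<forall>\<^sub>F z in nhds \<omega>. \<forall>t\<in>{c..d}. norm (u z t - u \<omega> t) < e / 2" by (rule un[OF half_gt_zero[OF \<open>e > 0\<close>]])
      have "dist (u z t) (u \<omega> x) < e" if "dist (u \<omega> t) (u \<omega> x) < e / 2 \<and> t \<in> {c<..<d}"
        "\<forall>t\<in>{c..d}. norm (u z t - u \<omega> t) < e / 2" for t z
      proof -
        have "dist (u z t) (u \<omega> t) < e / 2" using that by (auto simp: dist_norm)
        then show ?thesis using that by (metis dist_commute dist_triangle_half_l)
      qed
      then show "\<forall>\<^sub>F y in nhds (x, \<omega>). dist (case y of (x,z) \<Rightarrow> u z x) (u \<omega> x) < e"
        unfolding nhds_prod eventually_prod_filter using 1 2 by (intro exI conjI) auto
    qed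
    then have "((\<lambda>(x,z). u z x) \<longlongrightarrow> u \<omega> x) (at (x, \<omega>))"
      by (rule tendsto_mono[rotated]) (simp add: at_within_def)
    then show ?thesis unfolding isCont_def by simp
  qed
  then show ?thesis by (intro continuous_at_imp_continuous_on) auto
qed

section \<open>Square integrable functions\<close>

text \<open>Polarization in the form used below: \<open>A\<close> and \<open>B\<close> are
  differences of the mixed terms of two quadratic forms that agree on all combinations, and the
  values 1 and \<open>\<i>\<close> of \<open>c\<close> separate them.\<close>

lemma polarization_zero:
  fixes A B :: complex
  assumes "\<And>c. cnj c * A + c * B = 0"
  shows "A = 0"
proof -
  have "A + B = 0" using assms[of 1] by simp
  moreover have "\<i> * (B - A) = 0" using assms[of \<i>] by (simp add: algebra_simps)
  then have "B = A" by simp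
  ultimately show ?thesis by simp
qed

text \<open>The carriers consist of representatives, not of classes, so the form is only
  semidefinite and the linear structure is passed as \<open>comb\<close>. The instances are the
  square integrable functions, those of the matrix measure, and the plane under a single positive
  semidefinite matrix.\<close>

locale semi_inner =
  fixes H :: "'v set" and comb :: "complex \<Rightarrow> 'v \<Rightarrow> complex \<Rightarrow> 'v \<Rightarrow> 'v" and ip :: "'v \<Rightarrow> 'v \<Rightarrow> complex"
  assumes comb_in: "\<lbrakk>f \<in> H; g \<in> H\<rbrakk> \<Longrightarrow> comb c f d g \<in> H"
    and ip_comb: "\<lbrakk>f \<in> H; g \<in> H; h \<in> H\<rbrakk> \<Longrightarrow> ip (comb c f d g) h = c * ip f h + d * ip g h"
    and ip_cnj: "\<lbrakk>f \<in> H; g \<in> H\<rbrakk> \<Longrightarrow> ip g f = cnj (ip f g)"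
    and ip_nonneg: "f \<in> H \<Longrightarrow> 0 \<le> Re (ip f f)"
begin

definition nrm :: "'v \<Rightarrow> real" where "nrm f = sqrt (Re (ip f f))"

lemma nrm_nonneg: "f \<in> H \<Longrightarrow> 0 \<le> nrm f"
  by (simp add: nrm_def ip_nonneg)

lemma ip_self: "f \<in> H \<Longrightarrow> ip f f = of_real ((nrm f)\<^sup>2)"
  using ip_cnj[of f f] ip_nonneg[of f] by (simp add: nrm_def complex_eq_iff)

lemma ip_comb_right:
  assumes "f \<in> H" "g \<in> H" "h \<in> H"
  shows "ip h (comb c f d g) = cnj c * ip h f + cnj d * ip h g"
  using ip_cnj[OF comb_in[OF assms(1,2)] assms(3), of c d] ip_comb[OF assms, of c d]
    ip_cnj[OF assms(1,3)] ip_cnj[OF assms(2,3)] by simp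

lemma ip_comb_self:
  assumes "f \<in> H" "g \<in> H"
  shows "ip (comb c f d g) (comb c f d g) =
    of_real ((norm c)\<^sup>2) * ip f f + c * cnj d * ip f g + d * cnj c * ip g f + of_real ((norm d)\<^sup>2) * ip g g"
  unfolding complex_norm_square using assms by (simp add: ip_comb ip_comb_right comb_in algebra_simps)

lemma cauchy_schwarz:
  assumes "f \<in> H" "g \<in> H"
  shows "norm (ip f g) \<le> nrm f * nrm g"
proof -
  define A where "A = (norm (ip f g))\<^sup>2"
  define N where "N = (nrm g)\<^sup>2"
  have ineq: "0 \<le> (nrm f)\<^sup>2 - 2 * t * A + t\<^sup>2 * A * N" for t :: real
  proof -
    \<comment> \<open>This phase makes both mixed terms real and leaves a quadratic polynomial in
      \<open>t\<close>.\<close>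
    define c where "c = - of_real t * ip f g"
    have "Re (ip (comb 1 f c g) (comb 1 f c g)) = (nrm f)\<^sup>2 - 2 * t * A + t\<^sup>2 * A * N"
    proof -
      have E: "ip f g * cnj (ip f g) = of_real A" unfolding A_def complex_norm_square ..
      have "cnj c * ip f g = of_real (- t) * (ip f g * cnj (ip f g))"
        "c * ip g f = of_real (- t) * (ip f g * cnj (ip f g))"
        unfolding c_def ip_cnj[OF assms] by simp_all
      then have 1: "cnj c * ip f g = of_real (- t * A)" "c * ip g f = of_real (- t * A)"
        unfolding E by simp_all
      have 2: "(norm c)\<^sup>2 = t\<^sup>2 * A" unfolding c_def A_def by (simp add: norm_mult power_mult_distrib)
      have "ip (comb 1 f c g) (comb 1 f c g) = of_real ((nrm f)\<^sup>2 - 2 * t * A + t\<^sup>2 * A * N)"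
        unfolding ip_comb_self[OF assms] ip_self[OF assms(1)] ip_self[OF assms(2)] 2 N_def using 1 by simp
      then show ?thesis by (metis Re_complex_of_real)
    qed
    then show ?thesis using ip_nonneg[OF comb_in[OF assms], of 1 c] by simp
  qed
  have A0: "0 \<le> A" and N0: "0 \<le> N" by (auto simp: A_def N_def)
  have "A \<le> (nrm f)\<^sup>2 * N"
  proof (cases "N = 0")
    case True
    have "A = 0"
    proof (rule ccontr)
      assume "A \<noteq> 0"
      then have "A > 0" using A0 by simp
      \<comment> \<open>For \<open>N = 0\<close> the polynomial is affine in \<open>t\<close>, and
        this value of \<open>t\<close> makes it -1.\<close>
      then show False using ineq[of "((nrm f)\<^sup>2 + 1) / (2 * A)"] True by simp
    qed
    then show ?thesis using True by simp
  next
    case False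
    then have "N > 0" using N0 by simp
    \<comment> \<open>\<open>1 / N\<close> is the minimum point of the polynomial.\<close>
    have "0 \<le> (nrm f)\<^sup>2 - A / N" using ineq[of "1 / N"] \<open>N > 0\<close> by (simp add: power2_eq_square)
    then show ?thesis using \<open>N > 0\<close> by (simp add: field_simps)
  qed
  then have "(norm (ip f g))\<^sup>2 \<le> (nrm f * nrm g)\<^sup>2" by (simp add: A_def N_def power_mult_distrib)
  then show ?thesis by (rule power2_le_imp_le) (use assms nrm_nonneg in auto)
qed

lemma nrm_comb_le:
  assumes "f \<in> H" "g \<in> H"
  shows "nrm (comb c f d g) \<le> norm c * nrm f + norm d * nrm g"
proof -
  have n0: "0 \<le> nrm f" "0 \<le> nrm g" using assms by (auto simp: nrm_nonneg)
  have "(nrm (comb c f d g))\<^sup>2 = Re (ip (comb c f d g) (comb c f d g))"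
    using ip_nonneg[OF comb_in[OF assms]] by (simp add: nrm_def)
  also have "\<dots> \<le> norm (ip (comb c f d g) (comb c f d g))" by (rule complex_Re_le_cmod)
  also have "\<dots> \<le> norm (of_real ((norm c)\<^sup>2) * ip f f) + norm (c * cnj d * ip f g) + norm (d * cnj c * ip g f)
      + norm (of_real ((norm d)\<^sup>2) * ip g g)"
    unfolding ip_comb_self[OF assms] by (rule order_trans[OF norm_triangle_ineq add_right_mono],
      rule order_trans[OF norm_triangle_ineq add_right_mono], rule norm_triangle_ineq)
  also have "\<dots> \<le> (norm c)\<^sup>2 * (nrm f)\<^sup>2 + norm c * norm d * (nrm f * nrm g) + norm d * norm c * (nrm f * nrm g) + (norm d)\<^sup>2 * (nrm g)\<^sup>2"
  proof (intro add_mono)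
    show "norm (of_real ((norm c)\<^sup>2) * ip f f) \<le> (norm c)\<^sup>2 * (nrm f)\<^sup>2"
      unfolding ip_self[OF assms(1)] by (simp add: norm_mult norm_power)
    show "norm (of_real ((norm d)\<^sup>2) * ip g g) \<le> (norm d)\<^sup>2 * (nrm g)\<^sup>2"
      unfolding ip_self[OF assms(2)] by (simp add: norm_mult norm_power)
    show "norm (c * cnj d * ip f g) \<le> norm c * norm d * (nrm f * nrm g)"
      unfolding norm_mult complex_mod_cnj using cauchy_schwarz[OF assms] by (intro mult_left_mono) auto
    show "norm (d * cnj c * ip g f) \<le> norm d * norm c * (nrm f * nrm g)"
      unfolding norm_mult complex_mod_cnj using cauchy_schwarz[OF assms(2,1)] by (intro mult_left_mono) (auto simp: mult.commute)
  qed
  also have "\<dots> = (norm c * nrm f + norm d * nrm g)\<^sup>2" by (simp add: power2_eq_square algebra_simps)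
  finally show ?thesis by (rule power2_le_imp_le) (use n0 in auto)
qed

end

section \<open>Inner product, norm and completeness of L2\<close>

lemma L2_product_integrable:
  assumes "f \<in> L2 M" "g \<in> L2 M"
  shows "integrable M (\<lambda>x. f x * cnj (g x))"
proof (rule Bochner_Integration.integrable_bound)
  show "integrable M (\<lambda>x. (cmod (f x))\<^sup>2 + (cmod (g x))\<^sup>2)" using assms by (simp add: L2_def)
  show "(\<lambda>x. f x * cnj (g x)) \<in> borel_measurable M"
    using assms by (auto simp: L2_def intro!: borel_measurable_times
      measurable_compose[OF _ borel_measurable_continuous_onI[of cnj]] continuous_intros)
  have "cmod (f x) * cmod (g x) \<le> (cmod (f x))\<^sup>2 + (cmod (g x))\<^sup>2" for x
  proof -
    have "0 \<le> cmod (f x) * cmod (g x)" by simp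
    then show ?thesis using sum_squares_bound[of "cmod (f x)" "cmod (g x)"] by linarith
  qed
  then show "AE x in M. norm (f x * cnj (g x)) \<le> norm ((cmod (f x))\<^sup>2 + (cmod (g x))\<^sup>2)"
    by (simp add: norm_mult)
qed

lemma L2_comb:
  assumes "f \<in> L2 M" "g \<in> L2 M"
  shows "(\<lambda>x. c * f x + d * g x) \<in> L2 M"
  unfolding L2_def
proof (intro CollectI conjI)
  show m: "(\<lambda>x. c * f x + d * g x) \<in> borel_measurable M" using assms by (auto simp: L2_def)
  show "integrable M (\<lambda>x. (cmod (c * f x + d * g x))\<^sup>2)"
  proof (rule Bochner_Integration.integrable_bound)
    show "integrable M (\<lambda>x. 2 * (norm c)\<^sup>2 * (cmod (f x))\<^sup>2 + 2 * (norm d)\<^sup>2 * (cmod (g x))\<^sup>2)"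
      using assms by (simp add: L2_def)
    show "(\<lambda>x. (cmod (c * f x + d * g x))\<^sup>2) \<in> borel_measurable M" using m by simp
    have "(cmod (c * f x + d * g x))\<^sup>2 \<le> 2 * (norm c)\<^sup>2 * (cmod (f x))\<^sup>2 + 2 * (norm d)\<^sup>2 * (cmod (g x))\<^sup>2" for x
    proof -
      have "(cmod (c * f x + d * g x))\<^sup>2 \<le> (norm c * cmod (f x) + norm d * cmod (g x))\<^sup>2"
        by (intro power_mono) (auto simp: norm_mult[symmetric] norm_triangle_ineq)
      also have "\<dots> \<le> 2 * (norm c * cmod (f x))\<^sup>2 + 2 * (norm d * cmod (g x))\<^sup>2"
        using sum_squares_bound[of "norm c * cmod (f x)" "norm d * cmod (g x)"] by (simp add: power2_sum)
      finally show ?thesis by (simp add: power_mult_distrib)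
    qed
    then show "AE x in M. norm ((cmod (c * f x + d * g x))\<^sup>2)
      \<le> norm (2 * (norm c)\<^sup>2 * (cmod (f x))\<^sup>2 + 2 * (norm d)\<^sup>2 * (cmod (g x))\<^sup>2)" by simp
  qed
qed

interpretation L2: semi_inner "L2 M" "\<lambda>c f d g x. c * f x + d * g x" "L2_inner M" for M
proof
  fix f g :: "'a \<Rightarrow> complex" and c d assume f: "f \<in> L2 M" and g: "g \<in> L2 M"
  show "(\<lambda>x. c * f x + d * g x) \<in> L2 M" using f g by (rule L2_comb)
  show "L2_inner M g f = cnj (L2_inner M f g)"
  proof -
    have "cnj (L2_inner M f g) = (\<integral>x. cnj (f x * cnj (g x)) \<partial>M)"
      unfolding L2_inner_def using integral_bounded_linear[OF bounded_linear_cnj L2_product_integrable[OF f g]] by simp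
    then show ?thesis unfolding L2_inner_def by (simp add: mult.commute)
  qed
  fix h assume h: "h \<in> L2 M"
  have "L2_inner M (\<lambda>x. c * f x + d * g x) h = (\<integral>x. c * (f x * cnj (h x)) + d * (g x * cnj (h x)) \<partial>M)"
    unfolding L2_inner_def by (simp add: algebra_simps)
  also have "\<dots> = c * L2_inner M f h + d * L2_inner M g h"
    unfolding L2_inner_def using L2_product_integrable[OF f h] L2_product_integrable[OF g h]
    by (subst Bochner_Integration.integral_add) auto
  finally show "L2_inner M (\<lambda>x. c * f x + d * g x) h = c * L2_inner M f h + d * L2_inner M g h" .
next
  fix f :: "'a \<Rightarrow> complex"
  have "L2_inner M f f = of_real (\<integral>x. (cmod (f x))\<^sup>2 \<partial>M)"
    unfolding L2_inner_def by (simp add: complex_norm_square[symmetric] flip: of_real_power)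
  then show "0 \<le> Re (L2_inner M f f)" by simp
qed

lemma L2_inner_self: "L2_inner M f f = of_real ((L2_norm M f)\<^sup>2)"
proof -
  have "L2_inner M f f = of_real (\<integral>x. (cmod (f x))\<^sup>2 \<partial>M)"
    unfolding L2_inner_def by (simp add: complex_norm_square[symmetric] flip: of_real_power)
  then show ?thesis by (simp add: L2_norm_def)
qed

lemma L2_nrm_eq: "L2.nrm M f = L2_norm M f"
  unfolding L2.nrm_def L2_inner_self by (simp add: L2_norm_def)

lemmas L2_cauchy_schwarz = L2.cauchy_schwarz[unfolded L2_nrm_eq]
  and L2_norm_comb_le = L2.nrm_comb_le[unfolded L2_nrm_eq]

lemma L2_diff: "\<lbrakk>f \<in> L2 M; g \<in> L2 M\<rbrakk> \<Longrightarrow> (\<lambda>x. f x - g x) \<in> L2 M"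
  and L2_add: "\<lbrakk>f \<in> L2 M; g \<in> L2 M\<rbrakk> \<Longrightarrow> (\<lambda>x. f x + g x) \<in> L2 M"
  using L2_comb[of f M g 1 "-1"] L2_comb[of f M g 1 1] by auto

lemma L2_norm_add_le: "\<lbrakk>f \<in> L2 M; g \<in> L2 M\<rbrakk> \<Longrightarrow> L2_norm M (\<lambda>x. f x + g x) \<le> L2_norm M f + L2_norm M g"
  using L2_norm_comb_le[of f M g 1 1] by auto

lemma L2_inner_diff_left:
  assumes "f \<in> L2 M" "g \<in> L2 M" "h \<in> L2 M"
  shows "L2_inner M (\<lambda>x. f x - g x) h = L2_inner M f h - L2_inner M g h"
  using L2.ip_comb[OF assms, of 1 "-1"] by simp

lemma L2_norm_nonneg: "0 \<le> L2_norm M f"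
  by (simp add: L2_norm_def)

lemma L2_norm_eq_0_AE:
  assumes "f \<in> L2 M" "L2_norm M f = 0"
  shows "AE x in M. f x = 0"
proof -
  have "(\<integral>x. (cmod (f x))\<^sup>2 \<partial>M) = 0" using assms(2) by (simp add: L2_norm_def)
  then have "AE x in M. (cmod (f x))\<^sup>2 = 0"
    using assms(1) by (subst integral_nonneg_eq_0_iff_AE[symmetric]) (auto simp: L2_def)
  then show ?thesis by simp
qed

lemma L2_inner_cong_AE:
  assumes "f \<in> L2 M" "f' \<in> L2 M" "AE x in M. f x = f' x" "g \<in> L2 M" "g' \<in> L2 M" "AE x in M. g x = g' x"
  shows "L2_inner M f g = L2_inner M f' g'"
  unfolding L2_inner_def
  using L2_product_integrable[OF assms(1,4)] L2_product_integrable[OF assms(2,5)] assms(3,6)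
  by (intro integral_cong_AE) auto

lemma L2_nn_integral_iff:
  "f \<in> L2 M \<longleftrightarrow> f \<in> borel_measurable M \<and> (\<integral>\<^sup>+x. ennreal ((cmod (f x))\<^sup>2) \<partial>M) < \<infinity>"
  by (auto simp: L2_def integrable_iff_bounded)

lemma L2_nn_integral_norm:
  "f \<in> L2 M \<Longrightarrow> (\<integral>\<^sup>+x. ennreal ((cmod (f x))\<^sup>2) \<partial>M) = ennreal ((L2_norm M f)\<^sup>2)"
  by (subst nn_integral_eq_integral) (auto simp: L2_def L2_norm_def)

lemma L2_norm_le_of_nn_integral:
  assumes "f \<in> borel_measurable M" "(\<integral>\<^sup>+x. ennreal ((cmod (f x))\<^sup>2) \<partial>M) \<le> ennreal (C\<^sup>2)" "0 \<le> C"
  shows "f \<in> L2 M" "L2_norm M f \<le> C"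
proof -
  show f: "f \<in> L2 M" unfolding L2_nn_integral_iff using assms by (auto intro: order_le_less_trans)
  then have "ennreal ((L2_norm M f)\<^sup>2) \<le> ennreal (C\<^sup>2)" using assms(2) L2_nn_integral_norm by metis
  then have "(L2_norm M f)\<^sup>2 \<le> C\<^sup>2" by simp
  then show "L2_norm M f \<le> C" using assms(3) by (rule power2_le_imp_le)
qed

lemma L2_norm_sum_le:
  fixes n :: nat
  assumes "\<And>i. i < n \<Longrightarrow> f i \<in> L2 M"
  shows "(\<lambda>x. \<Sum>i<n. f i x) \<in> L2 M \<and> L2_norm M (\<lambda>x. \<Sum>i<n. f i x) \<le> (\<Sum>i<n. L2_norm M (f i))"
  using assms
proof (induction n)
  case 0
  then show ?case by (simp add: L2_def L2_norm_def)
next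
  case (Suc n)
  then have IH: "(\<lambda>x. \<Sum>i<n. f i x) \<in> L2 M" "L2_norm M (\<lambda>x. \<Sum>i<n. f i x) \<le> (\<Sum>i<n. L2_norm M (f i))"
    and fn: "f n \<in> L2 M" by auto
  show ?case using L2_add[OF IH(1) fn] L2_norm_add_le[OF IH(1) fn] IH(2) by simp
qed

text \<open>A rapidly Cauchy subsequence has increments with summable norms; monotone convergence
  makes the sum of their absolute values finite almost everywhere, which gives a pointwise limit.
  Fatou's lemma then bounds the distance of every late \<open>f n\<close> from that limit.\<close>

theorem L2_complete:
  fixes f :: "nat \<Rightarrow> 'a \<Rightarrow> complex"
  assumes f: "\<And>n. f n \<in> L2 M"
    and cauchy: "\<And>e. e > 0 \<Longrightarrow> \<exists>N. \<forall>m\<ge>N. \<forall>n\<ge>N. L2_norm M (\<lambda>x. f m x - f n x) < e"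
  obtains g where "g \<in> L2 M" "(\<lambda>n. L2_norm M (\<lambda>x. f n x - g x)) \<longlonglongrightarrow> 0"
proof -
  have "\<exists>N. \<forall>m\<ge>N. \<forall>n\<ge>N. L2_norm M (\<lambda>x. f m x - f n x) < (1/2) ^ k" for k by (rule cauchy) simp
  then obtain N where N: "\<And>k m n. \<lbrakk>m \<ge> N k; n \<ge> N k\<rbrakk> \<Longrightarrow> L2_norm M (\<lambda>x. f m x - f n x) < (1/2) ^ k" by metis
  \<comment> \<open>This sum dominates \<open>N k\<close>, increases with \<open>k\<close> and is at
    least \<open>k\<close>, all by construction.\<close>
  define s where "s k = (\<Sum>i\<le>k. N i) + k" for k
  have sN: "N k \<le> s k" for k unfolding s_def by (cases k) auto
  have smono: "s k \<le> s (Suc k)" for k unfolding s_def by simp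
  have sk: "k \<le> s k" for k unfolding s_def by simp
  define h where "h k x = f (s (Suc k)) x - f (s k) x" for k x
  have h: "h k \<in> L2 M" for k unfolding h_def using f by (intro L2_diff) auto
  have hn: "L2_norm M (h k) \<le> (1/2) ^ k" for k
    unfolding h_def using N[of k "s (Suc k)" "s k"] sN[of k] smono[of k] by simp
  define D where "D n x = (\<Sum>k<n. cmod (h k x))" for n x
  have hm: "h k \<in> borel_measurable M" for k using h[of k] by (simp add: L2_def)
  have Dm: "D n \<in> borel_measurable M" for n unfolding D_def using hm by (intro borel_measurable_sum) auto
  have D0: "0 \<le> D n x" for n x unfolding D_def by (intro sum_nonneg) auto
  \<comment> \<open>The geometric series bounds the norm of \<open>D n\<close> by 2, whence the
    4.\<close>
  have Dint: "(\<integral>\<^sup>+x. ennreal ((D n x)\<^sup>2) \<partial>M) \<le> ennreal 4" for n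
  proof -
    have hc: "(\<lambda>x. complex_of_real (cmod (h k x))) \<in> L2 M" for k using h[of k] by (auto simp: L2_def)
    have A: "(\<lambda>x. \<Sum>k<n. complex_of_real (cmod (h k x))) \<in> L2 M"
      "L2_norm M (\<lambda>x. \<Sum>k<n. complex_of_real (cmod (h k x))) \<le> (\<Sum>k<n. L2_norm M (\<lambda>x. complex_of_real (cmod (h k x))))"
      using L2_norm_sum_le[of n "\<lambda>k x. complex_of_real (cmod (h k x))" M] hc by auto
    have eq: "(\<lambda>x. \<Sum>k<n. complex_of_real (cmod (h k x))) = (\<lambda>x. complex_of_real (D n x))" by (simp add: D_def)
    have "L2_norm M (\<lambda>x. complex_of_real (D n x)) \<le> (\<Sum>k<n. (1/2) ^ k)"
      using A(2) unfolding eq by (rule order_trans) (intro sum_mono, use hn in \<open>simp add: L2_norm_def\<close>)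
    also have "\<dots> \<le> 2" by (simp add: geometric_sum)
    finally have "(L2_norm M (\<lambda>x. complex_of_real (D n x)))\<^sup>2 \<le> 2\<^sup>2" using L2_norm_nonneg by (intro power_mono)
    then show ?thesis using L2_nn_integral_norm[OF A(1)[unfolded eq]] D0 ennreal_leI[of _ "2\<^sup>2"] by simp
  qed
  have inc: "incseq (\<lambda>n x. ennreal ((D n x)\<^sup>2))"
  proof (intro incseq_SucI le_funI ennreal_leI power_mono D0)
    show "D n x \<le> D (Suc n) x" for n x by (simp add: D_def)
  qed
  have "(\<integral>\<^sup>+x. (SUP n. ennreal ((D n x)\<^sup>2)) \<partial>M) = (SUP n. \<integral>\<^sup>+x. ennreal ((D n x)\<^sup>2) \<partial>M)"
    using Dm by (intro nn_integral_monotone_convergence_SUP inc) auto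
  also have "\<dots> \<le> ennreal 4" using Dint by (intro SUP_least) auto
  finally have "(\<integral>\<^sup>+x. (SUP n. ennreal ((D n x)\<^sup>2)) \<partial>M) \<noteq> \<infinity>" by (auto simp: top_unique)
  then have "AE x in M. (SUP n. ennreal ((D n x)\<^sup>2)) \<noteq> \<infinity>"
    using Dm by (intro nn_integral_PInf_AE) auto
  then have conv: "AE x in M. convergent (\<lambda>n. f (s n) x)"
  proof eventually_elim
    case (elim x)
    obtain B where B: "(SUP n. ennreal ((D n x)\<^sup>2)) = ennreal B" "B \<ge> 0"
      using elim by (cases "SUP n. ennreal ((D n x)\<^sup>2)") auto
    have "(D n x)\<^sup>2 \<le> B" for n
    proof -
      have "ennreal ((D n x)\<^sup>2) \<le> ennreal B" unfolding B(1)[symmetric] by (rule SUP_upper) simp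
      then show ?thesis using B(2) by simp
    qed
    then have "D n x \<le> sqrt B" for n by (rule real_le_rsqrt)
    then have "summable (\<lambda>k. cmod (h k x))" unfolding D_def
      by (intro summableI_nonneg_bounded[of _ "sqrt B"]) auto
    then have "summable (\<lambda>k. h k x)" by (rule summable_norm_cancel)
    then have "convergent (\<lambda>n. \<Sum>k<n. h k x)" by (simp add: summable_iff_convergent)
    moreover have "(\<Sum>k<n. h k x) = f (s n) x - f (s 0) x" for n
      unfolding h_def by (rule sum_lessThan_telescope)
    ultimately have "convergent (\<lambda>n. f (s n) x - f (s 0) x)" by simp
    from convergent_add[OF this convergent_const[of "f (s 0) x"]] show ?case by simp
  qed
  define g where "g x = lim (\<lambda>n. f (s n) x)" for x
  have fm: "f n \<in> borel_measurable M" for n using f[of n] by (simp add: L2_def)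
  have gm: "g \<in> borel_measurable M" unfolding g_def using fm by (intro borel_measurable_lim_metric)
  have glim: "AE x in M. (\<lambda>n. f (s n) x) \<longlonglongrightarrow> g x"
    using conv by eventually_elim (simp add: g_def convergent_LIMSEQ_iff)
  have close: "(\<lambda>x. f n x - g x) \<in> L2 M \<and> L2_norm M (\<lambda>x. f n x - g x) \<le> e"
    if N0: "\<And>m. m \<ge> N0 \<Longrightarrow> L2_norm M (\<lambda>x. f m x - f n x) < e" and "e > 0" for n N0 e
  proof -
    have "(\<integral>\<^sup>+x. ennreal ((cmod (f n x - g x))\<^sup>2) \<partial>M) \<le> (\<integral>\<^sup>+x. liminf (\<lambda>k. ennreal ((cmod (f (s k) x - f n x))\<^sup>2)) \<partial>M)"
    proof (rule nn_integral_mono_AE)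
      show "AE x in M. ennreal ((cmod (f n x - g x))\<^sup>2) \<le> liminf (\<lambda>k. ennreal ((cmod (f (s k) x - f n x))\<^sup>2))"
        using glim
      proof eventually_elim
        case (elim x)
        have "(\<lambda>k. ennreal ((cmod (f (s k) x - f n x))\<^sup>2)) \<longlonglongrightarrow> ennreal ((cmod (g x - f n x))\<^sup>2)"
          using elim by (intro tendsto_intros)
        from lim_imp_Liminf[OF _ this] show ?case by (simp add: norm_minus_commute)
      qed
    qed
    also have "\<dots> \<le> liminf (\<lambda>k. \<integral>\<^sup>+x. ennreal ((cmod (f (s k) x - f n x))\<^sup>2) \<partial>M)"
      using fm by (intro nn_integral_liminf) auto
    also have "\<dots> \<le> ennreal (e\<^sup>2)"
    proof -
      have "\<forall>\<^sub>F k in sequentially. (\<integral>\<^sup>+x. ennreal ((cmod (f (s k) x - f n x))\<^sup>2) \<partial>M) \<le> ennreal (e\<^sup>2)"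
        using eventually_ge_at_top[of N0]
      proof eventually_elim
        case (elim k)
        have "L2_norm M (\<lambda>x. f (s k) x - f n x) < e" using elim sk[of k] by (intro N0) auto
        then have "(L2_norm M (\<lambda>x. f (s k) x - f n x))\<^sup>2 \<le> e\<^sup>2" by (intro power_mono) (auto simp: L2_norm_nonneg)
        then show ?case using L2_nn_integral_norm[OF L2_diff[OF f f], of "s k" n] by (simp add: ennreal_leI)
      qed
      then show ?thesis by (rule Liminf_le[rotated]) simp
    qed
    finally show ?thesis
      using L2_norm_le_of_nn_integral[of "\<lambda>x. f n x - g x" M e] fm gm \<open>e > 0\<close> by auto
  qed
  obtain N1 where N1: "\<forall>m\<ge>N1. \<forall>n\<ge>N1. L2_norm M (\<lambda>x. f m x - f n x) < 1" using cauchy[of 1] by auto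
  have "(\<lambda>x. f N1 x - g x) \<in> L2 M" using close[of N1 N1 1] N1 by auto
  from L2_diff[OF f[of N1] this] have g: "g \<in> L2 M" by simp
  show ?thesis
  proof (rule that[OF g], rule LIMSEQ_I)
    fix e :: real assume "e > 0"
    obtain N2 where N2: "\<forall>m\<ge>N2. \<forall>n\<ge>N2. L2_norm M (\<lambda>x. f m x - f n x) < e / 2" using cauchy[of "e / 2"] \<open>e > 0\<close> by auto
    have "L2_norm M (\<lambda>x. f n x - g x) \<le> e / 2" if "n \<ge> N2" for n using close[of N2 n "e / 2"] N2 that \<open>e > 0\<close> by auto
    then have "norm (L2_norm M (\<lambda>x. f n x - g x) - 0) < e" if "n \<ge> N2" for n
      using that \<open>e > 0\<close> L2_norm_nonneg[of M "\<lambda>x. f n x - g x"] by fastforce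
    then show "\<exists>no. \<forall>n\<ge>no. norm (L2_norm M (\<lambda>x. f n x - g x) - 0) < e" by blast
  qed
qed

lemma L2_indicator_mult:
  assumes "f \<in> L2 M" "A \<in> sets M"
  shows "(\<lambda>x. indicator A x * f x) \<in> L2 M" "L2_norm M (\<lambda>x. indicator A x * f x) \<le> L2_norm M f"
proof -
  have m: "(\<lambda>x. indicator A x * f x) \<in> borel_measurable M" using assms by (auto simp: L2_def)
  have "(\<integral>\<^sup>+x. ennreal ((cmod (indicator A x * f x))\<^sup>2) \<partial>M) \<le> (\<integral>\<^sup>+x. ennreal ((cmod (f x))\<^sup>2) \<partial>M)"
    by (intro nn_integral_mono ennreal_leI) (auto simp: indicator_def)
  also have "\<dots> = ennreal ((L2_norm M f)\<^sup>2)" using L2_nn_integral_norm[OF assms(1)] .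
  finally show "(\<lambda>x. indicator A x * f x) \<in> L2 M" "L2_norm M (\<lambda>x. indicator A x * f x) \<le> L2_norm M f"
    using L2_norm_le_of_nn_integral[OF m] L2_norm_nonneg by blast+
qed

lemma L2_indicator_tendsto:
  assumes f: "f \<in> L2 M" and A: "\<And>n::nat. A n \<in> sets M" and lim: "\<And>x. x \<in> space M \<Longrightarrow> \<forall>\<^sub>F n in sequentially. x \<in> A n"
  shows "(\<lambda>n. L2_norm M (\<lambda>x. indicator (A n) x * f x - f x)) \<longlonglongrightarrow> 0"
proof -
  have fm: "f \<in> borel_measurable M" using f by (simp add: L2_def)
  have "(\<lambda>n. \<integral>x. (cmod (indicator (A n) x * f x - f x))\<^sup>2 \<partial>M) \<longlonglongrightarrow> (\<integral>x. 0 \<partial>M)"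
  proof (rule integral_dominated_convergence)
    show "integrable M (\<lambda>x. (cmod (f x))\<^sup>2)" using f by (simp add: L2_def)
    show "(\<lambda>x. (cmod (indicator (A n) x * f x - f x))\<^sup>2) \<in> borel_measurable M" for n
      using A fm by measurable
    show "AE x in M. norm ((cmod (indicator (A n) x * f x - f x))\<^sup>2) \<le> (cmod (f x))\<^sup>2" for n
      by (auto simp: indicator_def)
    show "AE x in M. (\<lambda>n. (cmod (indicator (A n) x * f x - f x))\<^sup>2) \<longlonglongrightarrow> 0"
    proof (rule AE_I2)
      fix x assume "x \<in> space M"
      from lim[OF this] show "(\<lambda>n. (cmod (indicator (A n) x * f x - f x))\<^sup>2) \<longlonglongrightarrow> 0"
        by (rule tendsto_eventually[OF eventually_mono]) simp
    qed
  qed simp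
  from tendsto_real_sqrt[OF this] show ?thesis by (simp add: L2_norm_def)
qed

section \<open>The space of square integrable functions of a matrix measure\<close>

text \<open>Hermitian symmetry is a clause of its own because the second clause controls only the
  real part of the form.\<close>

definition psd :: "complex^2^2 \<Rightarrow> bool" where
  "psd A \<longleftrightarrow> (\<forall>i j. A $ i $ j = cnj (A $ j $ i)) \<and> (\<forall>u. 0 \<le> Re (matrix_form A u u))"

lemma matrix_form_comb_left:
  "matrix_form A (c *s u + d *s w) v = c * matrix_form A u v + d * matrix_form A w v"
  by (simp add: matrix_form_def sum_2 algebra_simps)

lemma matrix_form_scale: "matrix_form A (c *s u) v = c * matrix_form A u v"
  by (simp add: matrix_form_def sum_2 algebra_simps)

lemma matrix_form_scale_right: "matrix_form A u (c *s v) = cnj c * matrix_form A u v"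
  by (simp add: matrix_form_def sum_2 algebra_simps)

lemma matrix_form_cnj:
  assumes "psd A" shows "matrix_form A w u = cnj (matrix_form A u w)"
proof -
  have "A $ 1 $ 1 = cnj (A $ 1 $ 1)" "A $ 1 $ 2 = cnj (A $ 2 $ 1)" "A $ 2 $ 2 = cnj (A $ 2 $ 2)"
    "A $ 2 $ 1 = cnj (A $ 1 $ 2)"
    using assms unfolding psd_def by blast+
  then show ?thesis by (simp add: matrix_form_def sum_2 algebra_simps)
qed

lemma psd_semi_inner:
  assumes "psd A" shows "semi_inner UNIV (\<lambda>c u d w. c *s u + d *s w) (matrix_form A)"
proof
  show "0 \<le> Re (matrix_form A f f)" for f using assms by (simp add: psd_def)
qed (auto simp: matrix_form_comb_left intro: matrix_form_cnj[OF assms])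

lemma psd_matrix_form_real: "psd A \<Longrightarrow> matrix_form A u u = of_real (Re (matrix_form A u u))"
  using matrix_form_cnj[of A u u] by (simp add: complex_eq_iff)

lemma psd_cauchy_schwarz:
  assumes "psd A"
  shows "cmod (matrix_form A u w) \<le> sqrt (Re (matrix_form A u u)) * sqrt (Re (matrix_form A w w))"
  using semi_inner.cauchy_schwarz[OF psd_semi_inner[OF assms], of u w]
  by (simp add: semi_inner.nrm_def[OF psd_semi_inner[OF assms]])

text \<open>Cauchy-Schwarz weakened to a sum, so that the bound is visibly integrable.\<close>

lemma psd_form_bound:
  assumes "psd A"
  shows "cmod (matrix_form A u w) \<le> Re (matrix_form A u u) + Re (matrix_form A w w)"
proof -
  let ?a = "sqrt (Re (matrix_form A u u))" and ?b = "sqrt (Re (matrix_form A w w))"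
  have "0 \<le> Re (matrix_form A u u)" "0 \<le> Re (matrix_form A w w)" using assms by (auto simp: psd_def)
  moreover from this have "0 \<le> ?a * ?b" by simp
  moreover have "2 * (?a * ?b) \<le> ?a\<^sup>2 + ?b\<^sup>2" using sum_squares_bound[of ?a ?b] by (simp add: mult.assoc)
  ultimately show ?thesis using psd_cauchy_schwarz[OF assms, of u w] by simp
qed

lemma vec_nth_measurable:
  fixes g :: "'a \<Rightarrow> complex^2"
  assumes "g \<in> borel_measurable N" shows "(\<lambda>t. g t $ i) \<in> borel_measurable N"
  by (rule measurable_compose[OF assms borel_measurable_continuous_onI[OF linear_continuous_on[OF bounded_linear_vec_nth]]])

lemma mat_nth_measurable:
  fixes g :: "'a \<Rightarrow> complex^2^2"
  assumes "g \<in> borel_measurable N" shows "(\<lambda>t. g t $ i $ j) \<in> borel_measurable N"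
proof -
  have "bounded_linear (\<lambda>A::complex^2^2. A $ i $ j)"
    using bounded_linear_compose[OF bounded_linear_vec_nth[of j] bounded_linear_vec_nth[of i]] by simp
  from measurable_compose[OF assms borel_measurable_continuous_onI[OF linear_continuous_on[OF this]]]
  show ?thesis .
qed

lemma vector_2_measurable:
  fixes f :: "'a \<Rightarrow> complex^2"
  assumes "(\<lambda>t. f t $ 1) \<in> borel_measurable N" "(\<lambda>t. f t $ 2) \<in> borel_measurable N"
  shows "f \<in> borel_measurable N"
proof -
  have eq: "f = (\<lambda>t. axis 1 (f t $ 1) + axis 2 (f t $ 2))"
    by (intro ext) (simp add: vec_eq_iff forall_2 axis_def)
  have ax: "bounded_linear (\<lambda>z::complex. axis i z :: complex^2)" for i
  proof -
    have "linear (\<lambda>z::complex. axis i z :: complex^2)"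
      by (rule linearI) (auto simp: vec_eq_iff axis_def)
    then show ?thesis by (simp add: linear_conv_bounded_linear)
  qed
  show ?thesis
    by (subst eq, intro borel_measurable_add; rule measurable_compose[OF _ borel_measurable_continuous_onI[OF linear_continuous_on[OF ax]]])
      (use assms in auto)
qed

lemma matrix_form_measurable:
  assumes "A \<in> borel_measurable N" "u \<in> borel_measurable N" "w \<in> borel_measurable N"
  shows "(\<lambda>t. matrix_form (A t) (u t) (w t)) \<in> borel_measurable N"
proof -
  have [measurable]: "(\<lambda>t. A t $ i $ j) \<in> borel_measurable N" "(\<lambda>t. u t $ i) \<in> borel_measurable N" for i j
    using assms by (auto intro: mat_nth_measurable vec_nth_measurable)
  have [measurable]: "(\<lambda>t. cnj (w t $ i)) \<in> borel_measurable N" for i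
    by (rule measurable_compose[OF vec_nth_measurable[OF assms(3)] borel_measurable_continuous_onI])
      (intro continuous_intros)
  show ?thesis unfolding matrix_form_def by measurable
qed

section \<open>Positivity of the density matrix\<close>

text \<open>The test sets are the parts of the negativity set in bounded intervals; the densities to
  which this is applied are only locally integrable.\<close>

lemma AE_nonneg_if_integrals_nonneg:
  fixes f :: "real \<Rightarrow> real"
  assumes sets: "sets \<mu> = sets borel"
    and int: "\<And>B. B \<in> sets borel \<Longrightarrow> bounded B \<Longrightarrow> set_integrable \<mu> B f"
    and nn: "\<And>B. B \<in> sets borel \<Longrightarrow> bounded B \<Longrightarrow> 0 \<le> (LINT t:B|\<mu>. f t)"
    and fm: "f \<in> borel_measurable \<mu>"
  shows "AE t in \<mu>. 0 \<le> f t"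
proof -
  have sp: "space \<mu> = UNIV" using sets_eq_imp_space_eq[OF sets] by simp
  have "AE t in \<mu>. t \<in> {- real n..real n} \<longrightarrow> 0 \<le> f t" for n
  proof -
    define B where "B = {- real n..real n} \<inter> {t. f t < 0}"
    have "{t. f t < 0} \<in> sets \<mu>" using measurable_sets[OF fm, of "{..<0}"] by (simp add: sp vimage_def lessThan_def)
    then have B: "B \<in> sets borel" "bounded B" unfolding B_def sets by (auto intro: bounded_subset[of "{- real n..real n}"])
    have i: "integrable \<mu> (\<lambda>t. indicator B t *\<^sub>R f t)" using int[OF B] by (simp add: set_integrable_def)
    have "(\<integral>t. - (indicator B t *\<^sub>R f t) \<partial>\<mu>) \<le> 0" using nn[OF B] by (simp add: set_lebesgue_integral_def)
    moreover have np: "AE t in \<mu>. 0 \<le> - (indicator B t *\<^sub>R f t)" by (auto simp: B_def indicator_def)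
    moreover have "0 \<le> (\<integral>t. - (indicator B t *\<^sub>R f t) \<partial>\<mu>)" by (rule integral_nonneg_AE[OF np])
    ultimately have "AE t in \<mu>. - (indicator B t *\<^sub>R f t) = 0"
      by (subst integral_nonneg_eq_0_iff_AE[symmetric]) (use i in auto)
    then show ?thesis by eventually_elim (auto simp: B_def indicator_def split: if_splits)
  qed
  then have "AE t in \<mu>. \<forall>n::nat. t \<in> {- real n..real n} \<longrightarrow> 0 \<le> f t" unfolding AE_all_countable by blast
  then show ?thesis
  proof eventually_elim
    case (elim t)
    obtain n :: nat where "\<bar>t\<bar> \<le> real n" using real_arch_simple by blast
    then show ?case using elim by (auto simp: abs_le_iff)
  qed
qed

text \<open>Every real linear functional that is nonnegative on the values of
  \<open>\<Omega>\<close> at bounded Borel sets is nonnegative on \<open>R\<close> almost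
  everywhere. Hermitian symmetry and positivity are both of this kind; positivity involves
  uncountably many vectors, which a countable dense set and continuity reduce to countably
  many.\<close>

lemma AE_psd:
  assumes "matrix_measure \<Omega>" "trace_and_density \<Omega> \<mu> R"
  shows "AE t in \<mu>. psd (R t)"
proof -
  have sets: "sets \<mu> = sets borel" and Rm: "R \<in> borel_measurable \<mu>"
    and Ri: "\<And>B. B \<in> sets borel \<Longrightarrow> bounded B \<Longrightarrow> set_integrable \<mu> B R"
    and RO: "\<And>B. B \<in> sets borel \<Longrightarrow> bounded B \<Longrightarrow> \<Omega> B = (LINT t:B|\<mu>. R t)"
    using assms(2) by (auto simp: trace_and_density_def)
  have herm: "\<Omega> B $ i $ j = cnj (\<Omega> B $ j $ i)" and pos: "0 \<le> Re (matrix_form (\<Omega> B) \<xi> \<xi>)"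
    if "B \<in> sets borel" "bounded B" for B i j \<xi>
    using assms(1) that unfolding matrix_measure_def by blast+
  have key: "AE t in \<mu>. 0 \<le> h (R t)" if h: "linear h" and hp: "\<And>B. B \<in> sets borel \<Longrightarrow> bounded B \<Longrightarrow> 0 \<le> h (\<Omega> B)"
    for h :: "complex^2^2 \<Rightarrow> real"
  proof (rule AE_nonneg_if_integrals_nonneg[OF sets])
    have bl: "bounded_linear h" using h by (simp add: linear_conv_bounded_linear)
    show "(\<lambda>t. h (R t)) \<in> borel_measurable \<mu>"
      by (rule measurable_compose[OF Rm borel_measurable_continuous_onI[OF linear_continuous_on[OF bl]]])
    fix B :: "real set" assume B: "B \<in> sets borel" "bounded B"
    have 1: "integrable \<mu> (\<lambda>t. indicator B t *\<^sub>R R t)" using Ri[OF B] by (simp add: set_integrable_def)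
    have eq: "(\<lambda>t. h (indicator B t *\<^sub>R R t)) = (\<lambda>t. indicator B t *\<^sub>R h (R t))"
      by (intro ext linear_scale[OF h])
    show "set_integrable \<mu> B (\<lambda>t. h (R t))"
      using integrable_bounded_linear[OF bl 1] unfolding eq by (simp add: set_integrable_def)
    have "(LINT t:B|\<mu>. h (R t)) = h (\<Omega> B)"
      using integral_bounded_linear[OF bl 1] unfolding eq RO[OF B] by (simp add: set_lebesgue_integral_def)
    then show "0 \<le> (LINT t:B|\<mu>. h (R t))" using hp[OF B] by simp
  qed
  have "AE t in \<mu>. R t $ i $ j = cnj (R t $ j $ i)" for i j
  proof -
    \<comment> \<open>An equation as four inequalities: \<open>s\<close> is the sign, and
      \<open>c = 1\<close> or \<open>c = \<i>\<close> selects the real or the imaginary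
      part.\<close>
    have "AE t in \<mu>. 0 \<le> s * Re (c * (R t $ i $ j - cnj (R t $ j $ i)))" for s :: real and c :: complex
    proof (rule key)
      show "linear (\<lambda>A::complex^2^2. s * Re (c * (A $ i $ j - cnj (A $ j $ i))))"
        by (rule linearI) (simp_all add: algebra_simps)
      fix B :: "real set" assume "B \<in> sets borel" "bounded B"
      from herm[OF this, of i j] show "0 \<le> s * Re (c * (\<Omega> B $ i $ j - cnj (\<Omega> B $ j $ i)))"
        by (simp only: diff_self mult_zero_right zero_complex.sel order_refl)
    qed
    from this[of 1 1] this[of "-1" 1] this[of 1 \<i>] this[of "-1" \<i>]
    show ?thesis by eventually_elim (simp add: complex_eq_iff)
  qed
  then have 1: "AE t in \<mu>. \<forall>i j. R t $ i $ j = cnj (R t $ j $ i)" by (simp add: AE_all_countable AE_finite_all forall_2)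
  obtain D :: "(complex^2) set" where D: "countable D" "\<And>X. open X \<Longrightarrow> X \<noteq> {} \<Longrightarrow> \<exists>d\<in>D. d \<in> X"
    by (rule countable_dense_setE) (rule that)
  have "AE t in \<mu>. 0 \<le> Re (matrix_form (R t) u u)" for u
  proof (rule key)
    show "linear (\<lambda>A. Re (matrix_form A u u))"
      by (rule linearI) (simp_all add: matrix_form_def sum_2 algebra_simps)
  qed (rule pos)
  then have 2: "AE t in \<mu>. \<forall>u\<in>D. 0 \<le> Re (matrix_form (R t) u u)" using D(1) by (simp add: AE_ball_countable)
  show ?thesis using 1 2
  proof eventually_elim
    case (elim t)
    have "0 \<le> Re (matrix_form (R t) u u)" for u
    proof (rule ccontr)
      assume neg: "\<not> ?thesis"
      have "continuous_on UNIV (\<lambda>u. Re (matrix_form (R t) u u))"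
        unfolding matrix_form_def by (intro continuous_intros)
      then have "open {u. Re (matrix_form (R t) u u) < 0}" by (intro open_Collect_less continuous_on_const)
      moreover have "{u. Re (matrix_form (R t) u u) < 0} \<noteq> {}" using neg not_le by blast
      ultimately have "\<exists>d\<in>D. d \<in> {u. Re (matrix_form (R t) u u) < 0}" by (rule D(2))
      then obtain d where "d \<in> D" "Re (matrix_form (R t) d d) < 0" by blast
      then show False using elim(2) by fastforce
    qed
    then show ?case using elim(1) unfolding psd_def by blast
  qed
qed

definition mnorm :: "real measure \<Rightarrow> (real \<Rightarrow> complex^2^2) \<Rightarrow> (real \<Rightarrow> complex^2) \<Rightarrow> real" where
  "mnorm \<mu> R g = sqrt (Re (inner_matrix \<mu> R g g))"

locale matrix_L2 =
  fixes \<mu> :: "real measure" and R :: "real \<Rightarrow> complex^2^2"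
  assumes sets_mu: "sets \<mu> = sets borel" and R_meas: "R \<in> borel_measurable \<mu>" and R_psd: "AE t in \<mu>. psd (R t)"
begin

lemma space_mu: "space \<mu> = UNIV"
  using sets_eq_imp_space_eq[OF sets_mu] by simp

lemma form_measurable:
  "\<lbrakk>g \<in> borel_measurable \<mu>; h \<in> borel_measurable \<mu>\<rbrakk> \<Longrightarrow> (\<lambda>t. matrix_form (R t) (g t) (h t)) \<in> borel_measurable \<mu>"
  by (rule matrix_form_measurable[OF R_meas])

lemma form_integrable:
  assumes "g \<in> L2_matrix \<mu> R" "h \<in> L2_matrix \<mu> R"
  shows "integrable \<mu> (\<lambda>t. matrix_form (R t) (g t) (h t))"
proof (rule Bochner_Integration.integrable_bound)
  show "integrable \<mu> (\<lambda>t. Re (matrix_form (R t) (g t) (g t)) + Re (matrix_form (R t) (h t) (h t)))"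
    using assms by (auto simp: L2_matrix_def)
  show "(\<lambda>t. matrix_form (R t) (g t) (h t)) \<in> borel_measurable \<mu>"
    using assms by (intro form_measurable) (auto simp: L2_matrix_def)
  show "AE t in \<mu>. norm (matrix_form (R t) (g t) (h t))
     \<le> norm (Re (matrix_form (R t) (g t) (g t)) + Re (matrix_form (R t) (h t) (h t)))"
    using R_psd
  proof eventually_elim
    case (elim t)
    show ?case using psd_form_bound[OF elim, of "g t" "h t"] by simp
  qed
qed

lemma comb_measurable:
  fixes f g :: "real \<Rightarrow> complex^2"
  assumes "f \<in> borel_measurable \<mu>" "g \<in> borel_measurable \<mu>" "(c :: real \<Rightarrow> complex) \<in> borel_measurable \<mu>" "d \<in> borel_measurable \<mu>"
  shows "(\<lambda>t. c t *s f t + d t *s g t) \<in> borel_measurable \<mu>"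
  by (rule vector_2_measurable)
    (use assms in \<open>auto intro!: borel_measurable_add borel_measurable_times vec_nth_measurable\<close>)

lemma L2_matrix_comb:
  assumes "f \<in> L2_matrix \<mu> R" "g \<in> L2_matrix \<mu> R"
  shows "(\<lambda>t. c *s f t + d *s g t) \<in> L2_matrix \<mu> R"
proof -
  have m: "(\<lambda>t. c *s f t + d *s g t) \<in> borel_measurable \<mu>"
    using assms by (intro comb_measurable) (auto simp: L2_matrix_def)
  have "integrable \<mu> (\<lambda>t. matrix_form (R t) (c *s f t + d *s g t) (c *s f t + d *s g t))"
  proof (rule Bochner_Integration.integrable_cong_AE_imp)
    show "integrable \<mu> (\<lambda>t. of_real ((norm c)\<^sup>2) * matrix_form (R t) (f t) (f t) + c * cnj d * matrix_form (R t) (f t) (g t)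
       + d * cnj c * matrix_form (R t) (g t) (f t) + of_real ((norm d)\<^sup>2) * matrix_form (R t) (g t) (g t))"
      using form_integrable assms by (intro Bochner_Integration.integrable_add integrable_mult_right) auto
    show "(\<lambda>t. matrix_form (R t) (c *s f t + d *s g t) (c *s f t + d *s g t)) \<in> borel_measurable \<mu>"
      by (rule form_measurable[OF m m])
    show "AE t in \<mu>. of_real ((norm c)\<^sup>2) * matrix_form (R t) (f t) (f t) + c * cnj d * matrix_form (R t) (f t) (g t)
       + d * cnj c * matrix_form (R t) (g t) (f t) + of_real ((norm d)\<^sup>2) * matrix_form (R t) (g t) (g t) =
       matrix_form (R t) (c *s f t + d *s g t) (c *s f t + d *s g t)"
      using R_psd by eventually_elim (simp add: semi_inner.ip_comb_self[OF psd_semi_inner])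
  qed
  then show ?thesis using m by (simp add: L2_matrix_def)
qed

sublocale semi_inner "L2_matrix \<mu> R" "\<lambda>c f d g t. c *s f t + d *s g t" "inner_matrix \<mu> R"
proof
  fix f g c d assume f: "f \<in> L2_matrix \<mu> R" and g: "g \<in> L2_matrix \<mu> R"
  show "(\<lambda>t. c *s f t + d *s g t) \<in> L2_matrix \<mu> R" using f g by (rule L2_matrix_comb)
  have "inner_matrix \<mu> R g f = (\<integral>t. cnj (matrix_form (R t) (f t) (g t)) \<partial>\<mu>)"
    unfolding inner_matrix_def
  proof (rule integral_cong_AE)
    show "AE t in \<mu>. matrix_form (R t) (g t) (f t) = cnj (matrix_form (R t) (f t) (g t))"
      using R_psd by eventually_elim (rule matrix_form_cnj)
    show "(\<lambda>t. matrix_form (R t) (g t) (f t)) \<in> borel_measurable \<mu>"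
      using form_integrable[OF g f] by simp
    show "(\<lambda>t. cnj (matrix_form (R t) (f t) (g t))) \<in> borel_measurable \<mu>"
      using integrable_cnj[OF form_integrable[OF f g]] by (rule borel_measurable_integrable)
  qed
  then show "inner_matrix \<mu> R g f = cnj (inner_matrix \<mu> R f g)" by (simp add: inner_matrix_def)
  fix h assume h: "h \<in> L2_matrix \<mu> R"
  show "inner_matrix \<mu> R (\<lambda>t. c *s f t + d *s g t) h = c * inner_matrix \<mu> R f h + d * inner_matrix \<mu> R g h"
    unfolding inner_matrix_def matrix_form_comb_left
    using form_integrable[OF f h] form_integrable[OF g h] by (subst Bochner_Integration.integral_add) auto
next
  fix f assume f: "f \<in> L2_matrix \<mu> R"
  have "Re (inner_matrix \<mu> R f f) = (\<integral>t. Re (matrix_form (R t) (f t) (f t)) \<partial>\<mu>)"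
    unfolding inner_matrix_def using integral_Re[OF form_integrable[OF f f]] by simp
  also have "0 \<le> \<dots>" by (rule integral_nonneg_AE) (use R_psd in eventually_elim, simp add: psd_def)
  finally show "0 \<le> Re (inner_matrix \<mu> R f f)" .
qed

lemma nrm_mnorm: "nrm f = mnorm \<mu> R f"
  by (simp add: nrm_def mnorm_def)

lemmas m_cauchy_schwarz = cauchy_schwarz[unfolded nrm_mnorm]
  and m_comb_le = nrm_comb_le[unfolded nrm_mnorm]
  and m_nonneg = nrm_nonneg[unfolded nrm_mnorm]

lemma diff_in: "\<lbrakk>f \<in> L2_matrix \<mu> R; g \<in> L2_matrix \<mu> R\<rbrakk> \<Longrightarrow> (\<lambda>t. f t - g t) \<in> L2_matrix \<mu> R"
  using comb_in[of f g 1 "-1"] by (simp add: vector_sneg_minus1[symmetric])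

lemma inner_diff:
  "\<lbrakk>f \<in> L2_matrix \<mu> R; g \<in> L2_matrix \<mu> R; h \<in> L2_matrix \<mu> R\<rbrakk> \<Longrightarrow>
     inner_matrix \<mu> R (\<lambda>t. f t - g t) h = inner_matrix \<mu> R f h - inner_matrix \<mu> R g h"
  using ip_comb[of f g h 1 "-1"] by (simp add: vector_sneg_minus1[symmetric])

lemma eq_matrix_iff:
  assumes "f \<in> L2_matrix \<mu> R" "g \<in> L2_matrix \<mu> R"
  shows "eq_matrix \<mu> R f g \<longleftrightarrow> mnorm \<mu> R (\<lambda>t. f t - g t) = 0"
proof -
  let ?q = "\<lambda>t. matrix_form (R t) (f t - g t) (f t - g t)"
  have i: "integrable \<mu> ?q" using form_integrable[OF diff_in diff_in] assms by blast
  have "mnorm \<mu> R (\<lambda>t. f t - g t) = 0 \<longleftrightarrow> (\<integral>t. Re (?q t) \<partial>\<mu>) = 0"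
    unfolding mnorm_def inner_matrix_def using integral_Re[OF i] by simp
  also have "\<dots> \<longleftrightarrow> (AE t in \<mu>. Re (?q t) = 0)"
    using i R_psd by (intro integral_nonneg_eq_0_iff_AE) (auto simp: psd_def)
  also have "\<dots> \<longleftrightarrow> (AE t in \<mu>. ?q t = 0)"
  proof
    assume "AE t in \<mu>. Re (?q t) = 0"
    then show "AE t in \<mu>. ?q t = 0" using R_psd
    proof eventually_elim
      case (elim t)
      show ?case using psd_matrix_form_real[OF elim(2), of "f t - g t"] elim(1) by simp
    qed
  next
    assume "AE t in \<mu>. ?q t = 0"
    then show "AE t in \<mu>. Re (?q t) = 0" by eventually_elim simp
  qed
  finally show ?thesis by (simp add: eq_matrix_def)
qed

lemma mnorm_eq_0_inner:
  assumes "f \<in> L2_matrix \<mu> R" "g \<in> L2_matrix \<mu> R" "mnorm \<mu> R f = 0"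
  shows "inner_matrix \<mu> R f g = 0"
  using m_cauchy_schwarz[OF assms(1,2)] assms(3) by simp

lemma inner_cong:
  assumes "f \<in> L2_matrix \<mu> R" "f' \<in> L2_matrix \<mu> R" "eq_matrix \<mu> R f f'" "g \<in> L2_matrix \<mu> R"
  shows "inner_matrix \<mu> R f g = inner_matrix \<mu> R f' g" "inner_matrix \<mu> R g f = inner_matrix \<mu> R g f'"
proof -
  have "inner_matrix \<mu> R (\<lambda>t. f t - f' t) g = 0"
    using assms eq_matrix_iff diff_in by (intro mnorm_eq_0_inner) auto
  then show 1: "inner_matrix \<mu> R f g = inner_matrix \<mu> R f' g" using inner_diff assms by simp
  show "inner_matrix \<mu> R g f = inner_matrix \<mu> R g f'"
    using 1 ip_cnj[OF assms(1,4)] ip_cnj[OF assms(2,4)] by simp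
qed

lemma mnorm_cong:
  assumes "f \<in> L2_matrix \<mu> R" "f' \<in> L2_matrix \<mu> R" "eq_matrix \<mu> R f f'"
  shows "mnorm \<mu> R f = mnorm \<mu> R f'"
  unfolding mnorm_def using inner_cong[OF assms assms(1)] inner_cong[OF assms assms(2)] by simp

lemma mnorm_triangle:
  assumes "f \<in> L2_matrix \<mu> R" "g \<in> L2_matrix \<mu> R" "h \<in> L2_matrix \<mu> R"
  shows "mnorm \<mu> R (\<lambda>t. f t - h t) \<le> mnorm \<mu> R (\<lambda>t. f t - g t) + mnorm \<mu> R (\<lambda>t. g t - h t)"
  using m_comb_le[OF diff_in[OF assms(1,2)] diff_in[OF assms(2,3)], of 1 1] by simp

lemma mnorm_commute: "mnorm \<mu> R (\<lambda>t. f t - g t) = mnorm \<mu> R (\<lambda>t. g t - f t)"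
proof -
  have "matrix_form A (a - b) (a - b) = matrix_form A (b - a) (b - a)" for A a b
    by (simp add: matrix_form_def sum_2 algebra_simps)
  then show ?thesis by (simp add: mnorm_def inner_matrix_def)
qed

lemma eq_matrix_sym: "eq_matrix \<mu> R f g \<Longrightarrow> eq_matrix \<mu> R g f"
proof -
  have "matrix_form A (a - b) (a - b) = matrix_form A (b - a) (b - a)" for A a b
    by (simp add: matrix_form_def sum_2 algebra_simps)
  then show "eq_matrix \<mu> R f g \<Longrightarrow> eq_matrix \<mu> R g f" by (simp add: eq_matrix_def)
qed

lemma eq_matrix_trans:
  assumes "f \<in> L2_matrix \<mu> R" "g \<in> L2_matrix \<mu> R" "h \<in> L2_matrix \<mu> R" "eq_matrix \<mu> R f g" "eq_matrix \<mu> R g h"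
  shows "eq_matrix \<mu> R f h"
  using mnorm_triangle[OF assms(1-3)] m_nonneg[OF diff_in[OF assms(1,3)]] assms eq_matrix_iff by auto

lemma indicator_in:
  assumes "g \<in> L2_matrix \<mu> R" "B \<in> sets borel"
  shows "(\<lambda>t. indicator B t *s g t) \<in> L2_matrix \<mu> R"
proof -
  have "(\<lambda>t. indicator B t *s g t + 0 *s g t) \<in> borel_measurable \<mu>"
    using assms sets_mu by (intro comb_measurable) (auto simp: L2_matrix_def)
  then have m: "(\<lambda>t. indicator B t *s g t) \<in> borel_measurable \<mu>" by simp
  have i: "integrable \<mu> (\<lambda>t. matrix_form (R t) (g t) (g t))" using assms by (simp add: L2_matrix_def)
  have "integrable \<mu> (\<lambda>t. matrix_form (R t) (indicator B t *s g t) (indicator B t *s g t))"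
    by (rule Bochner_Integration.integrable_bound[OF i form_measurable[OF m m]])
      (auto simp: matrix_form_scale matrix_form_scale_right indicator_def)
  then show ?thesis using m by (simp add: L2_matrix_def)
qed

lemma inner_indicator:
  "inner_matrix \<mu> R (\<lambda>t. indicator B t *s f t) g = (\<integral>t. indicator B t * matrix_form (R t) (f t) (g t) \<partial>\<mu>)"
  "inner_matrix \<mu> R f (\<lambda>t. indicator B t *s g t) = (\<integral>t. indicator B t * matrix_form (R t) (f t) (g t) \<partial>\<mu>)"
  unfolding inner_matrix_def by (auto simp: matrix_form_scale matrix_form_scale_right indicator_def intro!: Bochner_Integration.integral_cong)

lemma inner_indicator_both:
  "inner_matrix \<mu> R (\<lambda>t. indicator B t *s f t) (\<lambda>t. indicator B t *s g t) = inner_matrix \<mu> R (\<lambda>t. indicator B t *s f t) g"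
  unfolding inner_matrix_def by (auto simp: matrix_form_scale matrix_form_scale_right indicator_def intro!: Bochner_Integration.integral_cong)

lemma indicator_eq_matrix:
  assumes "eq_matrix \<mu> R f g"
  shows "eq_matrix \<mu> R (\<lambda>t. indicator B t *s f t) (\<lambda>t. indicator B t *s g t)"
  using assms unfolding eq_matrix_def
  by eventually_elim (auto simp: indicator_def matrix_form_def)

text \<open>Dominated convergence with the form of \<open>g\<close> as the bound, since the
  difference is pointwise either 0 or \<open>- g t\<close>.\<close>

lemma truncation_tendsto:
  assumes g: "g \<in> L2_matrix \<mu> R"
  shows "((\<lambda>N. mnorm \<mu> R (\<lambda>t. indicator {-N..<N} t *s g t - g t)) \<longlongrightarrow> 0) at_top"
proof -
  let ?h = "\<lambda>N t. indicator {-N..<N} t *s g t - g t"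
  have hin: "?h N \<in> L2_matrix \<mu> R" for N using g by (intro diff_in indicator_in) auto
  have "((\<lambda>N. \<integral>t. matrix_form (R t) (?h N t) (?h N t) \<partial>\<mu>) \<longlongrightarrow> (\<integral>t. 0 \<partial>\<mu>)) at_top"
  proof (rule integral_dominated_convergence_at_top)
    show "integrable \<mu> (\<lambda>t. norm (matrix_form (R t) (g t) (g t)))" using g by (simp add: L2_matrix_def)
    show "(\<lambda>t. matrix_form (R t) (?h N t) (?h N t)) \<in> borel_measurable \<mu>" for N
      using form_integrable[OF hin hin] by simp
    show "\<forall>\<^sub>F N in at_top. AE t in \<mu>. norm (matrix_form (R t) (?h N t) (?h N t)) \<le> norm (matrix_form (R t) (g t) (g t))"
      by (intro always_eventually allI AE_I2) (auto simp: indicator_def matrix_form_def)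
    show "AE t in \<mu>. ((\<lambda>N. matrix_form (R t) (?h N t) (?h N t)) \<longlongrightarrow> 0) at_top"
    proof (rule AE_I2)
      fix t :: real
      have "\<forall>\<^sub>F N in at_top. N > \<bar>t\<bar>" by (rule eventually_gt_at_top)
      then have "\<forall>\<^sub>F N in at_top. matrix_form (R t) (?h N t) (?h N t) = 0"
        by eventually_elim (auto simp: indicator_def matrix_form_def)
      then show "((\<lambda>N. matrix_form (R t) (?h N t) (?h N t)) \<longlongrightarrow> 0) at_top" by (rule tendsto_eventually)
    qed
  qed simp
  from tendsto_real_sqrt[OF tendsto_Re[OF this]] show ?thesis by (simp add: mnorm_def inner_matrix_def)
qed

end

section \<open>Isometries into the matrix space\<close>

locale matrix_isometry = matrix_L2 \<mu> R for \<mu> :: "real measure" and R +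
  fixes M :: "'a measure" and F :: "('a \<Rightarrow> complex) \<Rightarrow> (real \<Rightarrow> complex^2)"
  assumes iso: "isometric M \<mu> R F"
begin

lemma F_in: "f \<in> L2 M \<Longrightarrow> F f \<in> L2_matrix \<mu> R"
  using iso by (simp add: isometric_def)

lemma F_comb: "\<lbrakk>f \<in> L2 M; g \<in> L2 M\<rbrakk> \<Longrightarrow>
    eq_matrix \<mu> R (F (\<lambda>x. c * f x + d * g x)) (\<lambda>t. c *s F f t + d *s F g t)"
  using iso by (simp add: isometric_def)

lemma F_inner_self: "f \<in> L2 M \<Longrightarrow> inner_matrix \<mu> R (F f) (F f) = L2_inner M f f"
  using iso by (simp add: isometric_def)

lemma F_norm: "f \<in> L2 M \<Longrightarrow> mnorm \<mu> R (F f) = L2_norm M f"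
  using F_inner_self[of f] L2_norm_nonneg[of M f] by (simp add: mnorm_def L2_inner_self)

lemma F_diff: "\<lbrakk>f \<in> L2 M; g \<in> L2 M\<rbrakk> \<Longrightarrow> eq_matrix \<mu> R (F (\<lambda>x. f x - g x)) (\<lambda>t. F f t - F g t)"
  using F_comb[of f g 1 "-1"] by (simp add: vector_sneg_minus1[symmetric])

lemma F_diff_norm:
  assumes "f \<in> L2 M" "g \<in> L2 M"
  shows "mnorm \<mu> R (\<lambda>t. F f t - F g t) = L2_norm M (\<lambda>x. f x - g x)"
  using mnorm_cong[OF F_in[OF L2_diff[OF assms]] diff_in[OF F_in[OF assms(1)] F_in[OF assms(2)]] F_diff[OF assms]]
    F_norm[OF L2_diff[OF assms]] by simp

text \<open>\<open>isometric\<close> records only the values on the diagonal, and \<open>F\<close>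
  respects combinations only up to \<open>eq_matrix\<close>, so the mixed values come from
  polarization.\<close>

lemma F_inner:
  assumes f: "f \<in> L2 M" and g: "g \<in> L2 M"
  shows "inner_matrix \<mu> R (F f) (F g) = L2_inner M f g"
proof -
  define A where "A = inner_matrix \<mu> R (F f) (F g) - L2_inner M f g"
  define B where "B = inner_matrix \<mu> R (F g) (F f) - L2_inner M g f"
  have "cnj c * A + c * B = 0" for c
  proof -
    have h: "(\<lambda>x. 1 * f x + c * g x) \<in> L2 M" using f g by (rule L2_comb)
    have k: "(\<lambda>t. 1 *s F f t + c *s F g t) \<in> L2_matrix \<mu> R" using F_in f g by (intro comb_in)
    have "inner_matrix \<mu> R (\<lambda>t. 1 *s F f t + c *s F g t) (\<lambda>t. 1 *s F f t + c *s F g t)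
      = L2_inner M (\<lambda>x. 1 * f x + c * g x) (\<lambda>x. 1 * f x + c * g x)"
      using inner_cong[OF F_in[OF h] k F_comb[OF f g] k] inner_cong[OF F_in[OF h] k F_comb[OF f g] F_in[OF h]]
        F_inner_self[OF h] by simp
    then show ?thesis
      unfolding ip_comb_self[OF F_in[OF f] F_in[OF g]] L2.ip_comb_self[OF f g]
      using F_inner_self[OF f] F_inner_self[OF g] by (simp add: A_def B_def algebra_simps)
  qed
  then have "A = 0" by (rule polarization_zero)
  then show ?thesis by (simp add: A_def)
qed

end

section \<open>The transform and its truncated inverse\<close>

lemma space_weight: "space (weight_measure L) = dom_int L"
  by (simp add: weighted_def)

lemma sets_weight: "sets (weight_measure L) = sets (lebesgue_on (dom_int L))"
  by (simp add: weighted_def)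

lemma Icc_sets_weight: "{c..d} \<subseteq> dom_int L \<Longrightarrow> {c..d} \<in> sets (weight_measure L)"
  unfolding sets_weight sets_restrict_space by (intro image_eqI[of _ _ "{c..d}"]) auto

lemma borel_measurable_weight_id: "(\<lambda>x. x) \<in> weight_measure L \<rightarrow>\<^sub>M borel"
proof -
  have "(\<lambda>x::real. x) \<in> lebesgue \<rightarrow>\<^sub>M borel" by (rule measurable_completion) simp
  then have "(\<lambda>x. x) \<in> lebesgue_on (dom_int L) \<rightarrow>\<^sub>M borel" by (rule measurable_restrict_space1)
  then show ?thesis by (simp add: weighted_def)
qed

lemma continuous_on_borel_measurable_weight:
  assumes "continuous_on (dom_int L) (f :: real \<Rightarrow> complex)"
  shows "f \<in> borel_measurable (weight_measure L)"
proof -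
  have "f \<in> borel_measurable (lebesgue_on (dom_int L))"
    by (rule continuous_imp_measurable_on_sets_lebesgue[OF assms dom_int_lebesgue])
  then show ?thesis by (simp add: weighted_def)
qed

lemma emeasure_weight_Icc_finite:
  assumes "sl_coefficients L" "{c..d} \<subseteq> dom_int L"
  shows "emeasure (weight_measure L) {c..d} < \<infinity>"
proof -
  let ?r = "coef_r L"
  have rm: "?r \<in> borel_measurable (lebesgue_on (dom_int L))" using assms(1) by (simp add: sl_coefficients_def)
  have "set_integrable lebesgue {c..d} ?r"
    using assms unfolding sl_coefficients_def L1_loc_def by (meson compact_Icc)
  then have i: "(\<integral>\<^sup>+x. ennreal (norm (indicator {c..d} x *\<^sub>R ?r x)) \<partial>lebesgue) < \<infinity>"
    unfolding set_integrable_def integrable_iff_bounded by simp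
  have "emeasure (weight_measure L) {c..d} = (\<integral>\<^sup>+x. ennreal (?r x) * indicator {c..d} x \<partial>lebesgue_on (dom_int L))"
    unfolding weighted_def using rm Icc_sets_weight[OF assms(2)]
    by (intro emeasure_density) (auto simp: sets_weight)
  also have "\<dots> = (\<integral>\<^sup>+x. ennreal (?r x) * indicator {c..d} x * indicator (dom_int L) x \<partial>lebesgue)"
    by (rule nn_integral_restrict_space) (use dom_int_lebesgue in auto)
  also have "\<dots> \<le> (\<integral>\<^sup>+x. ennreal (norm (indicator {c..d} x *\<^sub>R ?r x)) \<partial>lebesgue)"
    by (intro nn_integral_mono) (auto simp: indicator_def intro: ennreal_leI)
  finally show ?thesis using i by (rule order_le_less_trans)
qed

text \<open>Since \<open>r\<close> is positive almost everywhere, null sets of the weighted measure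
  are Lebesgue null, and a nondegenerate interval contains a nonempty open set.\<close>

lemma emeasure_weight_Icc_pos:
  assumes "sl_coefficients L" "{c..d} \<subseteq> dom_int L" "c < d"
  shows "emeasure (weight_measure L) {c..d} > 0"
proof (rule ccontr)
  let ?r = "coef_r L"
  assume "\<not> ?thesis"
  then have 0: "emeasure (weight_measure L) {c..d} = 0" by (simp add: zero_less_iff_neq_zero)
  have rm: "?r \<in> borel_measurable (lebesgue_on (dom_int L))" using assms(1) by (simp add: sl_coefficients_def)
  have "AE x in weight_measure L. x \<notin> {c..d}"
    using 0 Icc_sets_weight[OF assms(2)] by (intro AE_not_in) (simp add: null_sets_def)
  then have "AE x in lebesgue_on (dom_int L). 0 < ennreal (?r x) \<longrightarrow> x \<notin> {c..d}"
    unfolding weighted_def by (subst (asm) AE_density) (use rm in auto)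
  moreover have "AE x in lebesgue_on (dom_int L). ?r x > 0"
    using assms(1) by (simp add: sl_coefficients_def)
  ultimately have "AE x in lebesgue_on (dom_int L). x \<notin> {c..d}" by eventually_elim auto
  then have "negligible {x\<in>dom_int L. \<not> x \<notin> {c..d}}" by (simp add: AE_lebesgue_on_iff_negligible[OF dom_int_lebesgue])
  then have "negligible {c..d}" by (rule negligible_subset) (use assms(2) in auto)
  then have "negligible {c<..<d}" by (rule negligible_subset) auto
  moreover have "{c<..<d} \<noteq> {}" using assms(3) by simp
  ultimately show False using open_not_negligible[of "{c<..<d}"] by simp
qed

text \<open>Eventual membership, and not merely a covering, is what the arguments by dominated
  convergence and Fatou's lemma use.\<close>

lemma dom_int_exhaustion:
  assumes "sl_coefficients L"
  obtains c d :: "nat \<Rightarrow> real" where "\<And>n. {c n..d n} \<subseteq> dom_int L"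
    "\<And>x. x \<in> dom_int L \<Longrightarrow> \<forall>\<^sub>F n in sequentially. x \<in> {c n..d n}"
proof -
  have "lft L < rgt L" using assms by (simp add: sl_coefficients_def)
  then obtain u l :: "nat \<Rightarrow> real" where ul: "dom_int L = (\<Union>i. {l i .. u i})" "incseq u" "decseq l"
    unfolding dom_int_def by (rule einterval_Icc_approximation) blast
  have "\<forall>\<^sub>F n in sequentially. x \<in> {l n..u n}" if x: "x \<in> dom_int L" for x
  proof -
    obtain i where i: "x \<in> {l i..u i}" using x ul(1) by blast
    have "x \<in> {l n..u n}" if "n \<ge> i" for n
      using i incseqD[OF ul(2) that] decseqD[OF ul(3) that] by simp
    then show ?thesis unfolding eventually_sequentially by blast
  qed
  then show ?thesis using that[of l u] ul(1) by blast
qed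

lemma sigma_finite_weight:
  assumes "sl_coefficients L" shows "sigma_finite_measure (weight_measure L)"
proof -
  obtain c d :: "nat \<Rightarrow> real" where cd: "\<And>n. {c n..d n} \<subseteq> dom_int L"
    "\<And>x. x \<in> dom_int L \<Longrightarrow> \<forall>\<^sub>F n in sequentially. x \<in> {c n..d n}"
    using dom_int_exhaustion[OF assms] by blast
  have cover: "(\<Union>n. {c n..d n}) = dom_int L"
    using cd(1) eventually_happens[OF cd(2)] by fastforce
  show ?thesis
  proof
    show "\<exists>A. countable A \<and> A \<subseteq> sets (weight_measure L) \<and> \<Union> A = space (weight_measure L) \<and>
       (\<forall>a\<in>A. emeasure (weight_measure L) a \<noteq> \<infinity>)"
    proof (intro exI[of _ "range (\<lambda>n. {c n..d n})"] conjI)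
      show "range (\<lambda>n. {c n..d n}) \<subseteq> sets (weight_measure L)" using Icc_sets_weight[OF cd(1)] by blast
      show "\<Union> (range (\<lambda>n. {c n..d n})) = space (weight_measure L)" using cover by (simp add: space_weight)
      show "\<forall>a\<in>range (\<lambda>n. {c n..d n}). emeasure (weight_measure L) a \<noteq> \<infinity>"
        using emeasure_weight_Icc_finite[OF assms cd(1)] by (auto simp: less_top)
    qed auto
  qed
qed

text \<open>The half-open intervals form an intersection-stable generator, and the sets with
  vanishing integral are closed under complements and countable disjoint unions. Once all Borel
  integrals are zero, real and imaginary parts are both nonnegative and nonpositive almost
  everywhere.\<close>

lemma AE_zero_if_Ioc_integrals_zero:
  fixes k :: "real \<Rightarrow> complex"
  assumes sets: "sets \<mu> = sets borel" and k: "integrable \<mu> k"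
    and zero: "\<And>a b. a < b \<Longrightarrow> (\<integral>t. indicator {a<..b} t * k t \<partial>\<mu>) = 0"
  shows "AE t in \<mu>. k t = 0"
proof -
  have sp: "space \<mu> = UNIV" using sets_eq_imp_space_eq[OF sets] by simp
  have ki: "integrable \<mu> (\<lambda>t. indicator B t * k t)" if "B \<in> sets borel" for B
  proof -
    have eq: "(\<lambda>t. indicator B t * k t) = (\<lambda>t. indicator B t *\<^sub>R k t)" by (auto simp: indicator_def)
    show ?thesis unfolding eq using that sets by (intro integrable_mult_indicator k) simp
  qed
  define I where "I B = (\<integral>t. indicator B t * k t \<partial>\<mu>)" for B
  \<comment> \<open>Complements in the induction require the integral over the whole line, reached
    as a limit of intervals.\<close>
  have tot: "I UNIV = 0"
  proof -
    have "(\<lambda>n. I {- real n<..real n}) \<longlonglongrightarrow> (\<integral>t. k t \<partial>\<mu>)"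
      unfolding I_def
    proof (rule integral_dominated_convergence)
      show "integrable \<mu> (\<lambda>t. norm (k t))" using k by simp
      show "(\<lambda>t. indicator {- real n<..real n} t * k t) \<in> borel_measurable \<mu>" for n
        using ki[of "{- real n<..real n}"] by simp
      show "AE t in \<mu>. norm (indicator {- real n<..real n} t * k t) \<le> norm (k t)" for n
        by (auto simp: indicator_def)
      show "AE t in \<mu>. (\<lambda>n. indicator {- real n<..real n} t * k t) \<longlonglongrightarrow> k t"
      proof (rule AE_I2)
        fix t :: real
        obtain n0 :: nat where n0: "\<bar>t\<bar> < real n0" using reals_Archimedean2 by blast
        have "\<forall>\<^sub>F n in sequentially. indicator {- real n<..real n} t * k t = k t"
          using eventually_ge_at_top[of n0] by eventually_elim (use n0 in \<open>auto simp: indicator_def\<close>)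
        then show "(\<lambda>n. indicator {- real n<..real n} t * k t) \<longlonglongrightarrow> k t" by (rule tendsto_eventually)
      qed
    qed (use k in auto)
    moreover have "I {- real n<..real n} = 0" for n
    proof (cases n)
      case 0 then show ?thesis by (simp add: I_def)
    next
      case (Suc m) then show ?thesis unfolding I_def by (intro zero) simp
    qed
    ultimately show ?thesis by (simp add: I_def LIMSEQ_const_iff)
  qed
  have all: "I B = 0" if "B \<in> sets borel" for B
  proof -
    let ?G = "range (\<lambda>(a, b). {a <.. b::real})"
    show ?thesis
    proof (rule sigma_sets_induct_disjoint[where G="?G" and \<Omega>=UNIV and P="\<lambda>B. I B = 0"])
      show "B \<in> sigma_sets UNIV ?G" using that by (simp add: borel_sigma_sets_Ioc)
      show "Int_stable ?G" by (auto simp: Int_stable_def)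
      show "?G \<subseteq> Pow UNIV" by auto
    next
      fix A assume "A \<in> ?G"
      then obtain a b where A: "A = {a<..b}" by auto
      show "I A = 0"
      proof (cases "a < b")
        case True then show ?thesis unfolding I_def A by (rule zero)
      qed (simp add: I_def A)
    next
      show "I {} = 0" by (simp add: I_def)
    next
      fix A assume A: "A \<in> sigma_sets UNIV ?G" "I A = 0"
      then have Ab: "A \<in> sets borel" by (simp add: borel_sigma_sets_Ioc)
      have "I (UNIV - A) = (\<integral>t. indicator UNIV t * k t - indicator A t * k t \<partial>\<mu>)"
        unfolding I_def by (intro Bochner_Integration.integral_cong) (auto simp: indicator_def)
      also have "\<dots> = I UNIV - I A" unfolding I_def
        by (rule Bochner_Integration.integral_diff) (use ki[of UNIV] ki[OF Ab] in auto)
      finally show "I (UNIV - A) = 0" using tot A by simp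
    next
      fix A :: "nat \<Rightarrow> real set" assume A: "disjoint_family A" "range A \<subseteq> sigma_sets UNIV ?G" "\<And>i. I (A i) = 0"
      then have Ab: "A i \<in> sets \<mu>" for i using sets by (auto simp: borel_sigma_sets_Ioc)
      have UA: "(\<Union>i. A i) \<in> sets \<mu>" using Ab by auto
      have IS: "I B = (LINT t:B|\<mu>. k t)" for B
        unfolding I_def set_lebesgue_integral_def
        by (intro Bochner_Integration.integral_cong) (auto simp: indicator_def)
      have "I (\<Union>i. A i) = (\<Sum>i. I (A i))" unfolding IS
      proof (rule lebesgue_integral_countable_add[OF Ab])
        show "A i \<inter> A j = {}" if "i \<noteq> j" for i j using A(1) that by (auto simp: disjoint_family_on_def)
        show "set_integrable \<mu> (\<Union>i. A i) k" unfolding set_integrable_def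
          using integrable_mult_indicator[OF UA k] by simp
      qed
      then show "I (\<Union>i. A i) = 0" using A by simp
    qed
  qed
  have part: "AE t in \<mu>. 0 \<le> h (k t)" if h: "bounded_linear h" for h :: "complex \<Rightarrow> real"
  proof (rule AE_nonneg_if_integrals_nonneg[OF sets])
    have hk: "integrable \<mu> (\<lambda>t. h (k t))" by (rule integrable_bounded_linear[OF h k])
    show "(\<lambda>t. h (k t)) \<in> borel_measurable \<mu>" using hk by simp
    fix B :: "real set" assume B: "B \<in> sets borel"
    show "set_integrable \<mu> B (\<lambda>t. h (k t))"
      unfolding set_integrable_def using B sets by (intro integrable_mult_indicator hk) auto
    have eq: "(\<lambda>t. indicator B t *\<^sub>R h (k t)) = (\<lambda>t. h (indicator B t * k t))"
      using linear_0[OF bounded_linear.linear[OF h]] by (auto simp: indicator_def)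
    have "(LINT t:B|\<mu>. h (k t)) = h (I B)"
      unfolding set_lebesgue_integral_def eq I_def by (rule integral_bounded_linear[OF h ki[OF B]])
    then show "0 \<le> (LINT t:B|\<mu>. h (k t))" using all[OF B] linear_0[OF bounded_linear.linear[OF h]] by simp
  qed
  show ?thesis
    using part[OF bounded_linear_Re] part[OF bounded_linear_Im]
      part[OF bounded_linear_minus[OF bounded_linear_Re]] part[OF bounded_linear_minus[OF bounded_linear_Im]]
    by eventually_elim (simp add: complex_eq_iff)
qed

text \<open>From here on the differential equation enters only through joint continuity of the
  solutions, their reality for real parameter and their independence; the spectral measure enters
  through \<open>pvm\<close> and \<open>E_transform\<close>.\<close>

locale sl_transform = matrix_isometry \<mu> R "weight_measure L" F
  for L :: sturm_liouville and \<mu> :: "real measure" and R and F +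
  fixes \<theta> \<phi> :: "complex \<Rightarrow> real \<Rightarrow> complex"
    and E :: "real set \<Rightarrow> (real \<Rightarrow> complex) \<Rightarrow> (real \<Rightarrow> complex)"
  assumes coef: "sl_coefficients L"
    and cont_\<theta>: "continuous_on (dom_int L \<times> UNIV) (\<lambda>(x,t::real). \<theta> (of_real t) x)"
    and cont_\<phi>: "continuous_on (dom_int L \<times> UNIV) (\<lambda>(x,t::real). \<phi> (of_real t) x)"
    and real_\<theta>: "\<And>x t. x \<in> dom_int L \<Longrightarrow> cnj (\<theta> (of_real t) x) = \<theta> (of_real t) x"
    and real_\<phi>: "\<And>x t. x \<in> dom_int L \<Longrightarrow> cnj (\<phi> (of_real t) x) = \<phi> (of_real t) x"
    and indep: "\<And>t a b. (\<And>x. x \<in> dom_int L \<Longrightarrow> a * \<theta> (of_real t) x + b * \<phi> (of_real t) x = 0) \<Longrightarrow> a = 0 \<and> b = 0"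
    and R_int: "\<And>B. B \<in> sets borel \<Longrightarrow> bounded B \<Longrightarrow> set_integrable \<mu> B R"
    and mu_fin: "\<And>B. B \<in> sets borel \<Longrightarrow> bounded B \<Longrightarrow> emeasure \<mu> B < \<infinity>"
    and pvm: "projection_valued_measure (weight_measure L) E"
    and E_transform: "\<And>f g t1 t2. \<lbrakk>f \<in> L2 (weight_measure L); compactly_supported L f;
           g \<in> L2 (weight_measure L); compactly_supported L g; t1 < t2\<rbrakk> \<Longrightarrow>
           L2_inner (weight_measure L) (E {t1<..t2} f) g =
           inner_matrix \<mu> R (\<lambda>t. indicator {t1<..t2} t *s transform L \<theta> \<phi> f t)
             (transform L \<theta> \<phi> g)"
    and F_transform: "\<And>f. f \<in> L2 (weight_measure L) \<Longrightarrow> compactly_supported L f \<Longrightarrow>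
        transform L \<theta> \<phi> f \<in> L2_matrix \<mu> R \<and> eq_matrix \<mu> R (F f) (transform L \<theta> \<phi> f)"
begin

abbreviation "M \<equiv> weight_measure L"
abbreviation "I \<equiv> dom_int L"

sublocale M: sigma_finite_measure M
  by (rule sigma_finite_weight[OF coef])

lemma sigma_finite_mu: "sigma_finite_measure \<mu>"
proof
  show "\<exists>A. countable A \<and> A \<subseteq> sets \<mu> \<and> \<Union> A = space \<mu> \<and> (\<forall>a\<in>A. emeasure \<mu> a \<noteq> \<infinity>)"
  proof (intro exI[of _ "range (\<lambda>n::nat. {- real n..real n})"] conjI)
    show "range (\<lambda>n::nat. {- real n..real n}) \<subseteq> sets \<mu>" unfolding sets_mu by auto
    have "\<exists>n::nat. - real n \<le> t \<and> t \<le> real n" for t :: real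
    proof -
      obtain n :: nat where "\<bar>t\<bar> \<le> real n" using real_arch_simple by blast
      then show ?thesis by (intro exI[of _ n]) (auto simp: abs_le_iff)
    qed
    then show "\<Union> (range (\<lambda>n::nat. {- real n..real n})) = space \<mu>" by (auto simp: space_mu)
    show "\<forall>a\<in>range (\<lambda>n::nat. {- real n..real n}). emeasure \<mu> a \<noteq> \<infinity>"
      using mu_fin by (auto simp: less_top)
  qed auto
qed

sublocale \<mu>: sigma_finite_measure \<mu>
  by (rule sigma_finite_mu)

sublocale pair_sigma_finite M \<mu> ..

lemma compactly_supported_indicator:
  "{c..d} \<subseteq> I \<Longrightarrow> compactly_supported L (\<lambda>x. indicator {c..d} x * f x)"
  unfolding compactly_supported_def by (intro exI[of _ "{c..d}"]) auto

lemma compact_approximation: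
  assumes f: "f \<in> L2 M"
  obtains h where "\<And>n. h n \<in> L2 M" "(\<lambda>n. L2_norm M (\<lambda>x. h n x - f x)) \<longlonglongrightarrow> 0"
    "\<And>n::nat. \<exists>c d. {c..d} \<subseteq> I \<and> h n = (\<lambda>x. indicator {c..d} x * f x)"
proof -
  obtain c d :: "nat \<Rightarrow> real" where cd: "\<And>n. {c n..d n} \<subseteq> I"
    "\<And>x. x \<in> I \<Longrightarrow> \<forall>\<^sub>F n in sequentially. x \<in> {c n..d n}"
    using dom_int_exhaustion[OF coef] by blast
  show ?thesis
  proof (rule that[of "\<lambda>n x. indicator {c n..d n} x * f x"])
    show "(\<lambda>x. indicator {c n..d n} x * f x) \<in> L2 M" for n
      by (rule L2_indicator_mult[OF f Icc_sets_weight[OF cd(1)]])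
    show "(\<lambda>n. L2_norm M (\<lambda>x. indicator {c n..d n} x * f x - f x)) \<longlonglongrightarrow> 0"
      by (rule L2_indicator_tendsto[OF f Icc_sets_weight[OF cd(1)]]) (rule cd(2), simp only: space_weight)
  qed (use cd in blast)
qed

text \<open>Fubini requires measurability for the product of \<open>M\<close> and
  \<open>\<mu>\<close>. The identity into the Borel plane is measurable, and a function continuous
  on \<open>I \<times> UNIV\<close> is Borel there.\<close>

lemma kernel_measurable:
  assumes "continuous_on (I \<times> UNIV) (\<lambda>(x,t::real). w (of_real t) x :: complex)"
  shows "(\<lambda>(x,t). w (of_real t) x) \<in> borel_measurable (M \<Otimes>\<^sub>M \<mu>)"
proof -
  have "(\<lambda>p. (fst p, snd p)) \<in> M \<Otimes>\<^sub>M \<mu> \<rightarrow>\<^sub>M borel \<Otimes>\<^sub>M borel"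
  proof (rule measurable_Pair)
    show "fst \<in> M \<Otimes>\<^sub>M \<mu> \<rightarrow>\<^sub>M borel"
      by (rule measurable_compose[OF measurable_fst borel_measurable_weight_id])
    have "(\<lambda>x. x) \<in> \<mu> \<rightarrow>\<^sub>M borel" using sets_mu by (simp add: measurable_ident_sets)
    then show "snd \<in> M \<Otimes>\<^sub>M \<mu> \<rightarrow>\<^sub>M borel" by (rule measurable_compose[OF measurable_snd])
  qed
  then have "(\<lambda>p. p) \<in> M \<Otimes>\<^sub>M \<mu> \<rightarrow>\<^sub>M borel" by (simp add: borel_prod)
  then have "(\<lambda>p. p) \<in> M \<Otimes>\<^sub>M \<mu> \<rightarrow>\<^sub>M restrict_space borel (I \<times> UNIV)"
    by (rule measurable_restrict_space2[rotated]) (auto simp: space_pair_measure space_weight)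
  from measurable_compose[OF this borel_measurable_continuous_on_restrict[OF assms]]
  show ?thesis .
qed

lemma kernel_bounded:
  assumes "continuous_on (I \<times> UNIV) (\<lambda>(x,t::real). w (of_real t) x :: complex)" "{c..d} \<subseteq> I"
  obtains C where "C \<ge> 0" "\<And>x t. \<lbrakk>x \<in> {c..d}; t \<in> {-N..<N}\<rbrakk> \<Longrightarrow> cmod (w (of_real t) x) \<le> C"
proof -
  have "continuous_on ({c..d} \<times> {-N..N}) (\<lambda>(x,t::real). w (of_real t) x)"
    by (rule continuous_on_subset[OF assms(1)]) (use assms(2) in auto)
  from compact_continuous_image[OF this] have "bounded ((\<lambda>(x,t::real). w (of_real t) x) ` ({c..d} \<times> {-N..N}))"
    by (intro compact_imp_bounded) (auto intro: compact_Times)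
  then obtain C where C: "\<And>p. p \<in> {c..d} \<times> {-N..N} \<Longrightarrow> cmod (case p of (x,t) \<Rightarrow> w (of_real t) x) \<le> C"
    unfolding bounded_iff by blast
  show ?thesis
  proof (rule that[of "max C 0"])
    fix x t assume "x \<in> {c..d}" "t \<in> {-N..<N}"
    then show "cmod (w (of_real t) x) \<le> max C 0" using C[of "(x,t)"] by auto
  qed simp
qed

lemma kernel_section_continuous:
  assumes "continuous_on (I \<times> UNIV) (\<lambda>(x,t::real). w (of_real t) x :: complex)"
  shows "t \<in> UNIV \<Longrightarrow> continuous_on I (w (of_real t))"
    "x \<in> I \<Longrightarrow> continuous_on UNIV (\<lambda>t::real. w (of_real t) x)"
proof -
  have "continuous_on I (\<lambda>x. (x, t))" "(\<lambda>x. (x,t)) ` I \<subseteq> I \<times> UNIV" by (auto intro!: continuous_intros)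
  from continuous_on_compose2[OF assms this] show "continuous_on I (w (of_real t))" by simp
  assume "x \<in> I"
  then have "continuous_on UNIV (\<lambda>t::real. (x, t))" "(\<lambda>t::real. (x,t)) ` UNIV \<subseteq> I \<times> UNIV" by (auto intro!: continuous_intros)
  from continuous_on_compose2[OF assms this] show "continuous_on UNIV (\<lambda>t::real. w (of_real t) x)" by simp
qed

lemma indicator_Icc_integrable:
  assumes "{c..d} \<subseteq> I" shows "integrable M (indicator {c..d} :: real \<Rightarrow> real)"
  using emeasure_weight_Icc_finite[OF coef assms] Icc_sets_weight[OF assms]
  by (intro integrable_real_indicator) auto

lemma indicator_Icc_L2:
  assumes "{c..d} \<subseteq> I" shows "indicator {c..d} \<in> L2 M"
proof -
  have "(\<lambda>x. (cmod (indicator {c..d} x))\<^sup>2) = (indicator {c..d} :: real \<Rightarrow> real)" by (auto simp: indicator_def)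
  then show ?thesis using indicator_Icc_integrable[OF assms] Icc_sets_weight[OF assms] by (simp add: L2_def)
qed

lemma kernel_mult_integrable:
  assumes w: "continuous_on (I \<times> UNIV) (\<lambda>(x,t::real). w (of_real t) x :: complex)" and sub: "{c..d} \<subseteq> I"
    and h: "integrable M h" and supp: "\<And>x. x \<notin> {c..d} \<Longrightarrow> h x = 0"
  shows "integrable M (\<lambda>x. w (of_real t) x * h x)"
proof -
  obtain C where C: "C \<ge> 0" "\<And>x s. \<lbrakk>x \<in> {c..d}; s \<in> {-(\<bar>t\<bar>+1)..<\<bar>t\<bar>+1}\<rbrakk> \<Longrightarrow> cmod (w (of_real s) x) \<le> C"
    using kernel_bounded[OF w sub] by blast
  show ?thesis
  proof (rule Bochner_Integration.integrable_bound)
    show "integrable M (\<lambda>x. C * norm (h x))" using h by simp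
    show "(\<lambda>x. w (of_real t) x * h x) \<in> borel_measurable M"
      using continuous_on_borel_measurable_weight[OF kernel_section_continuous(1)[OF w UNIV_I]] h
      by (intro borel_measurable_times) auto
    have "cmod (w (of_real t) x) * cmod (h x) \<le> C * cmod (h x)" for x
    proof (cases "x \<in> {c..d}")
      case True
      have "t \<in> {-(\<bar>t\<bar>+1)..<\<bar>t\<bar>+1}" by (auto simp: abs_if)
      from C(2)[OF True this] show ?thesis by (intro mult_right_mono) auto
    qed (simp add: supp)
    then show "AE x in M. norm (w (of_real t) x * h x) \<le> norm (C * norm (h x))"
      using C(1) by (intro AE_I2) (simp add: norm_mult)
  qed
qed

section \<open>The truncated inversion integral\<close>

text \<open>Entry \<open>j\<close> of the row vector \<open>g R\<close>. It is both the coefficient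
  of a fundamental solution in \<open>inversion_integrand\<close> and the coefficient of
  \<open>cnj (w $ j)\<close> in the form of \<open>g\<close> against \<open>w\<close>.\<close>

definition form_row :: "(real \<Rightarrow> complex^2) \<Rightarrow> 2 \<Rightarrow> real \<Rightarrow> complex" where
  "form_row g j t = (\<Sum>i\<in>UNIV. g t $ i * R t $ i $ j)"

lemma inversion_integrand_form_row:
  "inversion_integrand \<theta> \<phi> R g x t = form_row g 1 t * \<theta> (of_real t) x + form_row g 2 t * \<phi> (of_real t) x"
  by (simp add: inversion_integrand_def form_row_def)

lemma matrix_form_form_row: "matrix_form (R t) (g t) w = form_row g 1 t * cnj (w $ 1) + form_row g 2 t * cnj (w $ 2)"
  by (simp add: matrix_form_def form_row_def sum_2 algebra_simps)

lemma form_row_measurable: "g \<in> L2_matrix \<mu> R \<Longrightarrow> form_row g j \<in> borel_measurable \<mu>"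
proof -
  assume "g \<in> L2_matrix \<mu> R"
  then have [measurable]: "(\<lambda>t. g t $ i) \<in> borel_measurable \<mu>" for i
    by (auto simp: L2_matrix_def intro: vec_nth_measurable)
  have [measurable]: "(\<lambda>t. R t $ i $ j) \<in> borel_measurable \<mu>" for i j
    by (rule mat_nth_measurable[OF R_meas])
  show ?thesis unfolding form_row_def by measurable
qed

text \<open>Entry \<open>j\<close> of \<open>g R\<close> is the form of \<open>g\<close> against a
  basis vector, so it is bounded by the form of \<open>g\<close> plus the diagonal entry
  \<open>R t $ j $ j\<close>. The latter is known to be integrable only over bounded sets, whence
  the cut-off.\<close>

lemma form_row_integrable:
  assumes g: "g \<in> L2_matrix \<mu> R"
  shows "integrable \<mu> (\<lambda>t. indicator {-N..<N} t *\<^sub>R form_row g j t)"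
proof (rule Bochner_Integration.integrable_bound)
  have bl: "bounded_linear (\<lambda>A::complex^2^2. Re (A $ j $ j))"
  proof -
    have "linear (\<lambda>A::complex^2^2. Re (A $ j $ j))" by (rule linearI) auto
    then show ?thesis by (simp add: linear_conv_bounded_linear)
  qed
  have "integrable \<mu> (\<lambda>t. indicator {-N..<N} t *\<^sub>R R t)"
    using R_int[of "{-N..<N}"] by (simp add: set_integrable_def)
  from integrable_bounded_linear[OF bl this]
  have "integrable \<mu> (\<lambda>t. indicator {-N..<N} t * Re (R t $ j $ j))" by simp
  moreover have "integrable \<mu> (\<lambda>t. Re (matrix_form (R t) (g t) (g t)))"
    using g by (simp add: L2_matrix_def)
  ultimately show "integrable \<mu> (\<lambda>t. Re (matrix_form (R t) (g t) (g t)) + indicator {-N..<N} t * Re (R t $ j $ j))"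
    by (rule Bochner_Integration.integrable_add[rotated])
  show "(\<lambda>t. indicator {-N..<N} t *\<^sub>R form_row g j t) \<in> borel_measurable \<mu>"
    using form_row_measurable[OF g] sets_mu by (intro borel_measurable_scaleR borel_measurable_indicator) auto
  show "AE t in \<mu>. norm (indicator {-N..<N} t *\<^sub>R form_row g j t)
    \<le> norm (Re (matrix_form (R t) (g t) (g t)) + indicator {-N..<N} t * Re (R t $ j $ j))"
    using R_psd
  proof eventually_elim
    case (elim t)
    have "form_row g j t = matrix_form (R t) (g t) (axis j 1)"
      unfolding matrix_form_form_row using exhaust_2[of j] by (auto simp: axis_def)
    moreover have "matrix_form (R t) (axis j 1) (axis j 1) = R t $ j $ j"
      unfolding matrix_form_def sum_2 using exhaust_2[of j] by (auto simp: axis_def)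
    ultimately have "cmod (form_row g j t) \<le> Re (matrix_form (R t) (g t) (g t)) + Re (R t $ j $ j)"
      using psd_form_bound[OF elim, of "g t" "axis j 1"] by simp
    moreover have "0 \<le> Re (matrix_form (R t) (g t) (g t))" using elim by (simp add: psd_def)
    ultimately show ?case by (auto simp: indicator_def)
  qed
qed

lemma inversion_integrand_measurable:
  assumes g: "g \<in> L2_matrix \<mu> R"
  shows "(\<lambda>(x,t). indicator {-N..<N} t *\<^sub>R inversion_integrand \<theta> \<phi> R g x t) \<in> borel_measurable (M \<Otimes>\<^sub>M \<mu>)"
proof -
  have [measurable]: "(\<lambda>p. form_row g j (snd p)) \<in> borel_measurable (M \<Otimes>\<^sub>M \<mu>)" for j
    by (rule measurable_compose[OF measurable_snd form_row_measurable[OF g]])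
  have [measurable]: "(\<lambda>p. \<theta> (of_real (snd p)) (fst p)) \<in> borel_measurable (M \<Otimes>\<^sub>M \<mu>)"
    "(\<lambda>p. \<phi> (of_real (snd p)) (fst p)) \<in> borel_measurable (M \<Otimes>\<^sub>M \<mu>)"
    using kernel_measurable[OF cont_\<theta>] kernel_measurable[OF cont_\<phi>] by (simp_all add: split_def)
  have "(indicator {-N..<N} :: real \<Rightarrow> real) \<in> borel_measurable \<mu>" using sets_mu by (intro borel_measurable_indicator) auto
  then have [measurable]: "(\<lambda>p. indicator {-N..<N} (snd p) :: real) \<in> borel_measurable (M \<Otimes>\<^sub>M \<mu>)"
    by (rule measurable_compose[OF measurable_snd])
  show ?thesis unfolding inversion_integrand_form_row split_def by measurable
qed

lemma inversion_integrand_bound: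
  assumes "{c..d} \<subseteq> I"
  obtains C where "C \<ge> 0" "\<And>x t. x \<in> {c..d} \<Longrightarrow> norm (indicator {-N..<N} t *\<^sub>R inversion_integrand \<theta> \<phi> R g x t) \<le>
      C * (norm (indicator {-N..<N} t *\<^sub>R form_row g 1 t) + norm (indicator {-N..<N} t *\<^sub>R form_row g 2 t))"
proof -
  obtain C1 where C1: "C1 \<ge> 0" "\<And>x t. \<lbrakk>x \<in> {c..d}; t \<in> {-N..<N}\<rbrakk> \<Longrightarrow> cmod (\<theta> (of_real t) x) \<le> C1"
    using kernel_bounded[OF cont_\<theta> assms] by blast
  obtain C2 where C2: "C2 \<ge> 0" "\<And>x t. \<lbrakk>x \<in> {c..d}; t \<in> {-N..<N}\<rbrakk> \<Longrightarrow> cmod (\<phi> (of_real t) x) \<le> C2"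
    using kernel_bounded[OF cont_\<phi> assms] by blast
  show ?thesis
  proof (rule that[of "C1 + C2"])
    show "C1 + C2 \<ge> 0" using C1 C2 by simp
    fix x t assume x: "x \<in> {c..d}"
    show "norm (indicator {-N..<N} t *\<^sub>R inversion_integrand \<theta> \<phi> R g x t) \<le>
      (C1 + C2) * (norm (indicator {-N..<N} t *\<^sub>R form_row g 1 t) + norm (indicator {-N..<N} t *\<^sub>R form_row g 2 t))"
    proof (cases "t \<in> {-N..<N}")
      case True
      have "cmod (inversion_integrand \<theta> \<phi> R g x t) \<le> cmod (form_row g 1 t) * cmod (\<theta> (of_real t) x) + cmod (form_row g 2 t) * cmod (\<phi> (of_real t) x)"
        unfolding inversion_integrand_form_row norm_mult[symmetric] by (rule norm_triangle_ineq)
      also have "\<dots> \<le> cmod (form_row g 1 t) * (C1 + C2) + cmod (form_row g 2 t) * (C1 + C2)"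
        using C1(1) C2(1) C1(2)[OF x True] C2(2)[OF x True] by (intro add_mono mult_left_mono) auto
      finally show ?thesis using True by (simp add: algebra_simps)
    qed simp
  qed
qed

lemma inversion_integrand_integrable:
  assumes g: "g \<in> L2_matrix \<mu> R" and x: "x \<in> I"
  shows "set_integrable \<mu> {-N..<N} (inversion_integrand \<theta> \<phi> R g x)"
proof -
  have sub: "{x..x} \<subseteq> I" using x by simp
  obtain C where C: "C \<ge> 0" "\<And>y t. y \<in> {x..x} \<Longrightarrow> norm (indicator {-N..<N} t *\<^sub>R inversion_integrand \<theta> \<phi> R g y t) \<le>
      C * (norm (indicator {-N..<N} t *\<^sub>R form_row g 1 t) + norm (indicator {-N..<N} t *\<^sub>R form_row g 2 t))"
    using inversion_integrand_bound[OF sub] by blast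
  show ?thesis unfolding set_integrable_def
  proof (rule Bochner_Integration.integrable_bound)
    show "integrable \<mu> (\<lambda>t. C * (norm (indicator {-N..<N} t *\<^sub>R form_row g 1 t) + norm (indicator {-N..<N} t *\<^sub>R form_row g 2 t)))"
      by (intro integrable_mult_right Bochner_Integration.integrable_add integrable_norm form_row_integrable[OF g])
    show "AE t in \<mu>. norm (indicator {-N..<N} t *\<^sub>R inversion_integrand \<theta> \<phi> R g x t)
      \<le> norm (C * (norm (indicator {-N..<N} t *\<^sub>R form_row g 1 t) + norm (indicator {-N..<N} t *\<^sub>R form_row g 2 t)))"
      using C(2)[of x] C(1) by (intro AE_I2) (simp add: abs_of_nonneg)
    have "x \<in> space M" using x by (simp add: space_weight)
    from measurable_compose[OF measurable_Pair1'[OF this] inversion_integrand_measurable[OF g]]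
    show "(\<lambda>t. indicator {-N..<N} t *\<^sub>R inversion_integrand \<theta> \<phi> R g x t) \<in> borel_measurable \<mu>" by simp
  qed
qed

definition truncated_inverse :: "real \<Rightarrow> (real \<Rightarrow> complex^2) \<Rightarrow> real \<Rightarrow> complex" where
  "truncated_inverse N g x = (LINT t:{-N..<N}|\<mu>. inversion_integrand \<theta> \<phi> R g x t)"

lemma truncated_inverse_measurable: "g \<in> L2_matrix \<mu> R \<Longrightarrow> truncated_inverse N g \<in> borel_measurable M"
  unfolding truncated_inverse_def[abs_def] set_lebesgue_integral_def
  using inversion_integrand_measurable by (rule \<mu>.borel_measurable_lebesgue_integral)

text \<open>The support has finite measure, and |h| is at most 1 + |h|^2 on it.\<close>

lemma L2_integrable_Icc:
  assumes h: "h \<in> L2 M" and sub: "{c..d} \<subseteq> I" and supp: "\<And>x. x \<notin> {c..d} \<Longrightarrow> h x = 0"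
  shows "integrable M h"
proof (rule Bochner_Integration.integrable_bound)
  have "integrable M (\<lambda>x. (cmod (h x))\<^sup>2)" using h by (simp add: L2_def)
  with indicator_Icc_integrable[OF sub] show "integrable M (\<lambda>x. indicator {c..d} x + (cmod (h x))\<^sup>2)" by (rule Bochner_Integration.integrable_add)
  show "h \<in> borel_measurable M" using h by (simp add: L2_def)
  have "cmod (h x) \<le> indicator {c..d} x + (cmod (h x))\<^sup>2" for x
  proof (cases "x \<in> {c..d}")
    case True
    have "2 * cmod (h x) \<le> 1 + (cmod (h x))\<^sup>2" using sum_squares_bound[of 1 "cmod (h x)"] by simp
    moreover have "0 \<le> cmod (h x)" by simp
    ultimately have "cmod (h x) \<le> 1 + (cmod (h x))\<^sup>2" by linarith
    then show ?thesis using True by simp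
  qed (simp add: supp)
  then show "AE x in M. norm (h x) \<le> norm (indicator {c..d} x + (cmod (h x))\<^sup>2)"
    by (intro AE_I2) simp
qed

text \<open>For compactly supported \<open>h\<close> the kernel is bounded on the relevant
  rectangle, so the double integrand is dominated by a product of an integrable function of
  \<open>t\<close> and one of \<open>x\<close>. After the exchange the inner integrals are the
  conjugates of the transform entries.\<close>

lemma truncated_inverse_duality_compact:
  assumes g: "g \<in> L2_matrix \<mu> R" and h: "h \<in> L2 M" and sub: "{c..d} \<subseteq> I"
    and supp: "\<And>x. x \<notin> {c..d} \<Longrightarrow> h x = 0"
  shows "L2_inner M (truncated_inverse N g) h = inner_matrix \<mu> R (\<lambda>t. indicator {-N..<N} t *s g t) (F h)"
proof -
  let ?\<chi> = "\<lambda>t. indicator {-N..<N} t :: real"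
  let ?k = "\<lambda>x t. ?\<chi> t *\<^sub>R inversion_integrand \<theta> \<phi> R g x t"
  define \<Phi> where "\<Phi> = (\<lambda>x t. ?k x t * cnj (h x))"
  have hint: "integrable M h" by (rule L2_integrable_Icc[OF h sub supp])
  have cs: "compactly_supported L h" unfolding compactly_supported_def
    using sub supp by (intro exI[of _ "{c..d}"]) auto
  obtain C where C: "C \<ge> 0" "\<And>x t. x \<in> {c..d} \<Longrightarrow> norm (?k x t) \<le>
      C * (norm (?\<chi> t *\<^sub>R form_row g 1 t) + norm (?\<chi> t *\<^sub>R form_row g 2 t))"
    using inversion_integrand_bound[OF sub] by blast
  define S where "S = (\<integral>t. norm (?\<chi> t *\<^sub>R form_row g 1 t) + norm (?\<chi> t *\<^sub>R form_row g 2 t) \<partial>\<mu>)"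
  have Gi: "integrable \<mu> (\<lambda>t. norm (?\<chi> t *\<^sub>R form_row g 1 t) + norm (?\<chi> t *\<^sub>R form_row g 2 t))"
    by (intro Bochner_Integration.integrable_add integrable_norm form_row_integrable[OF g])
  have hm: "(\<lambda>p. cnj (h (fst p))) \<in> borel_measurable (M \<Otimes>\<^sub>M \<mu>)"
    by (rule measurable_compose[OF measurable_fst borel_measurable_integrable[OF integrable_cnj[OF hint]]])
  have \<Phi>m: "case_prod \<Phi> \<in> borel_measurable (M \<Otimes>\<^sub>M \<mu>)"
    using borel_measurable_times[OF inversion_integrand_measurable[OF g, of N] hm] by (simp add: \<Phi>_def split_def)
  have ki: "integrable \<mu> (?k x)" if "x \<in> I" for x
    using inversion_integrand_integrable[OF g that, of N] by (simp add: set_integrable_def)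
  have \<Phi>bound: "norm (\<Phi> x t) \<le> C * (norm (?\<chi> t *\<^sub>R form_row g 1 t) + norm (?\<chi> t *\<^sub>R form_row g 2 t)) * norm (h x)" for x t
  proof (cases "x \<in> {c..d}")
    case True
    then show ?thesis unfolding \<Phi>_def norm_mult complex_mod_cnj using C(2)[OF True] by (intro mult_right_mono) auto
  qed (simp add: \<Phi>_def supp)
  have \<Phi>x: "integrable \<mu> (\<Phi> x)" if "x \<in> I" for x
    unfolding \<Phi>_def using ki[OF that] by (rule integrable_mult_left)
  have int: "integrable (M \<Otimes>\<^sub>M \<mu>) (case_prod \<Phi>)"
  proof (rule Fubini_integrable[OF \<Phi>m])
    show "AE x in M. integrable \<mu> (\<lambda>t. case_prod \<Phi> (x, t))"
      using \<Phi>x by (intro AE_I2) (simp add: space_weight)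
    show "integrable M (\<lambda>x. \<integral>t. norm (case_prod \<Phi> (x, t)) \<partial>\<mu>)"
    proof (rule Bochner_Integration.integrable_bound)
      show "integrable M (\<lambda>x. C * S * norm (h x))" using hint by simp
      have "(\<lambda>(x,t). norm (\<Phi> x t)) \<in> borel_measurable (M \<Otimes>\<^sub>M \<mu>)" using \<Phi>m by (simp add: split_def)
      then show "(\<lambda>x. \<integral>t. norm (case_prod \<Phi> (x, t)) \<partial>\<mu>) \<in> borel_measurable M"
        using \<mu>.borel_measurable_lebesgue_integral by simp
      show "AE x in M. norm (\<integral>t. norm (case_prod \<Phi> (x, t)) \<partial>\<mu>) \<le> norm (C * S * norm (h x))"
      proof (rule AE_I2)
        fix x assume "x \<in> space M"
        then have x: "x \<in> I" by (simp add: space_weight)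
        have "(\<integral>t. norm (\<Phi> x t) \<partial>\<mu>) \<le> (\<integral>t. C * (norm (?\<chi> t *\<^sub>R form_row g 1 t) + norm (?\<chi> t *\<^sub>R form_row g 2 t)) * norm (h x) \<partial>\<mu>)"
          using Gi \<Phi>x[OF x] by (intro integral_mono \<Phi>bound integrable_norm integrable_mult_left integrable_mult_right)
        also have "\<dots> = C * S * norm (h x)" unfolding S_def by simp
        finally show "norm (\<integral>t. norm (case_prod \<Phi> (x, t)) \<partial>\<mu>) \<le> norm (C * S * norm (h x))"
          by simp
      qed
    qed
  qed
  have "L2_inner M (truncated_inverse N g) h = (\<integral>x. (\<integral>t. \<Phi> x t \<partial>\<mu>) \<partial>M)"
    unfolding L2_inner_def truncated_inverse_def set_lebesgue_integral_def \<Phi>_def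
    by (simp only: integral_mult_left_zero)
  also have "\<dots> = (\<integral>t. (\<integral>x. \<Phi> x t \<partial>M) \<partial>\<mu>)"
    by (rule Fubini_integral[OF int, symmetric])
  also have "\<dots> = (\<integral>t. indicator {-N..<N} t * matrix_form (R t) (g t) (transform L \<theta> \<phi> h t) \<partial>\<mu>)"
  proof (rule Bochner_Integration.integral_cong[OF refl])
    fix t
    \<comment> \<open>\<open>transform\<close> has no conjugation; reality of the solutions moves
      the one on \<open>h\<close> outside the integral.\<close>
    have real: "(\<integral>x. w (of_real t) x * cnj (h x) \<partial>M) = cnj (\<integral>x. w (of_real t) x * h x \<partial>M)"
      if "\<And>x. x \<in> I \<Longrightarrow> cnj (w (of_real t) x) = w (of_real t) x" for w :: "complex \<Rightarrow> real \<Rightarrow> complex"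
    proof -
      have "(\<integral>x. w (of_real t) x * cnj (h x) \<partial>M) = (\<integral>x. cnj (w (of_real t) x * h x) \<partial>M)"
        by (rule Bochner_Integration.integral_cong) (auto simp: space_weight that)
      then show ?thesis by (simp only: Bochner_Integration.integral_cnj)
    qed
    have ci: "integrable M (\<lambda>x. w (of_real t) x * cnj (h x))"
      if w: "continuous_on (I \<times> UNIV) (\<lambda>(x,t::real). w (of_real t) x)"
        "\<And>x. x \<in> I \<Longrightarrow> cnj (w (of_real t) x) = w (of_real t) x" for w :: "complex \<Rightarrow> real \<Rightarrow> complex"
    proof -
      have "integrable M (\<lambda>x. cnj (w (of_real t) x * h x))" using kernel_mult_integrable[OF w(1) sub hint supp] by (intro integrable_cnj)
      then show ?thesis
        by (rule Bochner_Integration.integrable_cong[THEN iffD1, OF refl, rotated]) (simp add: space_weight w(2))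
    qed
    have "(\<integral>x. \<Phi> x t \<partial>M) = (\<integral>x. indicator {-N..<N} t * (form_row g 1 t * (\<theta> (of_real t) x * cnj (h x)) + form_row g 2 t * (\<phi> (of_real t) x * cnj (h x))) \<partial>M)"
      unfolding \<Phi>_def inversion_integrand_form_row
      by (rule Bochner_Integration.integral_cong) (auto simp: indicator_def algebra_simps)
    also have "\<dots> = indicator {-N..<N} t * (form_row g 1 t * (\<integral>x. \<theta> (of_real t) x * cnj (h x) \<partial>M) + form_row g 2 t * (\<integral>x. \<phi> (of_real t) x * cnj (h x) \<partial>M))"
      using ci[OF cont_\<theta> real_\<theta>] ci[OF cont_\<phi> real_\<phi>] by simp
    also have "\<dots> = indicator {-N..<N} t * matrix_form (R t) (g t) (transform L \<theta> \<phi> h t)"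
    proof -
      have "(\<integral>x. \<theta> (of_real t) x * cnj (h x) \<partial>M) = cnj (\<integral>x. \<theta> (of_real t) x * h x \<partial>M)"
        by (rule real) (rule real_\<theta>)
      moreover have "(\<integral>x. \<phi> (of_real t) x * cnj (h x) \<partial>M) = cnj (\<integral>x. \<phi> (of_real t) x * h x \<partial>M)"
        by (rule real) (rule real_\<phi>)
      ultimately show ?thesis unfolding matrix_form_form_row transform_def by simp
    qed
    finally show "(\<integral>x. \<Phi> x t \<partial>M) = indicator {-N..<N} t * matrix_form (R t) (g t) (transform L \<theta> \<phi> h t)" .
  qed
  also have "\<dots> = inner_matrix \<mu> R (\<lambda>t. indicator {-N..<N} t *s g t) (transform L \<theta> \<phi> h)"
    by (simp add: inner_indicator)
  also have "\<dots> = inner_matrix \<mu> R (\<lambda>t. indicator {-N..<N} t *s g t) (F h)"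
    using F_transform[OF h cs] indicator_in[OF g] F_in[OF h] eq_matrix_sym
    by (intro inner_cong(2)) auto
  finally show ?thesis .
qed

end

lemma tendsto_if_norm_diff_le:
  fixes a :: "'i \<Rightarrow> 'b::real_normed_vector"
  assumes "\<And>n. norm (a n - l) \<le> b n" "(b \<longlongrightarrow> 0) F"
  shows "(a \<longlongrightarrow> l) F"
  by (rule LIM_zero_cancel, rule Lim_null_comparison[OF _ assms(2)]) (use assms(1) in auto)

lemma L2_inner_tendsto:
  assumes "f \<in> L2 M" "h \<in> L2 M" "\<And>n::nat. k n \<in> L2 M" "(\<lambda>n. L2_norm M (\<lambda>x. k n x - h x)) \<longlonglongrightarrow> 0"
  shows "(\<lambda>n. L2_inner M (k n) f) \<longlonglongrightarrow> L2_inner M h f" "(\<lambda>n. L2_inner M f (k n)) \<longlonglongrightarrow> L2_inner M f h"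
proof -
  show 1: "(\<lambda>n. L2_inner M (k n) f) \<longlonglongrightarrow> L2_inner M h f"
  proof (rule tendsto_if_norm_diff_le)
    show "norm (L2_inner M (k n) f - L2_inner M h f) \<le> L2_norm M (\<lambda>x. k n x - h x) * L2_norm M f" for n
      using L2_cauchy_schwarz[OF L2_diff[OF assms(3,2)] assms(1)] L2_inner_diff_left[OF assms(3,2,1)] by simp
    show "(\<lambda>n. L2_norm M (\<lambda>x. k n x - h x) * L2_norm M f) \<longlonglongrightarrow> 0"
      using tendsto_mult_right[OF assms(4), of "L2_norm M f"] by simp
  qed
  show "(\<lambda>n. L2_inner M f (k n)) \<longlonglongrightarrow> L2_inner M f h"
    using tendsto_cnj[OF 1] L2.ip_cnj[OF assms(3,1)] L2.ip_cnj[OF assms(2,1)] by simp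
qed

context matrix_isometry
begin

lemma F_inner_tendsto:
  assumes "g \<in> L2_matrix \<mu> R" "h \<in> L2 M" "\<And>n::nat. k n \<in> L2 M" "(\<lambda>n. L2_norm M (\<lambda>x. k n x - h x)) \<longlonglongrightarrow> 0"
  shows "(\<lambda>n. inner_matrix \<mu> R (F (k n)) g) \<longlonglongrightarrow> inner_matrix \<mu> R (F h) g"
    "(\<lambda>n. inner_matrix \<mu> R g (F (k n))) \<longlonglongrightarrow> inner_matrix \<mu> R g (F h)"
proof -
  show 1: "(\<lambda>n. inner_matrix \<mu> R (F (k n)) g) \<longlonglongrightarrow> inner_matrix \<mu> R (F h) g"
  proof (rule tendsto_if_norm_diff_le)
    show "norm (inner_matrix \<mu> R (F (k n)) g - inner_matrix \<mu> R (F h) g) \<le> L2_norm M (\<lambda>x. k n x - h x) * mnorm \<mu> R g" for n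
      using m_cauchy_schwarz[OF diff_in[OF F_in[OF assms(3)] F_in[OF assms(2)]] assms(1)]
        inner_diff[OF F_in[OF assms(3)] F_in[OF assms(2)] assms(1)] F_diff_norm[OF assms(3,2)] by simp
    show "(\<lambda>n. L2_norm M (\<lambda>x. k n x - h x) * mnorm \<mu> R g) \<longlonglongrightarrow> 0"
      using tendsto_mult_right[OF assms(4), of "mnorm \<mu> R g"] by simp
  qed
  show "(\<lambda>n. inner_matrix \<mu> R g (F (k n))) \<longlonglongrightarrow> inner_matrix \<mu> R g (F h)"
    using tendsto_cnj[OF 1] ip_cnj[OF F_in[OF assms(3)] assms(1)] ip_cnj[OF F_in[OF assms(2)] assms(1)] by simp
qed

end

context sl_transform
begin

text \<open>Makes every cut-off of the truncated inverse to a compact interval square integrable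
  before this is known for the function itself.\<close>

lemma truncated_inverse_bounded:
  assumes g: "g \<in> L2_matrix \<mu> R" and sub: "{c..d} \<subseteq> I"
  obtains B where "B \<ge> 0" "\<And>x. x \<in> {c..d} \<Longrightarrow> cmod (truncated_inverse N g x) \<le> B"
proof -
  let ?\<chi> = "\<lambda>t. indicator {-N..<N} t :: real"
  obtain C where C: "C \<ge> 0" "\<And>x t. x \<in> {c..d} \<Longrightarrow> norm (?\<chi> t *\<^sub>R inversion_integrand \<theta> \<phi> R g x t) \<le>
      C * (norm (?\<chi> t *\<^sub>R form_row g 1 t) + norm (?\<chi> t *\<^sub>R form_row g 2 t))"
    using inversion_integrand_bound[OF sub] by blast
  have Gi: "integrable \<mu> (\<lambda>t. C * (norm (?\<chi> t *\<^sub>R form_row g 1 t) + norm (?\<chi> t *\<^sub>R form_row g 2 t)))"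
    by (intro integrable_mult_right Bochner_Integration.integrable_add integrable_norm form_row_integrable[OF g])
  define B where "B = (\<integral>t. C * (norm (?\<chi> t *\<^sub>R form_row g 1 t) + norm (?\<chi> t *\<^sub>R form_row g 2 t)) \<partial>\<mu>)"
  show ?thesis
  proof (rule that[of B])
    show "B \<ge> 0" unfolding B_def using C(1) by (intro integral_nonneg_AE AE_I2) auto
    fix x assume x: "x \<in> {c..d}"
    have ki: "integrable \<mu> (\<lambda>t. ?\<chi> t *\<^sub>R inversion_integrand \<theta> \<phi> R g x t)"
      using inversion_integrand_integrable[OF g subsetD[OF sub x], of N] by (simp add: set_integrable_def)
    have "cmod (truncated_inverse N g x) \<le> (\<integral>t. norm (?\<chi> t *\<^sub>R inversion_integrand \<theta> \<phi> R g x t) \<partial>\<mu>)"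
      unfolding truncated_inverse_def set_lebesgue_integral_def by (rule integral_norm_bound)
    also have "\<dots> \<le> B" unfolding B_def
      by (rule integral_mono[OF integrable_norm[OF ki] Gi C(2)[OF x]])
    finally show "cmod (truncated_inverse N g x) \<le> B" .
  qed
qed

text \<open>Pair the truncated inverse with its own cut-off \<open>h n\<close>: duality and
  Cauchy-Schwarz bound the squared norm of \<open>h n\<close> by the norm of the truncated
  \<open>g\<close> times the norm of \<open>h n\<close>. Cancelling gives a bound free of
  \<open>n\<close>, and Fatou's lemma carries it to the whole interval.\<close>

lemma truncated_inverse_L2:
  assumes g: "g \<in> L2_matrix \<mu> R"
  shows "truncated_inverse N g \<in> L2 M"
proof -
  let ?g = "\<lambda>t. indicator {-N..<N} t *s g t"
  have gin: "?g \<in> L2_matrix \<mu> R" using g by (rule indicator_in) simp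
  obtain c d :: "nat \<Rightarrow> real" where cd: "\<And>n. {c n..d n} \<subseteq> I"
    "\<And>x. x \<in> I \<Longrightarrow> \<forall>\<^sub>F n in sequentially. x \<in> {c n..d n}"
    using dom_int_exhaustion[OF coef] by blast
  define h where "h n x = indicator {c n..d n} x * truncated_inverse N g x" for n x
  have Pm: "truncated_inverse N g \<in> borel_measurable M" by (rule truncated_inverse_measurable[OF g])
  have hm: "h n \<in> borel_measurable M" for n
    unfolding h_def using Pm Icc_sets_weight[OF cd(1)] by (intro borel_measurable_times borel_measurable_indicator) auto
  have h: "h n \<in> L2 M" for n
  proof -
    obtain B where B: "B \<ge> 0" "\<And>x. x \<in> {c n..d n} \<Longrightarrow> cmod (truncated_inverse N g x) \<le> B"
      using truncated_inverse_bounded[OF g cd(1)] by blast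
    have "integrable M (\<lambda>x. (cmod (h n x))\<^sup>2)"
    proof (rule Bochner_Integration.integrable_bound)
      show "integrable M (\<lambda>x. B\<^sup>2 * indicator {c n..d n} x)"
        by (rule integrable_mult_right[OF indicator_Icc_integrable[OF cd(1)]])
      show "(\<lambda>x. (cmod (h n x))\<^sup>2) \<in> borel_measurable M" using hm by simp
      have "(cmod (h n x))\<^sup>2 \<le> B\<^sup>2 * indicator {c n..d n} x" for x
      proof (cases "x \<in> {c n..d n}")
        case True
        then have "(cmod (truncated_inverse N g x))\<^sup>2 \<le> B\<^sup>2" using B(2)[OF True] by (intro power_mono) auto
        then show ?thesis using True by (simp add: h_def)
      qed (simp add: h_def)
      then show "AE x in M. norm ((cmod (h n x))\<^sup>2) \<le> norm (B\<^sup>2 * indicator {c n..d n} x)"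
        by (intro AE_I2) simp
    qed
    then show ?thesis using hm by (simp add: L2_def)
  qed
  have hn: "L2_norm M (h n) \<le> mnorm \<mu> R ?g" for n
  proof -
    have "L2_inner M (truncated_inverse N g) (h n) = L2_inner M (h n) (h n)"
      unfolding L2_inner_def h_def by (intro Bochner_Integration.integral_cong) (auto simp: indicator_def)
    also have "\<dots> = of_real ((L2_norm M (h n))\<^sup>2)" by (rule L2_inner_self)
    finally have "of_real ((L2_norm M (h n))\<^sup>2) = inner_matrix \<mu> R ?g (F (h n))"
      using truncated_inverse_duality_compact[OF g h[of n] cd(1)[of n], where N=N] by (simp add: h_def)
    then have "(L2_norm M (h n))\<^sup>2 = cmod (inner_matrix \<mu> R ?g (F (h n)))"
      by (metis norm_of_real abs_power2)
    also have "\<dots> \<le> mnorm \<mu> R ?g * L2_norm M (h n)"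
      using m_cauchy_schwarz[OF gin F_in[OF h]] F_norm[OF h] by simp
    finally have "L2_norm M (h n) * L2_norm M (h n) \<le> mnorm \<mu> R ?g * L2_norm M (h n)" by (simp add: power2_eq_square)
    then show ?thesis using L2_norm_nonneg[of M "h n"] m_nonneg[OF gin]
      by (cases "L2_norm M (h n) = 0") (auto simp: mult_le_cancel_right)
  qed
  have "(\<integral>\<^sup>+x. ennreal ((cmod (truncated_inverse N g x))\<^sup>2) \<partial>M) \<le> (\<integral>\<^sup>+x. liminf (\<lambda>n. ennreal ((cmod (h n x))\<^sup>2)) \<partial>M)"
  proof (rule nn_integral_mono)
    fix x assume "x \<in> space M"
    then have "x \<in> I" by (simp add: space_weight)
    from cd(2)[OF this] have "\<forall>\<^sub>F n in sequentially. ennreal ((cmod (h n x))\<^sup>2) = ennreal ((cmod (truncated_inverse N g x))\<^sup>2)"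
      by eventually_elim (simp add: h_def)
    then have "(\<lambda>n. ennreal ((cmod (h n x))\<^sup>2)) \<longlonglongrightarrow> ennreal ((cmod (truncated_inverse N g x))\<^sup>2)" by (rule tendsto_eventually)
    from lim_imp_Liminf[OF _ this] show "ennreal ((cmod (truncated_inverse N g x))\<^sup>2) \<le> liminf (\<lambda>n. ennreal ((cmod (h n x))\<^sup>2))" by simp
  qed
  also have "\<dots> \<le> liminf (\<lambda>n. \<integral>\<^sup>+x. ennreal ((cmod (h n x))\<^sup>2) \<partial>M)"
    using hm by (intro nn_integral_liminf) auto
  also have "\<dots> \<le> ennreal ((mnorm \<mu> R ?g)\<^sup>2)"
  proof -
    have "(\<integral>\<^sup>+x. ennreal ((cmod (h n x))\<^sup>2) \<partial>M) \<le> ennreal ((mnorm \<mu> R ?g)\<^sup>2)" for n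
      unfolding L2_nn_integral_norm[OF h] using hn[of n] L2_norm_nonneg by (intro ennreal_leI power_mono)
    then show ?thesis by (intro Liminf_le always_eventually allI) auto
  qed
  finally show ?thesis by (rule L2_norm_le_of_nn_integral(1)[OF Pm _ m_nonneg[OF gin]])
qed

lemma truncated_inverse_duality:
  assumes g: "g \<in> L2_matrix \<mu> R" and h: "h \<in> L2 M"
  shows "L2_inner M (truncated_inverse N g) h = inner_matrix \<mu> R (\<lambda>t. indicator {-N..<N} t *s g t) (F h)"
proof -
  have gin: "(\<lambda>t. indicator {-N..<N} t *s g t) \<in> L2_matrix \<mu> R" using g by (rule indicator_in) simp
  obtain k where k: "\<And>n. k n \<in> L2 M" "(\<lambda>n. L2_norm M (\<lambda>x. k n x - h x)) \<longlonglongrightarrow> 0"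
    "\<And>n::nat. \<exists>c d. {c..d} \<subseteq> I \<and> k n = (\<lambda>x. indicator {c..d} x * h x)"
    using compact_approximation[OF h] by blast
  have eq: "L2_inner M (truncated_inverse N g) (k n) = inner_matrix \<mu> R (\<lambda>t. indicator {-N..<N} t *s g t) (F (k n))" for n
  proof -
    obtain c d where cd: "{c..d} \<subseteq> I" "k n = (\<lambda>x. indicator {c..d} x * h x)" using k(3) by blast
    show ?thesis by (rule truncated_inverse_duality_compact[OF g k(1) cd(1)]) (simp add: cd(2))
  qed
  show ?thesis
    using LIMSEQ_unique[OF L2_inner_tendsto(2)[OF truncated_inverse_L2[OF g] h k(1,2)] F_inner_tendsto(2)[OF gin h k(1,2), folded eq]] .
qed

section \<open>Spectral projections on the transform side\<close>

lemma E_projection: "B \<in> sets borel \<Longrightarrow> orthogonal_projection M (E B)"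
  using pvm unfolding projection_valued_measure_def by (elim conjE) (rule bspec)

lemma E_L2: "\<lbrakk>f \<in> L2 M; B \<in> sets borel\<rbrakk> \<Longrightarrow> E B f \<in> L2 M"
  using E_projection[of B] by (simp add: orthogonal_projection_def)

lemma E_sym: "\<lbrakk>f \<in> L2 M; g \<in> L2 M; B \<in> sets borel\<rbrakk> \<Longrightarrow> L2_inner M (E B f) g = L2_inner M f (E B g)"
  using E_projection[of B] by (simp add: orthogonal_projection_def)

lemma E_idem: "\<lbrakk>f \<in> L2 M; B \<in> sets borel\<rbrakk> \<Longrightarrow> AE x in M. E B (E B f) x = E B f x"
  using E_projection[of B] by (simp add: orthogonal_projection_def)

text \<open>Passage from compact supports to the whole space, one argument at a time. For the limit
  in \<open>f\<close> the projection is first moved onto \<open>g\<close> by symmetry, so that only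
  the inner product has to be continuous.\<close>

lemma E_inner:
  assumes f: "f \<in> L2 M" and g: "g \<in> L2 M" and ab: "a < b"
  shows "L2_inner M (E {a<..b} f) g = inner_matrix \<mu> R (\<lambda>t. indicator {a<..b} t *s F f t) (F g)"
proof -
  let ?\<chi> = "\<lambda>u t. indicator {a<..b} t *s u t :: complex^2"
  have chi_in: "?\<chi> u \<in> L2_matrix \<mu> R" if "u \<in> L2_matrix \<mu> R" for u
    using that by (rule indicator_in) simp
  have B: "{a<..b} \<in> sets borel" by simp
  have both: "L2_inner M (E {a<..b} f) g = inner_matrix \<mu> R (?\<chi> (F f)) (F g)"
    if f: "f \<in> L2 M" "compactly_supported L f" and g: "g \<in> L2 M" "compactly_supported L g" for f g
  proof -
    note Ff = F_transform[OF f] and Fg = F_transform[OF g]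
    have "L2_inner M (E {a<..b} f) g = inner_matrix \<mu> R (?\<chi> (transform L \<theta> \<phi> f)) (transform L \<theta> \<phi> g)"
      by (rule E_transform[OF f g ab])
    also have "\<dots> = inner_matrix \<mu> R (?\<chi> (F f)) (transform L \<theta> \<phi> g)"
      using Ff Fg F_in[OF f(1)] eq_matrix_sym chi_in indicator_eq_matrix by (intro inner_cong(1)) auto
    also have "\<dots> = inner_matrix \<mu> R (?\<chi> (F f)) (F g)"
      using Fg F_in[OF f(1)] F_in[OF g(1)] eq_matrix_sym chi_in by (intro inner_cong(2)) auto
    finally show ?thesis .
  qed
  obtain fk where fk: "\<And>n. fk n \<in> L2 M" "(\<lambda>n. L2_norm M (\<lambda>x. fk n x - f x)) \<longlonglongrightarrow> 0"
    "\<And>n::nat. \<exists>c d. {c..d} \<subseteq> I \<and> fk n = (\<lambda>x. indicator {c..d} x * f x)"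
    using compact_approximation[OF f] by blast
  obtain gk where gk: "\<And>n. gk n \<in> L2 M" "(\<lambda>n. L2_norm M (\<lambda>x. gk n x - g x)) \<longlonglongrightarrow> 0"
    "\<And>n::nat. \<exists>c d. {c..d} \<subseteq> I \<and> gk n = (\<lambda>x. indicator {c..d} x * g x)"
    using compact_approximation[OF g] by blast
  have cs: "compactly_supported L (fk n)" "compactly_supported L (gk n)" for n
    using fk(3)[of n] gk(3)[of n] compactly_supported_indicator by force+
  have one: "L2_inner M (E {a<..b} (fk m)) g = inner_matrix \<mu> R (?\<chi> (F (fk m))) (F g)" for m
    using LIMSEQ_unique[OF L2_inner_tendsto(2)[OF E_L2[OF fk(1) B] g gk(1,2)]
      F_inner_tendsto(2)[OF chi_in[OF F_in[OF fk(1)]] g gk(1,2), folded both[OF fk(1) cs(1) gk(1) cs(2)]]] .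
  have swap: "inner_matrix \<mu> R (?\<chi> (F u)) (F g) = inner_matrix \<mu> R (F u) (?\<chi> (F g))" for u
    by (simp add: inner_indicator)
  have "(\<lambda>m. L2_inner M (fk m) (E {a<..b} g)) \<longlonglongrightarrow> L2_inner M f (E {a<..b} g)"
    by (rule L2_inner_tendsto(1)[OF E_L2[OF g B] f fk(1,2)])
  moreover have "L2_inner M (fk m) (E {a<..b} g) = inner_matrix \<mu> R (F (fk m)) (?\<chi> (F g))" for m
    using one[of m] E_sym[OF fk(1) g B] swap by simp
  ultimately have "(\<lambda>m. inner_matrix \<mu> R (F (fk m)) (?\<chi> (F g))) \<longlonglongrightarrow> L2_inner M f (E {a<..b} g)" by simp
  moreover have "(\<lambda>m. inner_matrix \<mu> R (F (fk m)) (?\<chi> (F g))) \<longlonglongrightarrow> inner_matrix \<mu> R (F f) (?\<chi> (F g))"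
    by (rule F_inner_tendsto(1)[OF chi_in[OF F_in[OF g]] f fk(1,2)])
  ultimately have "L2_inner M f (E {a<..b} g) = inner_matrix \<mu> R (F f) (?\<chi> (F g))"
    by (rule LIMSEQ_unique)
  then show ?thesis using E_sym[OF f g B] swap[of f] by simp
qed

text \<open>With \<open>n\<close> the squared norm of \<open>E {a<..b} f\<close>, symmetry and
  idempotence make all four inner products between its image and the cut-off of \<open>F f\<close>
  equal to \<open>n\<close>, so the squared norm of the difference cancels.\<close>

lemma F_E:
  assumes f: "f \<in> L2 M" and ab: "a < b"
  shows "eq_matrix \<mu> R (F (E {a<..b} f)) (\<lambda>t. indicator {a<..b} t *s F f t)"
proof -
  let ?e = "E {a<..b} f" and ?w = "\<lambda>t. indicator {a<..b} t *s F f t"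
  have B: "{a<..b} \<in> sets borel" by simp
  have e: "?e \<in> L2 M" by (rule E_L2[OF f B])
  have w: "?w \<in> L2_matrix \<mu> R" using F_in[OF f] by (rule indicator_in) simp
  define n where "n = L2_inner M ?e ?e"
  have ef: "L2_inner M ?e f = n"
  proof -
    have "L2_inner M ?e ?e = L2_inner M (E {a<..b} ?e) f" using E_sym[OF e f B] by simp
    also have "\<dots> = L2_inner M ?e f"
      by (rule L2_inner_cong_AE[OF E_L2[OF e B] e E_idem[OF f B] f f]) simp
    finally show ?thesis by (simp add: n_def)
  qed
  have 1: "inner_matrix \<mu> R ?w ?w = n"
    using E_inner[OF f f ab] ef inner_indicator_both[of "{a<..b}" "F f" "F f"] by simp
  have 2: "inner_matrix \<mu> R ?w (F ?e) = n" using E_inner[OF f e ab] by (simp add: n_def)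
  have nr: "cnj n = n" unfolding n_def L2_inner_self by simp
  have 3: "inner_matrix \<mu> R (F ?e) ?w = n" using ip_cnj[OF w F_in[OF e]] 2 nr by simp
  have 4: "inner_matrix \<mu> R (F ?e) (F ?e) = n" using F_inner_self[OF e] by (simp add: n_def)
  have "inner_matrix \<mu> R (\<lambda>t. 1 *s F ?e t + (-1) *s ?w t) (\<lambda>t. 1 *s F ?e t + (-1) *s ?w t) = 0"
    unfolding ip_comb_self[OF F_in[OF e] w] 1 2 3 4 by simp
  then have "mnorm \<mu> R (\<lambda>t. F ?e t - ?w t) = 0" by (simp add: mnorm_def vector_sneg_minus1[symmetric])
  then show ?thesis using eq_matrix_iff[OF F_in[OF e] w] by simp
qed

text \<open>The transforms of the indicators of the countably many intervals with rational endpoints span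
  the whole plane at every point, because the two solutions are linearly independent.\<close>

lemma rational_transforms_separate:
  assumes zero: "\<And>c d::rat. {of_rat c..of_rat d} \<subseteq> I \<Longrightarrow>
      (\<Sum>j\<in>UNIV. transform L \<theta> \<phi> (indicator {of_rat c..of_rat d}) t $ j * \<eta> j) = 0"
  shows "\<eta> (1::2) = 0 \<and> \<eta> 2 = 0"
proof (rule indep)
  define u where "u x = \<eta> 1 * \<theta> (of_real t) x + \<eta> 2 * \<phi> (of_real t) x" for x
  have cu: "continuous_on I u" unfolding u_def
    using kernel_section_continuous(1)[OF cont_\<theta> UNIV_I] kernel_section_continuous(1)[OF cont_\<phi> UNIV_I]
    by (intro continuous_intros)
  fix x1 assume x1: "x1 \<in> I"
  have "u x1 = 0"
  proof (rule ccontr)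
    assume ne: "u x1 \<noteq> 0"
    \<comment> \<open>Multiplying by the conjugate of \<open>u x1\<close> makes the value at
      \<open>x1\<close> positive, and continuity keeps the real part above half of it on a short
      rational interval, where the integral then cannot vanish.\<close>
    define v where "v x = Re (u x * cnj (u x1))" for x
    define e where "e = (cmod (u x1))\<^sup>2 / 2"
    have e: "e > 0" using ne by (simp add: e_def)
    have cv: "continuous_on I v" unfolding v_def by (intro continuous_intros cu)
    have v1: "v x1 = 2 * e" unfolding v_def e_def complex_norm_square[symmetric] by simp
    have "isCont v x1" using cv x1 open_dom_int continuous_on_eq_continuous_at by blast
    then obtain \<delta> where \<delta>: "\<delta> > 0" "\<And>x. dist x x1 < \<delta> \<Longrightarrow> dist (v x) (v x1) < e"
      using e unfolding continuous_at_eps_delta by blast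
    obtain c0 d0 where cd0: "c0 < x1" "x1 < d0" "{c0..d0} \<subseteq> I" using x1 by (rule dom_int_Icc_neighbourhood)
    obtain c :: rat where c: "max c0 (x1 - \<delta>) < of_rat c" "of_rat c < x1"
      using of_rat_dense[of "max c0 (x1 - \<delta>)" x1] cd0 \<delta> by auto
    obtain d :: rat where d: "x1 < of_rat d" "of_rat d < min d0 (x1 + \<delta>)"
      using of_rat_dense[of x1 "min d0 (x1 + \<delta>)"] cd0 \<delta> by auto
    let ?K = "{of_rat c..of_rat d} :: real set"
    have sub: "?K \<subseteq> I" by (rule order_trans[OF _ cd0(3)]) (use c d in auto)
    have vlow: "e \<le> v x" if "x \<in> ?K" for x
    proof -
      have "dist x x1 < \<delta>" using that c d by (auto simp: dist_real_def abs_less_iff)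
      from \<delta>(2)[OF this] show ?thesis using v1 by (auto simp: dist_real_def abs_less_iff)
    qed
    have Ks: "?K \<in> sets M" by (rule Icc_sets_weight[OF sub])
    have Kr: "integrable M (indicator ?K :: real \<Rightarrow> real)" by (rule indicator_Icc_integrable[OF sub])
    have "(\<lambda>x. complex_of_real (indicator ?K x)) = indicator ?K" by (auto simp: indicator_def)
    then have Kc: "integrable M (indicator ?K :: real \<Rightarrow> complex)"
      using complex_of_real_integrable_eq[of M "indicator ?K"] Kr by simp
    have wi: "integrable M (\<lambda>x. w (of_real t) x * indicator ?K x)"
      if w: "continuous_on (I \<times> UNIV) (\<lambda>(x,t::real). w (of_real t) x)" for w :: "complex \<Rightarrow> real \<Rightarrow> complex"
      by (rule kernel_mult_integrable[OF w sub Kc]) simp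
    have ui: "integrable M (\<lambda>x. u x * indicator ?K x)"
      using integrable_mult_right[OF wi[OF cont_\<theta>], of "\<eta> 1"] integrable_mult_right[OF wi[OF cont_\<phi>], of "\<eta> 2"]
      by (simp add: u_def algebra_simps)
    have "(\<integral>x. u x * indicator ?K x \<partial>M) = (\<integral>x. \<eta> 1 * (\<theta> (of_real t) x * indicator ?K x) + \<eta> 2 * (\<phi> (of_real t) x * indicator ?K x) \<partial>M)"
      by (simp add: u_def algebra_simps)
    also have "\<dots> = \<eta> 1 * (\<integral>x. \<theta> (of_real t) x * indicator ?K x \<partial>M) + \<eta> 2 * (\<integral>x. \<phi> (of_real t) x * indicator ?K x \<partial>M)"
      using wi[OF cont_\<theta>] wi[OF cont_\<phi>] by simp
    also have "\<dots> = (\<Sum>j\<in>UNIV. transform L \<theta> \<phi> (indicator ?K) t $ j * \<eta> j)"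
      by (simp add: transform_def sum_2 mult.commute)
    also have "\<dots> = 0" by (rule zero[OF sub])
    finally have u0: "(\<integral>x. u x * indicator ?K x \<partial>M) = 0" .
    have vi: "integrable M (\<lambda>x. v x * indicator ?K x)" and v0: "(\<integral>x. v x * indicator ?K x \<partial>M) = 0"
    proof -
      have bl: "bounded_linear (\<lambda>z. Re (z * cnj (u x1)))"
        by (rule bounded_linear_compose[OF bounded_linear_Re bounded_linear_mult_left])
      have eq: "(\<lambda>x. Re (u x * indicator ?K x * cnj (u x1))) = (\<lambda>x. v x * indicator ?K x)"
        by (auto simp: v_def indicator_def)
      show "integrable M (\<lambda>x. v x * indicator ?K x)" using integrable_bounded_linear[OF bl ui] unfolding eq .
      show "(\<integral>x. v x * indicator ?K x \<partial>M) = 0" using integral_bounded_linear[OF bl ui] unfolding eq u0 by simp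
    qed
    have "(\<integral>x. e * indicator ?K x \<partial>M) \<le> (\<integral>x. v x * indicator ?K x \<partial>M)"
    proof (rule integral_mono[OF _ vi])
      show "integrable M (\<lambda>x. e * indicator ?K x)" using Kr by (rule integrable_mult_right)
    qed (use vlow in \<open>auto simp: indicator_def\<close>)
    then have "e * measure M ?K \<le> 0" unfolding v0 using Ks sets.sets_into_space[OF Ks] by (simp add: Int_absorb2)
    moreover have "measure M ?K > 0"
    proof -
      have "(of_rat c :: real) < of_rat d" using c(2) d(1) by (rule less_trans)
      from emeasure_weight_Icc_pos[OF coef sub this] show ?thesis using emeasure_weight_Icc_finite[OF coef sub]
        by (auto simp: measure_def enn2real_positive_iff)
    qed
    ultimately show False using e by (simp add: mult_le_0_iff)
  qed
  then show "\<eta> 1 * \<theta> (of_real t) x1 + \<eta> 2 * \<phi> (of_real t) x1 = 0" by (simp add: u_def)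
qed

text \<open>Invariance of the range under cut-offs turns one orthogonality relation into vanishing
  integrals over all half-open intervals, hence into a pointwise relation. Countability of
  \<open>J\<close> provides a single null set for all test functions.\<close>

lemma orthogonal_range_zero:
  assumes w: "w \<in> L2_matrix \<mu> R"
    and orth: "\<And>f. f \<in> L2 M \<Longrightarrow> inner_matrix \<mu> R (F f) w = 0"
  shows "mnorm \<mu> R w = 0"
proof -
  define J where "J = {cd :: rat \<times> rat. {of_rat (fst cd)..of_rat (snd cd)} \<subseteq> I}"
  define h where "h cd = (indicator {of_rat (fst cd)..of_rat (snd cd)} :: real \<Rightarrow> complex)" for cd :: "rat \<times> rat"
  have each: "AE t in \<mu>. matrix_form (R t) (transform L \<theta> \<phi> (h cd) t) (w t) = 0" if cd: "cd \<in> J" for cd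
  proof -
    obtain c d where cd_eq: "cd = (c,d)" by (cases cd)
    let ?K = "{of_rat c..of_rat d} :: real set"
    have sub: "?K \<subseteq> I" using cd by (simp add: J_def cd_eq)
    have hL2: "h cd \<in> L2 M" using indicator_Icc_L2[OF sub] by (simp add: h_def cd_eq)
    have cs: "compactly_supported L (h cd)"
      using compactly_supported_indicator[OF sub, of "\<lambda>x. 1"] by (simp add: h_def cd_eq)
    note T = F_transform[OF hL2 cs]
    show ?thesis
    proof (rule AE_zero_if_Ioc_integrals_zero[OF sets_mu])
      show "integrable \<mu> (\<lambda>t. matrix_form (R t) (transform L \<theta> \<phi> (h cd) t) (w t))"
        using T w by (intro form_integrable) auto
      fix a b :: real assume ab: "a < b"
      have Fin: "(\<lambda>t. indicator {a<..b} t *s F (h cd) t) \<in> L2_matrix \<mu> R"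
        "(\<lambda>t. indicator {a<..b} t *s transform L \<theta> \<phi> (h cd) t) \<in> L2_matrix \<mu> R"
        using F_in[OF hL2] T by (auto intro!: indicator_in)
      have B: "{a<..b} \<in> sets borel" by simp
      have "(\<integral>t. indicator {a<..b} t * matrix_form (R t) (transform L \<theta> \<phi> (h cd) t) (w t) \<partial>\<mu>)
        = inner_matrix \<mu> R (\<lambda>t. indicator {a<..b} t *s transform L \<theta> \<phi> (h cd) t) w"
        by (simp add: inner_indicator)
      also have "\<dots> = inner_matrix \<mu> R (\<lambda>t. indicator {a<..b} t *s F (h cd) t) w"
        using T Fin w eq_matrix_sym indicator_eq_matrix by (intro inner_cong(1)) auto
      also have "\<dots> = inner_matrix \<mu> R (F (E {a<..b} (h cd))) w"
        using Fin w F_in[OF E_L2[OF hL2 B]] F_E[OF hL2 ab] eq_matrix_sym by (intro inner_cong(1)) auto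
      also have "\<dots> = 0" by (rule orth[OF E_L2[OF hL2 B]])
      finally show "(\<integral>t. indicator {a<..b} t * matrix_form (R t) (transform L \<theta> \<phi> (h cd) t) (w t) \<partial>\<mu>) = 0" .
    qed
  qed
  have "countable J" by (rule countable_subset[OF subset_UNIV]) simp
  then have "AE t in \<mu>. \<forall>cd\<in>J. matrix_form (R t) (transform L \<theta> \<phi> (h cd) t) (w t) = 0"
    using each by (simp add: AE_ball_countable)
  then have "AE t in \<mu>. matrix_form (R t) (w t) (w t) = 0"
  proof eventually_elim
    case (elim t)
    \<comment> \<open>The coefficients of the functional that pairs a vector with \<open>w t\<close>
      under \<open>R t\<close>; once they vanish, \<open>w t\<close> has form zero even where
      \<open>R t\<close> is singular.\<close>
    define \<eta> where "\<eta> i = (\<Sum>j\<in>UNIV. R t $ i $ j * cnj (w t $ j))" for i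
    have form: "matrix_form (R t) u (w t) = (\<Sum>i\<in>UNIV. u $ i * \<eta> i)" for u
      by (simp add: matrix_form_def \<eta>_def sum_2 algebra_simps)
    have "\<eta> 1 = 0 \<and> \<eta> 2 = 0"
    proof (rule rational_transforms_separate)
      fix c d :: rat assume "{of_rat c..of_rat d} \<subseteq> I"
      then have "(c,d) \<in> J" by (simp add: J_def)
      from bspec[OF elim this] show "(\<Sum>j\<in>UNIV. transform L \<theta> \<phi> (indicator {of_rat c..of_rat d}) t $ j * \<eta> j) = 0"
        unfolding form by (simp add: h_def)
    qed
    then show ?case unfolding form by (simp add: sum_2)
  qed
  then have "inner_matrix \<mu> R w w = 0" unfolding inner_matrix_def by (rule integral_eq_zero_AE)
  then show ?thesis by (simp add: mnorm_def)
qed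

section \<open>Surjectivity and the inversion formula\<close>

text \<open>By duality the truncated inverse pairs with every \<open>f\<close> as the cut-off of
  \<open>g\<close> pairs with \<open>F f\<close>, and \<open>F\<close> preserves pairings, so the
  difference is orthogonal to the range.\<close>

lemma F_truncated_inverse:
  assumes g: "g \<in> L2_matrix \<mu> R"
  shows "eq_matrix \<mu> R (F (truncated_inverse N g)) (\<lambda>t. indicator {-N..<N} t *s g t)"
proof -
  let ?g = "\<lambda>t. indicator {-N..<N} t *s g t"
  have gin: "?g \<in> L2_matrix \<mu> R" using g by (rule indicator_in) simp
  have Pin: "truncated_inverse N g \<in> L2 M" by (rule truncated_inverse_L2[OF g])
  have w: "(\<lambda>t. F (truncated_inverse N g) t - ?g t) \<in> L2_matrix \<mu> R" by (rule diff_in[OF F_in[OF Pin] gin])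
  have "mnorm \<mu> R (\<lambda>t. F (truncated_inverse N g) t - ?g t) = 0"
  proof (rule orthogonal_range_zero[OF w])
    fix f assume f: "f \<in> L2 M"
    have "inner_matrix \<mu> R (\<lambda>t. F (truncated_inverse N g) t - ?g t) (F f) = L2_inner M (truncated_inverse N g) f - inner_matrix \<mu> R ?g (F f)"
      using inner_diff[OF F_in[OF Pin] gin F_in[OF f]] F_inner[OF Pin f] by simp
    also have "\<dots> = 0" using truncated_inverse_duality[OF g f] by simp
    finally show "inner_matrix \<mu> R (F f) (\<lambda>t. F (truncated_inverse N g) t - ?g t) = 0"
      using ip_cnj[OF w F_in[OF f]] by simp
  qed
  then show ?thesis using eq_matrix_iff[OF F_in[OF Pin] gin] by simp
qed

text \<open>The inversion error is exactly the truncation error of \<open>g\<close>, so the limit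
  over real \<open>N\<close> is inherited from \<open>truncation_tendsto\<close>.\<close>

lemma truncated_inverse_norm_diff:
  assumes g: "g \<in> L2_matrix \<mu> R" and f: "f \<in> L2 M" "eq_matrix \<mu> R (F f) g"
  shows "L2_norm M (\<lambda>x. truncated_inverse N g x - f x) = mnorm \<mu> R (\<lambda>t. indicator {-N..<N} t *s g t - g t)"
proof -
  let ?g = "\<lambda>t. indicator {-N..<N} t *s g t"
  have gin: "?g \<in> L2_matrix \<mu> R" using g by (rule indicator_in) simp
  have Pin: "truncated_inverse N g \<in> L2 M" by (rule truncated_inverse_L2[OF g])
  have z: "mnorm \<mu> R (\<lambda>t. F (truncated_inverse N g) t - ?g t) = 0" "mnorm \<mu> R (\<lambda>t. F f t - g t) = 0"
    using F_truncated_inverse[OF g] f eq_matrix_iff[OF F_in[OF Pin] gin] eq_matrix_iff[OF F_in[OF f(1)] g] by auto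
  have "mnorm \<mu> R (\<lambda>t. F (truncated_inverse N g) t - F f t) \<le> mnorm \<mu> R (\<lambda>t. ?g t - g t)"
    using mnorm_triangle[OF F_in[OF Pin] gin F_in[OF f(1)]] mnorm_triangle[OF gin g F_in[OF f(1)]] z mnorm_commute[of "F f" g] by simp
  moreover have "mnorm \<mu> R (\<lambda>t. ?g t - g t) \<le> mnorm \<mu> R (\<lambda>t. F (truncated_inverse N g) t - F f t)"
    using mnorm_triangle[OF gin F_in[OF Pin] g] mnorm_triangle[OF F_in[OF Pin] F_in[OF f(1)] g] z mnorm_commute[of "F (truncated_inverse N g)" ?g] by simp
  ultimately show ?thesis using F_diff_norm[OF Pin f(1)] by simp
qed

lemma F_surj:
  assumes g: "g \<in> L2_matrix \<mu> R"
  obtains f where "f \<in> L2 M" "eq_matrix \<mu> R (F f) g"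
proof -
  define p where "p n = truncated_inverse (real n) g" for n
  let ?g = "\<lambda>n t. indicator {- real n..<real n} t *s g t"
  have gin: "?g n \<in> L2_matrix \<mu> R" for n using g by (rule indicator_in) simp
  have pin: "p n \<in> L2 M" for n unfolding p_def by (rule truncated_inverse_L2[OF g])
  have lim: "(\<lambda>n. mnorm \<mu> R (\<lambda>t. ?g n t - g t)) \<longlonglongrightarrow> 0"
    using filterlim_compose[OF truncation_tendsto[OF g] filterlim_real_sequentially] .
  have pg: "mnorm \<mu> R (\<lambda>t. F (p n) t - g t) \<le> mnorm \<mu> R (\<lambda>t. ?g n t - g t)" for n
    using mnorm_triangle[OF F_in[OF pin] gin g, of n n] F_truncated_inverse[OF g, of "real n"]
      eq_matrix_iff[OF F_in[OF pin] gin, of n n] by (simp add: p_def)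
  have "\<exists>N. \<forall>m\<ge>N. \<forall>n\<ge>N. L2_norm M (\<lambda>x. p m x - p n x) < e" if "e > 0" for e
  proof -
    have "\<forall>\<^sub>F n in sequentially. mnorm \<mu> R (\<lambda>t. ?g n t - g t) < e / 2" by (rule order_tendstoD(2)[OF lim half_gt_zero[OF \<open>e > 0\<close>]])
    then obtain N where N: "\<And>n. n \<ge> N \<Longrightarrow> mnorm \<mu> R (\<lambda>t. ?g n t - g t) < e / 2" unfolding eventually_sequentially by blast
    have "L2_norm M (\<lambda>x. p m x - p n x) < e" if "m \<ge> N" "n \<ge> N" for m n
      using mnorm_triangle[OF F_in[OF pin] g F_in[OF pin], of m n] pg[of m] pg[of n] N[OF that(1)] N[OF that(2)]
        F_diff_norm[OF pin pin, of m n] mnorm_commute[of "F (p n)" g] by simp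
    then show ?thesis by blast
  qed
  then obtain f where f: "f \<in> L2 M" "(\<lambda>n. L2_norm M (\<lambda>x. p n x - f x)) \<longlonglongrightarrow> 0"
    using L2_complete[of p M] pin by blast
  have "mnorm \<mu> R (\<lambda>t. F f t - g t) \<le> 0"
  proof (rule LIMSEQ_le_const)
    show "(\<lambda>n. L2_norm M (\<lambda>x. p n x - f x) + mnorm \<mu> R (\<lambda>t. ?g n t - g t)) \<longlonglongrightarrow> 0"
      using tendsto_add[OF f(2) lim] by simp
    have "mnorm \<mu> R (\<lambda>t. F f t - g t) \<le> L2_norm M (\<lambda>x. p n x - f x) + mnorm \<mu> R (\<lambda>t. ?g n t - g t)" for n
      using mnorm_triangle[OF F_in[OF f(1)] F_in[OF pin] g, of n] pg[of n] F_diff_norm[OF pin f(1), of n]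
        mnorm_commute[of "F f" "F (p n)"] by simp
    then show "\<exists>N. \<forall>n\<ge>N. mnorm \<mu> R (\<lambda>t. F f t - g t) \<le> L2_norm M (\<lambda>x. p n x - f x) + mnorm \<mu> R (\<lambda>t. ?g n t - g t)"
      by blast
  qed
  then have "mnorm \<mu> R (\<lambda>t. F f t - g t) = 0" using m_nonneg[OF diff_in[OF F_in[OF f(1)] g]] by simp
  then show ?thesis using that f(1) eq_matrix_iff[OF F_in[OF f(1)] g] by simp
qed

end

section \<open>Spectral representation\<close>

lemma matrix_form_diff:
  "matrix_form A (u - w) v = matrix_form A u v - matrix_form A w v"
  "matrix_form A v (u - w) = matrix_form A v u - matrix_form A v w"
  by (simp_all add: matrix_form_def sum_2 algebra_simps)

text \<open>A null vector of a semidefinite form lies in its radical, by Cauchy-Schwarz; hence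
  representatives of one element have the same form almost everywhere.\<close>

lemma psd_form_zero:
  assumes "psd A" "matrix_form A (u - w) (u - w) = 0"
  shows "matrix_form A u u = matrix_form A w w"
proof -
  have cs: "matrix_form A (u - w) v = 0" for v
    using psd_cauchy_schwarz[OF assms(1), of "u - w" v] assms(2) by simp
  then have "matrix_form A u v = matrix_form A w v" for v
    by (simp add: matrix_form_diff)
  moreover have "matrix_form A v (u - w) = 0" for v using matrix_form_cnj[OF assms(1), of v "u - w"] cs by simp
  then have "matrix_form A v u = matrix_form A v w" for v
    by (simp add: matrix_form_diff)
  ultimately show ?thesis by metis
qed

section \<open>Scalar spectral measures and multiplication by the variable\<close>

context sl_transform
begin

text \<open>Will turn out to be the density of the scalar spectral measure of \<open>f\<close> with
  respect to \<open>\<mu>\<close>.\<close>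

definition spectral_density :: "(real \<Rightarrow> complex) \<Rightarrow> real \<Rightarrow> real" where
  "spectral_density f t = Re (matrix_form (R t) (F f t) (F f t))"

lemma spectral_density_integrable: "f \<in> L2 M \<Longrightarrow> integrable \<mu> (spectral_density f)"
  unfolding spectral_density_def[abs_def] using form_integrable[OF F_in F_in] by (intro integrable_Re)

lemma spectral_density_nonneg: "AE t in \<mu>. 0 \<le> spectral_density f t"
  using R_psd by eventually_elim (simp add: spectral_density_def psd_def)

lemma form_eq_spectral_density: "AE t in \<mu>. matrix_form (R t) (F f t) (F f t) = of_real (spectral_density f t)"
  using R_psd unfolding spectral_density_def by eventually_elim (rule psd_matrix_form_real)

lemma E_countably_additive:
  assumes f: "f \<in> L2 M" and A: "\<And>k. A k \<in> sets borel" "disjoint_family A"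
  shows "(\<lambda>k. Re (L2_inner M (E (A k) f) f)) sums Re (L2_inner M (E (\<Union>k. A k) f) f)"
proof -
  let ?e = "\<lambda>k. E (A k) f" and ?u = "E (\<Union>k. A k) f"
  have e: "?e k \<in> L2 M" for k by (rule E_L2[OF f A(1)])
  have u: "?u \<in> L2 M" using A(1) by (intro E_L2[OF f]) auto
  have s: "(\<lambda>x. \<Sum>k<n. ?e k x) \<in> L2 M" for n using L2_norm_sum_le[of n ?e M] e by blast
  have "range A \<subseteq> sets borel" using A(1) by auto
  then have lim: "(\<lambda>n. L2_norm M (\<lambda>x. (\<Sum>k<n. ?e k x) - ?u x)) \<longlonglongrightarrow> 0"
    using pvm f A(2) unfolding projection_valued_measure_def by blast
  have "L2_inner M (\<lambda>x. \<Sum>k<n. ?e k x) f = (\<Sum>k<n. L2_inner M (?e k) f)" for n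
    unfolding L2_inner_def sum_distrib_right
    by (rule Bochner_Integration.integral_sum) (use L2_product_integrable[OF e f] in auto)
  then have "(\<lambda>n. \<Sum>k<n. L2_inner M (?e k) f) \<longlonglongrightarrow> L2_inner M ?u f"
    using L2_inner_tendsto(1)[OF f u s lim] by simp
  from tendsto_Re[OF this] show ?thesis unfolding sums_def by simp
qed

text \<open>Both sides are countably additive and agree on half-open intervals by
  \<open>E_inner\<close>. The total masses agree because \<open>E UNIV\<close> acts as the identity
  and \<open>F\<close> is isometric, which handles complements.\<close>

lemma scalar_measure_eq:
  assumes f: "f \<in> L2 M" and B: "B \<in> sets borel"
  shows "Re (L2_inner M (E B f) f) = (\<integral>t. indicator B t * spectral_density f t \<partial>\<mu>)"
proof -
  define s where "s B = Re (L2_inner M (E B f) f)" for B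
  define r where "r B = (\<integral>t. indicator B t * spectral_density f t \<partial>\<mu>)" for B
  let ?G = "range (\<lambda>(a, b). {a <.. b::real})"
  have ri: "integrable \<mu> (\<lambda>t. indicator B t * spectral_density f t)" if "B \<in> sets borel" for B
    using integrable_mult_indicator[OF _ spectral_density_integrable[OF f], of B] that sets_mu by simp
  have r_sums: "(\<lambda>k. r (A k)) sums r (\<Union>k. A k)" if A: "\<And>k. A k \<in> sets borel" "disjoint_family A" for A :: "nat \<Rightarrow> real set"
  proof -
    have q1: "integrable \<mu> (spectral_density f)" by (rule spectral_density_integrable[OF f])
    have ind: "(\<lambda>i. indicator (A i) t :: real) sums indicator (\<Union>k. A k) t" for t
      by (rule indicator_sums) (use A(2) in \<open>auto simp: disjoint_family_on_def\<close>)
    \<comment> \<open>Disjointness keeps the partial sums of indicators below 1, which gives the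
      absolute value of the density as dominating function.\<close>
    have le: "(\<Sum>k<n. indicator (A k) t :: real) \<le> 1" for n t
    proof -
      have "(\<Sum>k<n. indicator (A k) t :: real) \<le> (\<Sum>k. indicator (A k) t)"
        by (rule sum_le_suminf[OF sums_summable[OF ind]]) auto
      also have "\<dots> = indicator (\<Union>k. A k) t" by (rule sums_unique[OF ind, symmetric])
      also have "\<dots> \<le> 1" by (simp add: indicator_def)
      finally show ?thesis .
    qed
    have "(\<lambda>n. \<integral>t. (\<Sum>k<n. indicator (A k) t) * spectral_density f t \<partial>\<mu>) \<longlonglongrightarrow> r (\<Union>k. A k)"
      unfolding r_def
    proof (rule integral_dominated_convergence)
      show "integrable \<mu> (\<lambda>t. \<bar>spectral_density f t\<bar>)" using q1 by simp
      have "(\<Union>k. A k) \<in> sets borel" using A(1) by auto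
      from ri[OF this] show "(\<lambda>t. indicator (\<Union>k. A k) t * spectral_density f t) \<in> borel_measurable \<mu>" by simp
      show "(\<lambda>t. (\<Sum>k<n. indicator (A k) t) * spectral_density f t) \<in> borel_measurable \<mu>" for n
        unfolding sum_distrib_right using ri[OF A(1)] by (intro borel_measurable_sum) simp
      show "AE t in \<mu>. (\<lambda>n. (\<Sum>k<n. indicator (A k) t) * spectral_density f t) \<longlonglongrightarrow> indicator (\<Union>k. A k) t * spectral_density f t"
        using ind unfolding sums_def by (intro AE_I2 tendsto_mult_right) blast
      have "\<bar>(\<Sum>k<n. indicator (A k) t) * spectral_density f t\<bar> \<le> \<bar>spectral_density f t\<bar>" for n t
      proof -
        have "0 \<le> (\<Sum>k<n. indicator (A k) t :: real)" by (intro sum_nonneg) simp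
        then show ?thesis unfolding abs_mult using le[of t n] by (intro mult_left_le_one_le) auto
      qed
      then show "AE t in \<mu>. norm ((\<Sum>k<n. indicator (A k) t) * spectral_density f t) \<le> \<bar>spectral_density f t\<bar>" for n by simp
    qed
    moreover have "(\<integral>t. (\<Sum>k<n. indicator (A k) t) * spectral_density f t \<partial>\<mu>) = (\<Sum>k<n. r (A k))" for n
      unfolding r_def sum_distrib_right using ri[OF A(1)] by (intro Bochner_Integration.integral_sum)
    ultimately show ?thesis unfolding sums_def by simp
  qed
  have add: "r (A \<union> B) = r A + r B" if "A \<in> sets borel" "B \<in> sets borel" "A \<inter> B = {}" for A B
  proof -
    have "r (A \<union> B) = (\<integral>t. indicator A t * spectral_density f t + indicator B t * spectral_density f t \<partial>\<mu>)"
      unfolding r_def using that(3) by (intro Bochner_Integration.integral_cong) (auto simp: indicator_def)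
    then show ?thesis unfolding r_def using ri that by simp
  qed
  \<comment> \<open>Countable additivity applied to empty sets gives a summable constant sequence,
    so the constant is 0; finite additivity then follows by way of \<open>binaryset\<close>.\<close>
  have s_empty: "s {} = 0"
  proof -
    have "(\<lambda>k::nat. s {}) sums s {}" using E_countably_additive[OF f, of "\<lambda>_. {}"] by (simp add: s_def disjoint_family_on_def)
    then have "(\<lambda>k::nat. s {}) \<longlonglongrightarrow> 0" using sums_summable summable_LIMSEQ_zero by blast
    then show ?thesis by (simp add: LIMSEQ_const_iff)
  qed
  have s_add: "s (A \<union> B) = s A + s B" if "A \<in> sets borel" "B \<in> sets borel" "A \<inter> B = {}" for A B
  proof -
    have "(\<lambda>k. s (binaryset A B k)) sums s (\<Union>k. binaryset A B k)" unfolding s_def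
    proof (rule E_countably_additive[OF f])
      show "binaryset A B k \<in> sets borel" for k using that by (simp add: binaryset_def)
      show "disjoint_family (binaryset A B)" using that by (auto simp: disjoint_family_on_def binaryset_def)
    qed
    then show ?thesis using binaryset_sums[of s A B] s_empty by (simp add: UN_binaryset_eq sums_iff)
  qed
  have tot: "s UNIV = r UNIV"
  proof -
    have "L2_inner M (E UNIV f) f = L2_inner M f f"
    proof (rule L2_inner_cong_AE[OF E_L2[OF f] f _ f f])
      show "AE x in M. E UNIV f x = f x" using pvm f unfolding projection_valued_measure_def by blast
    qed auto
    also have "\<dots> = inner_matrix \<mu> R (F f) (F f)" using F_inner_self[OF f] by simp
    finally show ?thesis unfolding s_def r_def spectral_density_def inner_matrix_def
      using form_integrable[OF F_in[OF f] F_in[OF f]] by simp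
  qed
  have "s B = r B"
  proof (rule sigma_sets_induct_disjoint[where G="?G" and \<Omega>=UNIV and P="\<lambda>B. s B = r B"])
    show "B \<in> sigma_sets UNIV ?G" using B by (simp add: borel_sigma_sets_Ioc)
    show "Int_stable ?G" by (auto simp: Int_stable_def)
    show "?G \<subseteq> Pow UNIV" by auto
    show "s {} = r {}" using s_empty by (simp add: r_def)
  next
    fix A assume "A \<in> ?G"
    then obtain a b where A: "A = {a<..b}" by auto
    show "s A = r A"
    proof (cases "a < b")
      case True
      have "s A = Re (\<integral>t. indicator A t * matrix_form (R t) (F f t) (F f t) \<partial>\<mu>)"
        unfolding s_def A E_inner[OF f f True] inner_indicator ..
      also have "\<dots> = (\<integral>t. Re (indicator A t * matrix_form (R t) (F f t) (F f t)) \<partial>\<mu>)"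
      proof (rule integral_Re[symmetric])
        have "integrable \<mu> (\<lambda>t. matrix_form (R t) (indicator A t *s F f t) (F f t))"
          using F_in[OF f] by (intro form_integrable indicator_in) (auto simp: A)
        then show "integrable \<mu> (\<lambda>t. indicator A t * matrix_form (R t) (F f t) (F f t))" by (simp add: matrix_form_scale)
      qed
      also have "\<dots> = r A" unfolding r_def spectral_density_def
        by (intro Bochner_Integration.integral_cong) (auto simp: indicator_def)
      finally show ?thesis .
    qed (simp add: A s_empty r_def)
  next
    fix A assume A: "A \<in> sigma_sets UNIV ?G" "s A = r A"
    then have Ab: "A \<in> sets borel" by (simp add: borel_sigma_sets_Ioc)
    have "s (A \<union> (UNIV - A)) = r (A \<union> (UNIV - A))" using tot by simp
    then show "s (UNIV - A) = r (UNIV - A)" using add[of A "UNIV - A"] s_add[of A "UNIV - A"] Ab A by auto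
  next
    fix A :: "nat \<Rightarrow> real set" assume A: "disjoint_family A" "range A \<subseteq> sigma_sets UNIV ?G" "\<And>i. s (A i) = r (A i)"
    then have Ab: "A i \<in> sets borel" for i by (auto simp: borel_sigma_sets_Ioc)
    have "(\<lambda>k. s (A k)) sums s (\<Union>k. A k)" unfolding s_def by (rule E_countably_additive[OF f Ab A(1)])
    moreover have "(\<lambda>k. s (A k)) sums r (\<Union>k. A k)" unfolding A(3) by (rule r_sums[OF Ab A(1)])
    ultimately show "s (\<Union>i. A i) = r (\<Union>i. A i)" by (rule sums_unique2)
  qed
  then show ?thesis by (simp add: s_def r_def)
qed

text \<open>\<open>scalar_spectral_measure\<close> is made by \<open>measure_of\<close>, which takes
  over the values of a set function only if that is a measure; this is settled by recognising the
  set function as that of a density.\<close>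

lemma scalar_spectral_measure_eq:
  assumes f: "f \<in> L2 M"
  shows "scalar_spectral_measure M E f = density \<mu> (\<lambda>t. ennreal (spectral_density f t))"
proof -
  have qm: "spectral_density f \<in> borel_measurable \<mu>" using spectral_density_integrable[OF f] by simp
  let ?\<nu> = "density \<mu> (\<lambda>t. ennreal (spectral_density f t))"
  have "scalar_spectral_measure M E f = measure_of UNIV (sets borel) (emeasure ?\<nu>)"
    unfolding scalar_spectral_measure_def
  proof (rule measure_of_eq)
    fix B assume "B \<in> sigma_sets UNIV (sets (borel :: real measure))"
    then have B: "B \<in> sets borel" using sets.sigma_sets_eq[of "borel :: real measure"] by simp
    have i: "integrable \<mu> (\<lambda>t. indicator B t * spectral_density f t)"
      using integrable_mult_indicator[OF _ spectral_density_integrable[OF f], of B] B sets_mu by simp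
    have "emeasure ?\<nu> B = (\<integral>\<^sup>+t. ennreal (spectral_density f t) * indicator B t \<partial>\<mu>)"
      using qm B sets_mu by (intro emeasure_density) auto
    also have "\<dots> = (\<integral>\<^sup>+t. ennreal (indicator B t * spectral_density f t) \<partial>\<mu>)"
      by (intro nn_integral_cong) (auto simp: indicator_def)
    also have "\<dots> = ennreal (\<integral>t. indicator B t * spectral_density f t \<partial>\<mu>)"
      by (rule nn_integral_eq_integral[OF i]) (use spectral_density_nonneg[of f] in \<open>eventually_elim, auto simp: indicator_def\<close>)
    finally show "ennreal (Re (L2_inner M (E B f) f)) = emeasure ?\<nu> B" using scalar_measure_eq[OF f B] by simp
  qed auto
  also have "\<dots> = ?\<nu>" using measure_of_of_measure[of ?\<nu>] sets_mu space_mu by simp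
  finally show ?thesis .
qed

abbreviation mult :: "(real \<Rightarrow> complex^2) \<Rightarrow> real \<Rightarrow> complex^2" where
  "mult g \<equiv> (\<lambda>t. of_real t *s g t)"

lemma mult_measurable: "g \<in> borel_measurable \<mu> \<Longrightarrow> mult g \<in> borel_measurable \<mu>"
proof -
  assume g: "g \<in> borel_measurable \<mu>"
  have "(\<lambda>t. complex_of_real t) \<in> borel_measurable borel" by simp
  then have "(\<lambda>t. complex_of_real t) \<in> borel_measurable \<mu>" using measurable_cong_sets[OF sets_mu refl] by blast
  from comb_measurable[OF g g this borel_measurable_const[of 0]] show "mult g \<in> borel_measurable \<mu>" by simp
qed

text \<open>This matches the two domains: multiplication by \<open>t\<close> scales the form by its
  square, which turns the spectral density into the integrand of the second moment.\<close>

lemma mult_in_iff: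
  assumes f: "f \<in> L2 M"
  shows "mult (F f) \<in> L2_matrix \<mu> R \<longleftrightarrow> integrable (scalar_spectral_measure M E f) (\<lambda>t. t\<^sup>2)"
proof -
  have Fm: "F f \<in> borel_measurable \<mu>" using F_in[OF f] by (simp add: L2_matrix_def)
  have qm: "spectral_density f \<in> borel_measurable \<mu>" using spectral_density_integrable[OF f] by simp
  have "(\<lambda>t::real. t\<^sup>2) \<in> borel_measurable borel" by simp
  then have tm: "(\<lambda>t::real. t\<^sup>2) \<in> borel_measurable \<mu>" using measurable_cong_sets[OF sets_mu refl] by blast
  from measurable_compose[OF borel_measurable_scaleR[OF qm tm], of complex_of_real borel]
  have rm: "(\<lambda>t. complex_of_real (spectral_density f t *\<^sub>R t\<^sup>2)) \<in> borel_measurable \<mu>" by simp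
  have mm: "(\<lambda>t. matrix_form (R t) (mult (F f) t) (mult (F f) t)) \<in> borel_measurable \<mu>"
    using mult_measurable[OF Fm] by (intro form_measurable)
  have ae: "AE t in \<mu>. matrix_form (R t) (mult (F f) t) (mult (F f) t) = of_real (spectral_density f t *\<^sub>R t\<^sup>2)"
    using form_eq_spectral_density[of f]
    by eventually_elim (simp add: matrix_form_scale matrix_form_scale_right power2_eq_square)
  have "integrable (scalar_spectral_measure M E f) (\<lambda>t. t\<^sup>2) \<longleftrightarrow> integrable \<mu> (\<lambda>t. spectral_density f t *\<^sub>R t\<^sup>2)"
    unfolding scalar_spectral_measure_eq[OF f] by (rule integrable_density[OF tm qm spectral_density_nonneg])
  also have "\<dots> \<longleftrightarrow> integrable \<mu> (\<lambda>t. complex_of_real (spectral_density f t *\<^sub>R t\<^sup>2))"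
    by (rule complex_of_real_integrable_eq[symmetric])
  also have "\<dots> \<longleftrightarrow> integrable \<mu> (\<lambda>t. matrix_form (R t) (mult (F f) t) (mult (F f) t))"
    by (intro integrable_cong_AE rm mm) (use ae in \<open>eventually_elim, simp\<close>)
  finally show ?thesis using mult_measurable[OF Fm] by (simp add: L2_matrix_def)
qed

lemma mult_inner:
  assumes f: "f \<in> L2 M"
  shows "inner_matrix \<mu> R (mult (F f)) (F f) = of_real (\<integral>t. t \<partial>scalar_spectral_measure M E f)"
proof -
  have qm: "spectral_density f \<in> borel_measurable \<mu>" using spectral_density_integrable[OF f] by simp
  have "(\<lambda>t::real. t) \<in> borel_measurable borel" by simp
  then have tm: "(\<lambda>t::real. t) \<in> borel_measurable \<mu>" using measurable_cong_sets[OF sets_mu refl] by blast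
  have Fm: "F f \<in> borel_measurable \<mu>" using F_in[OF f] by (simp add: L2_matrix_def)
  have "inner_matrix \<mu> R (mult (F f)) (F f) = (\<integral>t. complex_of_real (spectral_density f t *\<^sub>R t) \<partial>\<mu>)"
    unfolding inner_matrix_def
  proof (rule integral_cong_AE)
    show "AE t in \<mu>. matrix_form (R t) (mult (F f) t) (F f t) = complex_of_real (spectral_density f t *\<^sub>R t)"
      using form_eq_spectral_density[of f] by eventually_elim (simp add: matrix_form_scale)
    show "(\<lambda>t. matrix_form (R t) (mult (F f) t) (F f t)) \<in> borel_measurable \<mu>"
      using mult_measurable[OF Fm] Fm by (intro form_measurable)
    show "(\<lambda>t. complex_of_real (spectral_density f t *\<^sub>R t)) \<in> borel_measurable \<mu>" using qm tm by simp
  qed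
  also have "\<dots> = of_real (\<integral>t. spectral_density f t *\<^sub>R t \<partial>\<mu>)" by (rule integral_complex_of_real)
  also have "(\<integral>t. spectral_density f t *\<^sub>R t \<partial>\<mu>) = (\<integral>t. t \<partial>scalar_spectral_measure M E f)"
    unfolding scalar_spectral_measure_eq[OF f] by (rule integral_density[OF tm qm spectral_density_nonneg, symmetric])
  finally show ?thesis .
qed

lemma mult_comb_eq:
  assumes f: "f \<in> L2 M" and g: "g \<in> L2 M"
  shows "eq_matrix \<mu> R (mult (F (\<lambda>x. a * f x + b * g x))) (\<lambda>t. a *s mult (F f) t + b *s mult (F g) t)"
  using F_comb[OF f g, of a b] unfolding eq_matrix_def
proof eventually_elim
  case (elim t)
  have "mult (F (\<lambda>x. a * f x + b * g x)) t - (a *s mult (F f) t + b *s mult (F g) t)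
    = of_real t *s (F (\<lambda>x. a * f x + b * g x) t - (a *s F f t + b *s F g t))"
    by (simp add: vec_eq_iff algebra_simps)
  then show ?case using elim by (simp only: matrix_form_scale matrix_form_scale_right mult_zero_right)
qed

text \<open>\<open>mult_id\<close> supplies only some representative \<open>k\<close> of the
  product; this transfers square integrability to the pointwise product.\<close>

lemma mult_in_if_eq:
  assumes f: "f \<in> L2 M" and k: "k \<in> L2_matrix \<mu> R" "eq_matrix \<mu> R k (mult (F f))"
  shows "mult (F f) \<in> L2_matrix \<mu> R"
proof -
  have Fm: "mult (F f) \<in> borel_measurable \<mu>" using F_in[OF f] by (intro mult_measurable) (simp add: L2_matrix_def)
  have "integrable \<mu> (\<lambda>t. matrix_form (R t) (mult (F f) t) (mult (F f) t))"
  proof (rule Bochner_Integration.integrable_cong_AE_imp[OF form_integrable[OF k(1) k(1)] form_measurable[OF Fm Fm]])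
    show "AE t in \<mu>. matrix_form (R t) (k t) (k t) = matrix_form (R t) (mult (F f) t) (mult (F f) t)"
      using k(2) R_psd unfolding eq_matrix_def by eventually_elim (rule psd_form_zero)
  qed
  then show ?thesis using Fm by (simp add: L2_matrix_def)
qed

lemma orthogonal_dense_zero:
  assumes dense: "densely_defined M S" and S: "Domain S \<subseteq> L2 M" and e: "e \<in> L2 M"
    and orth: "\<And>g. g \<in> Domain S \<Longrightarrow> L2_inner M e g = 0"
  shows "AE x in M. e x = 0"
proof -
  have "L2_norm M e \<le> 0"
  proof (rule field_le_epsilon)
    fix \<epsilon> :: real assume "\<epsilon> > 0"
    then obtain g where g: "g \<in> Domain S" "L2_norm M (\<lambda>x. e x - g x) < \<epsilon>"
      using dense e unfolding densely_defined_def by blast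
    then have gL: "g \<in> L2 M" using S by blast
    have "L2_inner M e e = L2_inner M e (\<lambda>x. e x - g x)"
      using L2.ip_comb_right[OF e gL e, of 1 "-1"] orth[OF g(1)] by simp
    then have "(L2_norm M e)\<^sup>2 = cmod (L2_inner M e (\<lambda>x. e x - g x))"
      unfolding L2_inner_self by (metis norm_of_real abs_power2)
    also have "\<dots> \<le> L2_norm M e * L2_norm M (\<lambda>x. e x - g x)" by (rule L2_cauchy_schwarz[OF e L2_diff[OF e gL]])
    also have "\<dots> \<le> L2_norm M e * \<epsilon>" using g(2) by (intro mult_left_mono) (auto simp: L2_norm_nonneg)
    finally have "L2_norm M e * L2_norm M e \<le> L2_norm M e * \<epsilon>" by (simp add: power2_eq_square)
    then show "L2_norm M e \<le> 0 + \<epsilon>" using L2_norm_nonneg[of M e] \<open>\<epsilon> > 0\<close>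
      by (cases "L2_norm M e = 0") (auto simp: mult_le_cancel_left)
  qed
  then show ?thesis using L2_norm_eq_0_AE[OF e] L2_norm_nonneg[of M e] by simp
qed

text \<open>\<open>spectral_measure_of\<close> gives \<open>S\<close> by domain and quadratic form.
  Polarization inside the graph yields equal pairings against the domain, and density of the domain
  then identifies the values of the two operators.\<close>

theorem spectral_representation:
  assumes sa: "self_adjoint_operator M S" and sp: "spectral_measure_of M S E"
  shows "S = {(f, h). f \<in> L2 M \<and>
         (\<exists>k. (F f, k) \<in> mult_id \<mu> R \<and> (k, h) \<in> adjoint_transform M \<mu> R F)}" (is "S = ?T")
proof -
  have dense: "densely_defined M S" and S_adj: "S = adjoint_operator M S"
    using sa by (auto simp: self_adjoint_operator_def)
  have dom: "Domain S = {f \<in> L2 M. integrable (scalar_spectral_measure M E f) (\<lambda>t. t\<^sup>2)}"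
    and quad: "\<And>f h. (f, h) \<in> S \<Longrightarrow> L2_inner M h f = of_real (\<integral>t. t \<partial>scalar_spectral_measure M E f)"
    using sp by (auto simp: spectral_measure_of_def)
  have S_iff: "(g, k) \<in> S \<longleftrightarrow> g \<in> L2 M \<and> k \<in> L2 M \<and> (\<forall>(f, h)\<in>S. L2_inner M h g = L2_inner M f k)" for g k
    by (subst S_adj) (simp add: adjoint_operator_def)
  have SL: "f \<in> L2 M" "h \<in> L2 M" if "(f, h) \<in> S" for f h using that S_iff[of f h] by blast+
  have DL: "Domain S \<subseteq> L2 M" using SL by blast
  \<comment> \<open>Being its own adjoint makes the graph linear, and likewise closed under changes
    of the value on null sets; both are read off the defining relation.\<close>
  have S_comb: "((\<lambda>x. a * f x + b * g x), (\<lambda>x. a * h x + b * k x)) \<in> S" if fh: "(f, h) \<in> S" and gk: "(g, k) \<in> S" for f h g k a b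
    unfolding S_iff
  proof (intro conjI ballI, goal_cases)
    case 1 show ?case using SL[OF fh] SL[OF gk] by (intro L2_comb)
  next
    case 2 show ?case using SL[OF fh] SL[OF gk] by (intro L2_comb)
  next
    case (3 p)
    obtain u y where p: "p = (u, y)" by (cases p)
    have uy: "(u, y) \<in> S" using 3 p by simp
    have "L2_inner M y f = L2_inner M u h" "L2_inner M y g = L2_inner M u k"
      using fh gk uy unfolding S_iff[of f h] S_iff[of g k] by blast+
    then show ?case unfolding p
      using L2.ip_comb_right[OF SL(1)[OF fh] SL(1)[OF gk] SL(2)[OF uy], of a b]
        L2.ip_comb_right[OF SL(2)[OF fh] SL(2)[OF gk] SL(1)[OF uy], of a b] by simp
  qed
  have S_cong: "(f, h') \<in> S" if fh: "(f, h) \<in> S" and h': "h' \<in> L2 M" "AE x in M. h x = h' x" for f h h'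
    unfolding S_iff
  proof (intro conjI ballI, goal_cases)
    case (3 p)
    obtain u y where p: "p = (u, y)" by (cases p)
    have uy: "(u, y) \<in> S" using 3 p by simp
    have "L2_inner M y f = L2_inner M u h" using fh uy unfolding S_iff[of f h] by blast
    also have "\<dots> = L2_inner M u h'"
      using SL[OF uy] SL[OF fh] h' by (intro L2_inner_cong_AE) auto
    finally show ?case by (simp add: p)
  qed (use SL[OF fh] h' in auto)
  have multS: "mult (F f) \<in> L2_matrix \<mu> R" if "(f, h) \<in> S" for f h
  proof -
    have "f \<in> Domain S" using that by blast
    then show ?thesis unfolding dom using mult_in_iff by simp
  qed
  have ex: "\<exists>y. y \<in> L2 M \<and> eq_matrix \<mu> R (F y) (mult (F f))" if "(f, h) \<in> S" for f h
    using F_surj[OF multS[OF that]] by blast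
  \<comment> \<open>\<open>y\<close> is the candidate for the value of \<open>S\<close> at
    \<open>f\<close>, a preimage of the product of \<open>F f\<close> with the variable; it pairs
    with the domain exactly as \<open>h\<close> does.\<close>
  have key: "L2_inner M h g = L2_inner M y g"
    if fh: "(f, h) \<in> S" and gk: "(g, k) \<in> S" and y: "y \<in> L2 M" "eq_matrix \<mu> R (F y) (mult (F f))" for f h g k y
  proof -
    obtain z where z: "z \<in> L2 M" "eq_matrix \<mu> R (F z) (mult (F g))" using ex[OF gk] by blast
    note fL = SL[OF fh] and gL = SL[OF gk]
    define A where "A = L2_inner M h g - L2_inner M y g"
    define B where "B = L2_inner M k f - L2_inner M z f"
    \<comment> \<open>Stated for fresh arguments because it is applied to \<open>f\<close>, to
      \<open>g\<close> and to their combination.\<close>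
    have diag: "L2_inner M h f = L2_inner M y f" if fh: "(f, h) \<in> S" and y: "y \<in> L2 M" "eq_matrix \<mu> R (F y) (mult (F f))" for f h y
    proof -
      have f: "f \<in> L2 M" using SL[OF fh] by simp
      have "L2_inner M y f = inner_matrix \<mu> R (F y) (F f)" using F_inner[OF y(1) f] by simp
      also have "\<dots> = inner_matrix \<mu> R (mult (F f)) (F f)"
        by (rule inner_cong(1)[OF F_in[OF y(1)] multS[OF fh] y(2) F_in[OF f]])
      finally show ?thesis using quad[OF fh] mult_inner[OF f] by simp
    qed
    have "cnj c * A + c * B = 0" for c
    proof -
      let ?f = "\<lambda>x. 1 * f x + c * g x" and ?h = "\<lambda>x. 1 * h x + c * k x" and ?y = "\<lambda>x. 1 * y x + c * z x"
      have s: "(?f, ?h) \<in> S" by (rule S_comb[OF fh gk])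
      have yL: "?y \<in> L2 M" using y(1) z(1) by (rule L2_comb)
      let ?m = "\<lambda>t. 1 *s mult (F f) t + c *s mult (F g) t"
      have mL: "?m \<in> L2_matrix \<mu> R" using multS[OF fh] multS[OF gk] by (rule comb_in)
      have "eq_matrix \<mu> R (F ?y) ?m"
      proof (rule eq_matrix_trans[OF F_in[OF yL] comb_in[OF F_in[OF y(1)] F_in[OF z(1)], of 1 c] mL F_comb[OF y(1) z(1)]])
        show "eq_matrix \<mu> R (\<lambda>t. 1 *s F y t + c *s F z t) ?m"
        proof -
          have "mnorm \<mu> R (\<lambda>t. 1 *s (F y t - mult (F f) t) + c *s (F z t - mult (F g) t)) \<le>
              cmod 1 * mnorm \<mu> R (\<lambda>t. F y t - mult (F f) t) + cmod c * mnorm \<mu> R (\<lambda>t. F z t - mult (F g) t)"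
            by (rule m_comb_le[OF diff_in[OF F_in[OF y(1)] multS[OF fh]] diff_in[OF F_in[OF z(1)] multS[OF gk]]])
          also have "\<dots> = 0" using y z eq_matrix_iff[OF F_in[OF y(1)] multS[OF fh]] eq_matrix_iff[OF F_in[OF z(1)] multS[OF gk]] by simp
          finally have le: "mnorm \<mu> R (\<lambda>t. 1 *s (F y t - mult (F f) t) + c *s (F z t - mult (F g) t)) \<le> 0" .
          have eq: "(\<lambda>t. 1 *s (F y t - mult (F f) t) + c *s (F z t - mult (F g) t)) = (\<lambda>t. (1 *s F y t + c *s F z t) - ?m t)"
            by (intro ext) (simp add: vec_eq_iff algebra_simps)
          have cL: "(\<lambda>t. 1 *s F y t + c *s F z t) \<in> L2_matrix \<mu> R" by (rule comb_in[OF F_in[OF y(1)] F_in[OF z(1)]])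
          have "mnorm \<mu> R (\<lambda>t. (1 *s F y t + c *s F z t) - ?m t) = 0"
            using le[unfolded eq] m_nonneg[OF diff_in[OF cL mL]] by (rule antisym)
          then show ?thesis using eq_matrix_iff[OF cL mL] by blast
        qed
      qed
      moreover have "eq_matrix \<mu> R ?m (mult (F ?f))"
        by (rule eq_matrix_sym[OF mult_comb_eq[OF fL(1) gL(1)]])
      ultimately have "eq_matrix \<mu> R (F ?y) (mult (F ?f))"
        by (rule eq_matrix_trans[OF F_in[OF yL] mL multS[OF s]])
      from diag[OF s yL this] have e: "L2_inner M ?h ?f = L2_inner M ?y ?f" .
      have fin: "?f \<in> L2 M" using SL[OF s] by simp
      have "L2_inner M ?h ?f = L2_inner M h f + cnj c * L2_inner M h g + c * L2_inner M k f + c * cnj c * L2_inner M k g"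
        unfolding L2.ip_comb[OF fL(2) gL(2) fin] L2.ip_comb_right[OF fL(1) gL(1) fL(2)] L2.ip_comb_right[OF fL(1) gL(1) gL(2)]
        by (simp add: algebra_simps)
      moreover have "L2_inner M ?y ?f = L2_inner M y f + cnj c * L2_inner M y g + c * L2_inner M z f + c * cnj c * L2_inner M z g"
        unfolding L2.ip_comb[OF y(1) z(1) fin] L2.ip_comb_right[OF fL(1) gL(1) y(1)] L2.ip_comb_right[OF fL(1) gL(1) z(1)]
        by (simp add: algebra_simps)
      \<comment> \<open>The pure terms cancel by \<open>diag\<close> at \<open>f\<close> and at
        \<open>g\<close>, which leaves the hypothesis of \<open>polarization_zero\<close>.\<close>
      ultimately have "cnj c * L2_inner M h g + c * L2_inner M k f = cnj c * L2_inner M y g + c * L2_inner M z f"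
        using e diag[OF fh y] diag[OF gk z] by simp
      then show ?thesis by (simp add: A_def B_def algebra_simps)
    qed
    then have "A = 0" by (rule polarization_zero)
    then show ?thesis by (simp add: A_def)
  qed
  have rep: "AE x in M. h x = y x" if fh: "(f, h) \<in> S" and y: "y \<in> L2 M" "eq_matrix \<mu> R (F y) (mult (F f))" for f h y
  proof -
    have "AE x in M. h x - y x = 0"
    proof (rule orthogonal_dense_zero[OF dense DL L2_diff[OF SL(2)[OF fh] y(1)]])
      fix g assume "g \<in> Domain S"
      then obtain k where gk: "(g, k) \<in> S" by blast
      show "L2_inner M (\<lambda>x. h x - y x) g = 0"
        using L2_inner_diff_left[OF SL(2)[OF fh] y(1) SL(1)[OF gk]] key[OF fh gk y] by simp
    qed
    then show ?thesis by simp
  qed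
  have fwd: "inner_matrix \<mu> R (F u) (mult (F f)) = L2_inner M u h" if fh: "(f, h) \<in> S" and u: "u \<in> L2 M" for f h u
  proof -
    obtain y where y: "y \<in> L2 M" "eq_matrix \<mu> R (F y) (mult (F f))" using ex[OF fh] by blast
    have "inner_matrix \<mu> R (F u) (mult (F f)) = inner_matrix \<mu> R (F u) (F y)"
      using inner_cong(2)[OF F_in[OF y(1)] multS[OF fh] y(2) F_in[OF u]] by simp
    also have "\<dots> = L2_inner M u y" by (rule F_inner[OF u y(1)])
    also have "\<dots> = L2_inner M u h"
      using rep[OF fh y] SL[OF fh] u y(1) by (intro L2_inner_cong_AE) (auto elim: eventually_mono)
    finally show ?thesis .
  qed
  have refl: "eq_matrix \<mu> R k k" for k by (simp add: eq_matrix_def matrix_form_def)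
  have sub1: "(f, h) \<in> ?T" if fh: "(f, h) \<in> S" for f h
  proof -
    have "(F f, mult (F f)) \<in> mult_id \<mu> R"
      using F_in[OF SL(1)[OF fh]] multS[OF fh] refl by (simp add: mult_id_def)
    moreover have "(mult (F f), h) \<in> adjoint_transform M \<mu> R F"
      using multS[OF fh] SL[OF fh] fwd[OF fh] by (simp add: adjoint_transform_def)
    ultimately show ?thesis using SL(1)[OF fh] by blast
  qed
  \<comment> \<open>Membership in \<open>?T\<close> puts \<open>f\<close> into the domain of
    \<open>S\<close>; its value \<open>h0\<close> there has the same pairings as \<open>h\<close>,
    and the graph tolerates changes on null sets.\<close>
  have sub2: "(f, h) \<in> S" if fhT: "(f, h) \<in> ?T" for f h
  proof -
    obtain k where f: "f \<in> L2 M" and kh: "(F f, k) \<in> mult_id \<mu> R" "(k, h) \<in> adjoint_transform M \<mu> R F"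
      using fhT by blast
    have k: "k \<in> L2_matrix \<mu> R" "eq_matrix \<mu> R k (mult (F f))" using kh(1) by (simp_all add: mult_id_def)
    have h: "h \<in> L2 M" "\<And>u. u \<in> L2 M \<Longrightarrow> inner_matrix \<mu> R (F u) k = L2_inner M u h"
      using kh(2) by (simp_all add: adjoint_transform_def)
    have mf: "mult (F f) \<in> L2_matrix \<mu> R" by (rule mult_in_if_eq[OF f k])
    then have "f \<in> Domain S" unfolding dom using f mult_in_iff[OF f] by simp
    then obtain h0 where h0: "(f, h0) \<in> S" by blast
    have "L2_inner M (\<lambda>x. h0 x - h x) u = 0" if u: "u \<in> L2 M" for u
    proof -
      have "L2_inner M u h0 = L2_inner M u h"
        using fwd[OF h0 u] h(2)[OF u] inner_cong(2)[OF k(1) mf k(2) F_in[OF u]] by simp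
      then show ?thesis
        using L2_inner_diff_left[OF SL(2)[OF h0] h(1) u] L2.ip_cnj[OF u SL(2)[OF h0]] L2.ip_cnj[OF u h(1)] by simp
    qed
    then have "AE x in M. h0 x - h x = 0"
      using DL by (intro orthogonal_dense_zero[OF dense DL L2_diff[OF SL(2)[OF h0] h(1)]]) blast
    then show ?thesis by (intro S_cong[OF h0 h(1)]) simp
  qed
  show ?thesis by (intro equalityI subrelI; erule sub1 sub2)
qed

end

section \<open>From the Sturm-Liouville data to the abstract transform\<close>

theorem theorem10p2:
  fixes L :: sturm_liouville
    and v :: "endpoint \<Rightarrow> real \<Rightarrow> complex"
    and x0 \<phi>a :: real
    and \<theta> \<phi> :: "complex \<Rightarrow> real \<Rightarrow> complex"
    and mminus mplus :: "complex \<Rightarrow> complex"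
    and \<Omega> :: "real set \<Rightarrow> complex^2^2"
    and \<mu> :: "real measure"
    and R :: "real \<Rightarrow> complex^2^2"
    and E :: "real set \<Rightarrow> (real \<Rightarrow> complex) \<Rightarrow> (real \<Rightarrow> complex)"
    and F :: "(real \<Rightarrow> complex) \<Rightarrow> (real \<Rightarrow> complex^2)"
  assumes "sl_coefficients L"
    and "boundary_functions L v"
    and "self_adjoint_operator (weight_measure L) (operator_S L v)"
    and "x0 \<in> dom_int L"
    and "0 \<le> \<phi>a" "\<phi>a < pi"
    and "fundamental_system L x0 \<phi>a \<theta> \<phi>"
    and "weyl_functions L v \<theta> \<phi> mminus mplus"
    and "matrix_measure \<Omega>"
    and "stieltjes_inversion (weyl_matrix mminus mplus) \<Omega>"
    and "trace_and_density \<Omega> \<mu> R"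
    and "spectral_measure_of (weight_measure L) (operator_S L v) E"
    and "\<And>f g t1 t2. \<lbrakk>f \<in> L2 (weight_measure L); compactly_supported L f;
           g \<in> L2 (weight_measure L); compactly_supported L g; t1 < t2\<rbrakk> \<Longrightarrow>
           L2_inner (weight_measure L) (E {t1<..t2} f) g =
           inner_matrix \<mu> R (\<lambda>t. indicator {t1<..t2} t *s transform L \<theta> \<phi> f t)
             (transform L \<theta> \<phi> g)"
    and "isometric_extension L \<theta> \<phi> \<mu> R F"
  shows "unitary (weight_measure L) \<mu> R F \<and>
    (\<forall>g\<in>L2_matrix \<mu> R. \<forall>f\<in>L2 (weight_measure L). eq_matrix \<mu> R (F f) g \<longrightarrow>
       (\<forall>N. \<forall>x\<in>dom_int L. set_integrable \<mu> {-N..<N} (inversion_integrand \<theta> \<phi> R g x)) \<and>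
       (\<forall>N. (\<lambda>x. LINT t:{-N..<N}|\<mu>. inversion_integrand \<theta> \<phi> R g x t) \<in> L2 (weight_measure L)) \<and>
       ((\<lambda>N. L2_norm (weight_measure L)
              (\<lambda>x. (LINT t:{-N..<N}|\<mu>. inversion_integrand \<theta> \<phi> R g x t) - f x))
          \<longlongrightarrow> 0) at_top) \<and>
    operator_S L v =
      {(f, h). f \<in> L2 (weight_measure L) \<and>
         (\<exists>k. (F f, k) \<in> mult_id \<mu> R \<and> (k, h) \<in> adjoint_transform (weight_measure L) \<mu> R F)}"
proof -
  let ?I = "dom_int L" and ?M = "weight_measure L"
  note coef = assms(1) and x0 = assms(4)
  define \<theta>1 where "\<theta>1 z = quasi_deriv L (\<theta> z)" for z
  define \<phi>1 where "\<phi>1 z = quasi_deriv L (\<phi> z)" for z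
  have init: "\<theta> z x0 = of_real (cos \<phi>a)" "\<phi>1 z x0 = of_real (cos \<phi>a)"
    "\<theta>1 z x0 = - of_real (sin \<phi>a)" "\<phi> z x0 = of_real (sin \<phi>a)" for z
  proof -
    have *: "\<theta> z x0 = of_real (cos \<phi>a)" "quasi_deriv L (\<phi> z) x0 = of_real (cos \<phi>a)"
      "- quasi_deriv L (\<theta> z) x0 = of_real (sin \<phi>a)" "\<phi> z x0 = of_real (sin \<phi>a)"
      using assms(7) unfolding fundamental_system_def by blast+
    show "\<theta> z x0 = of_real (cos \<phi>a)" "\<phi>1 z x0 = of_real (cos \<phi>a)" "\<phi> z x0 = of_real (sin \<phi>a)"
      using * by (simp_all add: \<phi>1_def)
    show "\<theta>1 z x0 = - of_real (sin \<phi>a)" using *(3) by (simp add: \<theta>1_def minus_equation_iff)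
  qed
  have sys: "sl_system L z (\<theta> z) (\<theta>1 z)" "sl_system L z (\<phi> z) (\<phi>1 z)" for z
    unfolding \<theta>1_def \<phi>1_def using assms(7)
    by (auto simp: fundamental_system_def intro: is_solution_imp_sl_system[OF coef])
  \<comment> \<open>The transform evaluates the solutions at real parameters, so joint continuity is
    restricted to the real line.\<close>
  have cont: "continuous_on (?I \<times> UNIV) (\<lambda>(x,t::real). w (of_real t) x)"
    if "continuous_on (?I \<times> UNIV) (\<lambda>(x,z). w z x)" for w :: "complex \<Rightarrow> real \<Rightarrow> complex"
  proof -
    have "continuous_on (?I \<times> (UNIV :: real set)) (\<lambda>p. (fst p, complex_of_real (snd p)))"
      "(\<lambda>p. (fst p, complex_of_real (snd p))) ` (?I \<times> UNIV) \<subseteq> ?I \<times> UNIV"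
      by (auto intro!: continuous_intros)
    from continuous_on_compose2[OF that this] show ?thesis by (simp add: split_def)
  qed
  have iso: "isometric ?M \<mu> R F" using assms(14) by (simp add: isometric_extension_def)
  have tr: "sets \<mu> = sets borel" "R \<in> borel_measurable \<mu>"
    "\<And>B. B \<in> sets borel \<Longrightarrow> bounded B \<Longrightarrow> emeasure \<mu> B = ennreal (Re (trace (\<Omega> B)))"
    "\<And>B. B \<in> sets borel \<Longrightarrow> bounded B \<Longrightarrow> set_integrable \<mu> B R"
    using assms(11) unfolding trace_and_density_def by blast+
  interpret sl_transform L \<mu> R F \<theta> \<phi> E
  proof
    show "sets \<mu> = sets borel" "R \<in> borel_measurable \<mu>" by (fact tr)+
    show "AE t in \<mu>. psd (R t)" by (rule AE_psd[OF assms(9,11)])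
    show "isometric ?M \<mu> R F" by (fact iso)
    show "sl_coefficients L" by (fact coef)
    show "continuous_on (?I \<times> UNIV) (\<lambda>(x,t::real). \<theta> (of_real t) x)"
      by (rule cont[OF sl_system_jointly_continuous[OF coef sys(1) x0 init(1,3)]])
    show "continuous_on (?I \<times> UNIV) (\<lambda>(x,t::real). \<phi> (of_real t) x)"
      by (rule cont[OF sl_system_jointly_continuous[OF coef sys(2) x0 init(4,2)]])
    \<comment> \<open>For real \<open>t\<close> the conjugate solves the same equation with the same
      real data at \<open>x0\<close>.\<close>
    show "cnj (\<theta> (of_real t) x) = \<theta> (of_real t) x" if "x \<in> ?I" for x t
      using sl_system_unique[OF coef sl_system_cnj[OF sys(1), of "of_real t", simplified] sys(1) x0 _ _ that] init by simp
    show "cnj (\<phi> (of_real t) x) = \<phi> (of_real t) x" if "x \<in> ?I" for x t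
      using sl_system_unique[OF coef sl_system_cnj[OF sys(2), of "of_real t", simplified] sys(2) x0 _ _ that] init by simp
    show "a = 0 \<and> b = 0" if z: "\<And>x. x \<in> ?I \<Longrightarrow> a * \<theta> (of_real t) x + b * \<phi> (of_real t) x = 0" for t a b
    proof -
      \<comment> \<open>The vanishing combination and its quasi-derivative at \<open>x0\<close> give
        two linear equations whose determinant is the sum of the squares of sine and cosine; the
        identities below are Cramer's rule.\<close>
      have "a * \<theta>1 (of_real t) x0 + b * \<phi>1 (of_real t) x0 = 0"
        by (rule sl_system_zero_quasi_deriv[OF coef sl_system_lincomb[OF sys(1) sys(2)] z x0])
      then have e1: "- a * of_real (sin \<phi>a) + b * of_real (cos \<phi>a) = 0" by (simp add: init)
      have e2: "a * of_real (cos \<phi>a) + b * of_real (sin \<phi>a) = 0" using z[OF x0] by (simp add: init)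
      have sc: "of_real (sin \<phi>a) * of_real (sin \<phi>a) + of_real (cos \<phi>a) * of_real (cos \<phi>a) = (1::complex)"
        by (metis of_real_1 of_real_add of_real_mult power2_eq_square sin_cos_squared_add)
      have "a * (of_real (sin \<phi>a) * of_real (sin \<phi>a) + of_real (cos \<phi>a) * of_real (cos \<phi>a)) =
        of_real (cos \<phi>a) * (a * of_real (cos \<phi>a) + b * of_real (sin \<phi>a)) - of_real (sin \<phi>a) * (- a * of_real (sin \<phi>a) + b * of_real (cos \<phi>a))"
        by (simp add: algebra_simps)
      then have "a = 0" unfolding e1 e2 sc by simp
      have "b * (of_real (sin \<phi>a) * of_real (sin \<phi>a) + of_real (cos \<phi>a) * of_real (cos \<phi>a)) =
        of_real (sin \<phi>a) * (a * of_real (cos \<phi>a) + b * of_real (sin \<phi>a)) + of_real (cos \<phi>a) * (- a * of_real (sin \<phi>a) + b * of_real (cos \<phi>a))"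
        by (simp add: algebra_simps)
      then have "b = 0" unfolding e1 e2 sc by simp
      show ?thesis using \<open>a = 0\<close> \<open>b = 0\<close> by simp
    qed
    show "set_integrable \<mu> B R" if "B \<in> sets borel" "bounded B" for B by (rule tr(4)[OF that])
    show "emeasure \<mu> B < \<infinity>" if "B \<in> sets borel" "bounded B" for B using tr(3)[OF that] by simp
    show "projection_valued_measure ?M E" using assms(12) by (simp add: spectral_measure_of_def)
    show "L2_inner ?M (E {t1<..t2} f) g = inner_matrix \<mu> R (\<lambda>t. indicator {t1<..t2} t *s transform L \<theta> \<phi> f t) (transform L \<theta> \<phi> g)"
      if "f \<in> L2 ?M" "compactly_supported L f" "g \<in> L2 ?M" "compactly_supported L g" "t1 < t2" for f g t1 t2
      by (rule assms(13)[OF that])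
    show "transform L \<theta> \<phi> f \<in> L2_matrix \<mu> R \<and> eq_matrix \<mu> R (F f) (transform L \<theta> \<phi> f)"
      if "f \<in> L2 ?M" "compactly_supported L f" for f
      using assms(14) that by (simp add: isometric_extension_def)
  qed
  show ?thesis
  proof (intro conjI ballI allI impI)
    show "unitary ?M \<mu> R F" unfolding unitary_def using iso F_surj by blast
    show "operator_S L v = {(f, h). f \<in> L2 ?M \<and>
         (\<exists>k. (F f, k) \<in> mult_id \<mu> R \<and> (k, h) \<in> adjoint_transform ?M \<mu> R F)}"
      by (rule spectral_representation[OF assms(3,12)])
  next
    fix g f assume g: "g \<in> L2_matrix \<mu> R" and f: "f \<in> L2 ?M" "eq_matrix \<mu> R (F f) g"
    show "set_integrable \<mu> {-N..<N} (inversion_integrand \<theta> \<phi> R g x)" if "x \<in> ?I" for N x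
      by (rule inversion_integrand_integrable[OF g that])
    show "(\<lambda>x. LINT t:{-N..<N}|\<mu>. inversion_integrand \<theta> \<phi> R g x t) \<in> L2 ?M" for N
      using truncated_inverse_L2[OF g, of N] by (simp add: truncated_inverse_def[abs_def])
    show "((\<lambda>N. L2_norm ?M (\<lambda>x. (LINT t:{-N..<N}|\<mu>. inversion_integrand \<theta> \<phi> R g x t) - f x)) \<longlongrightarrow> 0) at_top"
      using truncation_tendsto[OF g] unfolding truncated_inverse_norm_diff[OF g f, symmetric] by (simp add: truncated_inverse_def)
  qed
qed

end
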